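(* Let $p\geq 1$ and $k\geq 0$ be integers. The manifold $L(p,1)\times S^1\#k\overline{\mathbb{CP}^2}$ admits a twisted generalized complex structure if and only if it admits an almost complex structure.
   Context: $L(p,1)$ is the $3$-dimensional lens space with fundamental group $\mathbb{Z}/p\mathbb{Z}$ (with $L(1,1)=S^3$); $\#k\overline{\mathbb{CP}^2}$ means connected sum with $k$ copies of $\mathbb{CP}^2$ with the opposite orientation. Let $M$ be a smooth manifold of even dimension and $H$ a closed $3$-form on $M$. The bundle $TM\oplus T^*M$ carries the symmetric pairing $\langle X+\xi,Y+\eta\rangle=\frac12(\eta(X)+\xi(Y))$ and, on sections, the Courant bracket $[X+\xi,Y+\eta]_H=[X,Y]+\mathcal{L}_X\eta-\mathcal{L}_Y\xi-\frac12 d(\eta(X)-\xi(Y))+i_Yi_XH$. A twisted generalized complex structure $(M,H,\mathcal{J})$ is a complex structure $\mathcal{J}$ on the bundle $TM\oplus T^*M$ ($\mathcal{J}^2=-1$) that preserves the pairing and whose $+i$-eigenbundle $L\subset T_{\mathbb{C}}M\oplus T^*_{\mathbb{C}}M$ is closed under the Courant bracket. The closed $3$-form $H$ is part of the structure. *)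

theory Defs
  imports "HOL-Analysis.Analysis"
begin

section \<open>Smooth maps\<close>

text \<open>Only used for open \<open>S\<close>. All partial derivatives of order at most \<open>n\<close> exist and are continuous.\<close>

primrec Ck_on :: "nat \<Rightarrow> 'a::euclidean_space set \<Rightarrow> ('a \<Rightarrow> 'b::real_normed_vector) \<Rightarrow> bool" where
  "Ck_on 0 S f \<longleftrightarrow> continuous_on S f"
| "Ck_on (Suc n) S f \<longleftrightarrow>
     (\<forall>x\<in>S. f differentiable (at x)) \<and> (\<forall>v. Ck_on n S (\<lambda>x. frechet_derivative f (at x) v))"

definition smooth_on :: "'a::euclidean_space set \<Rightarrow> ('a \<Rightarrow> 'b::real_normed_vector) \<Rightarrow> bool" where
  "smooth_on S f \<longleftrightarrow> (\<forall>n. Ck_on n S f)"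


section \<open>Atlases\<close>

text \<open>
  A manifold is given by an atlas. A chart is a pair \<open>(U, \<phi>)\<close> where \<open>\<phi>\<close> is injective on \<open>U\<close> with open
  image in the model space; the values of \<open>\<phi>\<close> off \<open>U\<close> are irrelevant. The underlying set is the
  union of the chart domains and its topology is the one for which all charts are homeomorphisms.
  The atlases below are not maximal, and they are oriented: their transition maps preserve the
  orientation of the model space.
\<close>

type_synonym ('a, 'e) chart = "'a set \<times> ('a \<Rightarrow> 'e)"
type_synonym ('a, 'e) atlas = "('a, 'e) chart set"

definition atlas_open :: "('a, 'e::euclidean_space) atlas \<Rightarrow> 'a set \<Rightarrow> bool" where
  "atlas_open A W \<longleftrightarrow> W \<subseteq> (\<Union>(U, \<phi>)\<in>A. U) \<and> (\<forall>(U, \<phi>)\<in>A. open (\<phi> ` (U \<inter> W)))"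

definition transition_deriv ::
  "('a, 'e) chart \<Rightarrow> ('a, 'e) chart \<Rightarrow> 'a \<Rightarrow> 'e::euclidean_space \<Rightarrow> 'e" where
  "transition_deriv c d q =
     frechet_derivative (snd d \<circ> the_inv_into (fst c) (snd c)) (at (snd c q))"

text \<open>
  The atlas on the target of \<open>\<pi>\<close> making \<open>\<pi>\<close> a local diffeomorphism. It is used for covering
  projections whose deck transformations are orientation preserving diffeomorphisms, and for
  open embeddings.
\<close>

definition push_atlas :: "('a \<Rightarrow> 'b) \<Rightarrow> ('a, 'e::euclidean_space) atlas \<Rightarrow> ('b, 'e) atlas" where
  "push_atlas \<pi> A =
     {(\<pi> ` V, \<phi> \<circ> the_inv_into V \<pi>) | U \<phi> V. (U, \<phi>) \<in> A \<and> V \<subseteq> U \<and> atlas_open A V \<and> inj_on \<pi> V}"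

definition restrict_atlas :: "'a set \<Rightarrow> ('a, 'e) atlas \<Rightarrow> ('a, 'e) atlas" where
  "restrict_atlas W A = {(U \<inter> W, \<phi>) | U \<phi>. (U, \<phi>) \<in> A}"

definition product_atlas :: "('a, 'e) atlas \<Rightarrow> ('b, 'f) atlas \<Rightarrow> ('a \<times> 'b, 'e \<times> 'f) atlas" where
  "product_atlas A B = {(U \<times> V, map_prod \<phi> \<psi>) | U \<phi> V \<psi>. (U, \<phi>) \<in> A \<and> (V, \<psi>) \<in> B}"

text \<open>
  Postcomposition of all charts with a linear isomorphism of model spaces. If this reverses the
  orientation, the result is the same manifold with the opposite orientation.
\<close>

definition remodel_atlas :: "('e \<Rightarrow> 'f) \<Rightarrow> ('a, 'e) atlas \<Rightarrow> ('a, 'f) atlas" where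
  "remodel_atlas T A = {(U, T \<circ> \<phi>) | U \<phi>. (U, \<phi>) \<in> A}"


section \<open>Connected sums\<close>

text \<open>
  The connected sum of \<open>A\<close> with \<open>k\<close> copies of \<open>B\<close>, following Kervaire and Milnor. The maps
  \<open>i l\<close> (for \<open>l < k\<close>) are orientation preserving embeddings of the open unit ball into \<open>A\<close> with
  disjoint images, and \<open>j\<close> is an orientation reversing embedding of the open unit ball into \<open>B\<close>.
  The centres of all balls are deleted, and \<open>i l (t u)\<close> is identified with the point
  \<open>j ((1 - t) u)\<close> of the \<open>l\<close>-th copy of \<open>B\<close>, for \<open>0 < t < 1\<close> and unit vectors \<open>u\<close>.
\<close>

definition glue_rel ::
  "nat \<Rightarrow> (nat \<Rightarrow> 'e::euclidean_space \<Rightarrow> 'a) \<Rightarrow> ('e \<Rightarrow> 'b) \<Rightarrow> ('a + nat \<times> 'b) rel" where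
  "glue_rel k i j =
     {(Inl (i l (t *\<^sub>R u)), Inr (l, j ((1 - t) *\<^sub>R u))) | l t u. l < k \<and> 0 < t \<and> t < 1 \<and> norm u = 1}"

definition glue_proj ::
  "nat \<Rightarrow> (nat \<Rightarrow> 'e::euclidean_space \<Rightarrow> 'a) \<Rightarrow> ('e \<Rightarrow> 'b) \<Rightarrow> 'a + nat \<times> 'b \<Rightarrow> ('a + nat \<times> 'b) set" where
  "glue_proj k i j x = (glue_rel k i j \<union> (glue_rel k i j)\<inverse>)\<^sup>* `` {x}"

definition connected_sum_copies ::
  "('a, 'e::euclidean_space) atlas \<Rightarrow> nat \<Rightarrow> ('b, 'e) atlas \<Rightarrow> (nat \<Rightarrow> 'e \<Rightarrow> 'a) \<Rightarrow> ('e \<Rightarrow> 'b)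
     \<Rightarrow> (('a + nat \<times> 'b) set, 'e) atlas" where
  "connected_sum_copies A k B i j =
     push_atlas (\<lambda>x. glue_proj k i j (Inl x)) (restrict_atlas (- {i l 0 | l. l < k}) A) \<union>
     (\<Union>l<k. push_atlas (\<lambda>y. glue_proj k i j (Inr (l, y))) (restrict_atlas (- {j 0}) B))"


section \<open>The manifold\<close>

text \<open>
  The stereographic projections of the unit sphere in \<open>\<complex>\<^sup>2\<close> from \<open>(0, \<i>)\<close> and \<open>(0, -\<i>)\<close>; the
  conjugation makes the second one compatible with the orientation of the first one, which is the
  boundary orientation of the sphere.
\<close>

definition sphere3 :: "(complex \<times> complex, complex \<times> real) atlas" where
  "sphere3 =
     {(sphere 0 1 - {(0, \<i>)},  \<lambda>(z, w). (z / of_real (1 - Im w), Re w / (1 - Im w))),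
      (sphere 0 1 - {(0, -\<i>)}, \<lambda>(z, w). (cnj z / of_real (1 + Im w), Re w / (1 + Im w)))}"

definition lens_proj :: "nat \<Rightarrow> complex \<times> complex \<Rightarrow> (complex \<times> complex) set" where
  "lens_proj p = (\<lambda>(z, w). {(\<zeta> * z, \<zeta> * w) | \<zeta>. \<zeta> ^ p = 1})"

definition lens_space :: "nat \<Rightarrow> ((complex \<times> complex) set, complex \<times> real) atlas" where
  "lens_space p = push_atlas (lens_proj p) sphere3"

text \<open>The unit circle in \<open>\<complex>\<close>, with angles as charts.\<close>

definition circle :: "(complex, real) atlas" where
  "circle = push_atlas cis {(UNIV, id)}"

definition lens_circle :: "nat \<Rightarrow> ((complex \<times> complex) set \<times> complex, complex \<times> complex) atlas" where
  "lens_circle p =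
     remodel_atlas (\<lambda>((z, s), t). (z, Complex s t)) (product_atlas (lens_space p) circle)"

definition cline :: "complex \<times> complex \<times> complex \<Rightarrow> (complex \<times> complex \<times> complex) set" where
  "cline = (\<lambda>(x, y, z). {(a * x, a * y, a * z) | a. True})"

text \<open>The complex projective plane with its affine charts, which give it the complex orientation.\<close>

definition CP2 :: "((complex \<times> complex \<times> complex) set, complex \<times> complex) atlas" where
  "CP2 = {(range \<psi>, the_inv \<psi>) | \<psi>.
     \<psi> \<in> {\<lambda>(a, b). cline (1, a, b), \<lambda>(a, b). cline (a, 1, b), \<lambda>(a, b). cline (a, b, 1)}}"

definition CP2_bar :: "((complex \<times> complex \<times> complex) set, complex \<times> complex) atlas" where
  "CP2_bar = remodel_atlas (\<lambda>(a, b). (cnj a, b)) CP2"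

text \<open>
  The \<open>l\<close>-th ball in \<open>L(p,1) \<times> S\<^sup>1\<close> is the image of a small round ball in \<open>\<complex>\<^sup>2 - {0}\<close> with centre on
  the first axis. The sign in the circle coordinate makes it orientation preserving. Its radius
  relative to its centre is so small that the ball embeds and that the balls for \<open>l < k\<close>
  are disjoint.
\<close>

definition lens_circle_ball ::
  "nat \<Rightarrow> nat \<Rightarrow> nat \<Rightarrow> complex \<times> complex \<Rightarrow> (complex \<times> complex) set \<times> complex" where
  "lens_circle_ball p k l v =
     (let w = exp (real l / real (k + 1)) *\<^sub>R ((1, 0) + (1 / (4 * real p * real (k + 1))) *\<^sub>R v)
      in (lens_proj p (w /\<^sub>R norm w), cis (- ln (norm w))))"

text \<open>
  A geodesic ball around \<open>[1:0:0]\<close>: a diffeomorphism from the open unit ball onto the complement of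
  a line which preserves the complex orientation, hence reverses that of \<open>CP2_bar\<close>.
\<close>

definition CP2_ball :: "complex \<times> complex \<Rightarrow> (complex \<times> complex \<times> complex) set" where
  "CP2_ball v =
     cline (of_real (cos (pi / 2 * norm v)), (sin (pi / 2 * norm v) / norm v) *\<^sub>R v)"

definition lens_circle_sum_CP2_bar ::
  "nat \<Rightarrow> nat \<Rightarrow>
    (((complex \<times> complex) set \<times> complex + nat \<times> (complex \<times> complex \<times> complex) set) set,
     complex \<times> complex) atlas" where
  "lens_circle_sum_CP2_bar p k =
     connected_sum_copies (lens_circle p) k CP2_bar (lens_circle_ball p k) CP2_ball"


section \<open>Almost complex structures\<close>

text \<open>
  Tensor fields are given by their coordinate expressions in every chart of the atlas,
  subject to the transformation law under changes of charts.
\<close>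

definition almost_complex_structure ::
  "('a, 'e::euclidean_space) atlas \<Rightarrow> (('a, 'e) chart \<Rightarrow> 'e \<Rightarrow> 'e \<Rightarrow> 'e) \<Rightarrow> bool" where
  "almost_complex_structure A J \<longleftrightarrow>
     (\<forall>c\<in>A. (\<forall>v. smooth_on (snd c ` fst c) (\<lambda>x. J c x v)) \<and>
        (\<forall>x \<in> snd c ` fst c. linear (J c x) \<and> (\<forall>v. J c x (J c x v) = - v))) \<and>
     (\<forall>c\<in>A. \<forall>d\<in>A. \<forall>q \<in> fst c \<inter> fst d. \<forall>v.
        transition_deriv c d q (J c (snd c q) v) = J d (snd d q) (transition_deriv c d q v))"


section \<open>Twisted generalized complex structures\<close>

subsection \<open>The Courant bracket on an open subset of a vector space\<close>

text \<open>\<open>(X, \<xi>)\<close> stands for the element \<open>X + \<xi>\<close> of the fibre of \<open>TM \<oplus> T\<^sup>*M\<close>.\<close>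

type_synonym 'e gtan = "'e \<times> ('e \<Rightarrow>\<^sub>L real)"

definition pairing :: "'e::euclidean_space gtan \<Rightarrow> 'e gtan \<Rightarrow> real" where
  "pairing = (\<lambda>(X, \<xi>) (Y, \<eta>). (blinfun_apply \<eta> X + blinfun_apply \<xi> Y) / 2)"

definition lie_bracket :: "('e::euclidean_space \<Rightarrow> 'e) \<Rightarrow> ('e \<Rightarrow> 'e) \<Rightarrow> 'e \<Rightarrow> 'e" where
  "lie_bracket X Y x = frechet_derivative Y (at x) (X x) - frechet_derivative X (at x) (Y x)"

definition lie_deriv_1form ::
  "('e::euclidean_space \<Rightarrow> 'e) \<Rightarrow> ('e \<Rightarrow> 'e \<Rightarrow>\<^sub>L real) \<Rightarrow> 'e \<Rightarrow> 'e \<Rightarrow>\<^sub>L real" where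
  "lie_deriv_1form X \<eta> x = Blinfun (\<lambda>v.
     blinfun_apply (frechet_derivative \<eta> (at x) (X x)) v +
     blinfun_apply (\<eta> x) (frechet_derivative X (at x) v))"

definition d_fun :: "('e::euclidean_space \<Rightarrow> real) \<Rightarrow> 'e \<Rightarrow> 'e \<Rightarrow>\<^sub>L real" where
  "d_fun f x = Blinfun (frechet_derivative f (at x))"

definition courant ::
  "('e::euclidean_space \<Rightarrow> 'e \<Rightarrow> 'e \<Rightarrow> 'e \<Rightarrow> real) \<Rightarrow> ('e \<Rightarrow> 'e gtan) \<Rightarrow> ('e \<Rightarrow> 'e gtan) \<Rightarrow> 'e \<Rightarrow> 'e gtan"
  where
  "courant H s t x =
     (let X = fst \<circ> s; \<xi> = snd \<circ> s; Y = fst \<circ> t; \<eta> = snd \<circ> t in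
      (lie_bracket X Y x,
       lie_deriv_1form X \<eta> x - lie_deriv_1form Y \<xi> x
       - (1/2) *\<^sub>R d_fun (\<lambda>y. blinfun_apply (\<eta> y) (X y) - blinfun_apply (\<xi> y) (Y y)) x
       + Blinfun (H x (X x) (Y x))))"


subsection \<open>Global notions\<close>

definition closed_3form ::
  "('a, 'e::euclidean_space) atlas \<Rightarrow> (('a, 'e) chart \<Rightarrow> 'e \<Rightarrow> 'e \<Rightarrow> 'e \<Rightarrow> 'e \<Rightarrow> real) \<Rightarrow> bool" where
  "closed_3form A H \<longleftrightarrow>
     (\<forall>c\<in>A. (\<forall>u v w. smooth_on (snd c ` fst c) (\<lambda>x. H c x u v w)) \<and>
        (\<forall>x \<in> snd c ` fst c.
           (\<forall>u v. linear (\<lambda>w. H c x w u v) \<and> linear (\<lambda>w. H c x u w v) \<and> linear (\<lambda>w. H c x u v w)) \<and>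
           (\<forall>u v. H c x u u v = 0 \<and> H c x u v v = 0) \<and>
           (\<forall>u0 u1 u2 u3.
              frechet_derivative (\<lambda>y. H c y u1 u2 u3) (at x) u0
              - frechet_derivative (\<lambda>y. H c y u0 u2 u3) (at x) u1
              + frechet_derivative (\<lambda>y. H c y u0 u1 u3) (at x) u2
              - frechet_derivative (\<lambda>y. H c y u0 u1 u2) (at x) u3 = 0))) \<and>
     (\<forall>c\<in>A. \<forall>d\<in>A. \<forall>q \<in> fst c \<inter> fst d. \<forall>u v w.
        H c (snd c q) u v w =
        H d (snd d q) (transition_deriv c d q u) (transition_deriv c d q v) (transition_deriv c d q w))"

text \<open>
  \<open>g\<close> and \<open>h\<close> are the coordinates of the same element of the fibre of \<open>TM \<oplus> T\<^sup>*M\<close> at \<open>q\<close>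
  in the charts \<open>c\<close> and \<open>d\<close>.
\<close>

definition same_gtan ::
  "('a, 'e) chart \<Rightarrow> ('a, 'e) chart \<Rightarrow> 'a \<Rightarrow> 'e::euclidean_space gtan \<Rightarrow> 'e gtan \<Rightarrow> bool" where
  "same_gtan c d q g h \<longleftrightarrow>
     fst h = transition_deriv c d q (fst g) \<and>
     (\<forall>v. blinfun_apply (snd g) v = blinfun_apply (snd h) (transition_deriv c d q v))"

definition smooth_gsection ::
  "('a, 'e::euclidean_space) atlas \<Rightarrow> 'a set \<Rightarrow> (('a, 'e) chart \<Rightarrow> 'e \<Rightarrow> 'e gtan) \<Rightarrow> bool" where
  "smooth_gsection A W s \<longleftrightarrow>
     (\<forall>c\<in>A. smooth_on (snd c ` (fst c \<inter> W)) (s c)) \<and>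
     (\<forall>c\<in>A. \<forall>d\<in>A. \<forall>q \<in> fst c \<inter> fst d \<inter> W. same_gtan c d q (s c (snd c q)) (s d (snd d q)))"

text \<open>
  The complex section \<open>s + \<i> s'\<close> over \<open>W\<close>, with \<open>s\<close> and \<open>s'\<close> real, takes values in the
  \<open>+\<i>\<close>-eigenbundle of (the complex linear extension of) \<open>J\<close>.
\<close>

definition in_eigenbundle ::
  "('a, 'e::euclidean_space) atlas \<Rightarrow> (('a, 'e) chart \<Rightarrow> 'e \<Rightarrow> 'e gtan \<Rightarrow> 'e gtan) \<Rightarrow> 'a set
     \<Rightarrow> (('a, 'e) chart \<Rightarrow> 'e \<Rightarrow> 'e gtan) \<Rightarrow> (('a, 'e) chart \<Rightarrow> 'e \<Rightarrow> 'e gtan) \<Rightarrow> bool" where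
  "in_eigenbundle A J W s s' \<longleftrightarrow>
     (\<forall>c\<in>A. \<forall>x \<in> snd c ` (fst c \<inter> W). J c x (s c x) = - s' c x \<and> J c x (s' c x) = s c x)"

text \<open>
  In the last conjunct the Courant bracket is extended complex bilinearly to
  \<open>s + \<i> s'\<close> and \<open>t + \<i> t'\<close>.
\<close>

definition twisted_generalized_complex_structure ::
  "('a, 'e::euclidean_space) atlas \<Rightarrow> (('a, 'e) chart \<Rightarrow> 'e \<Rightarrow> 'e \<Rightarrow> 'e \<Rightarrow> 'e \<Rightarrow> real)
     \<Rightarrow> (('a, 'e) chart \<Rightarrow> 'e \<Rightarrow> 'e gtan \<Rightarrow> 'e gtan) \<Rightarrow> bool" where
  "twisted_generalized_complex_structure A H J \<longleftrightarrow>
     closed_3form A H \<and>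
     (\<forall>c\<in>A. (\<forall>g. smooth_on (snd c ` fst c) (\<lambda>x. J c x g)) \<and>
        (\<forall>x \<in> snd c ` fst c. linear (J c x) \<and> (\<forall>g. J c x (J c x g) = - g) \<and>
           (\<forall>g h. pairing (J c x g) (J c x h) = pairing g h))) \<and>
     (\<forall>c\<in>A. \<forall>d\<in>A. \<forall>q \<in> fst c \<inter> fst d. \<forall>g h.
        same_gtan c d q g h \<longrightarrow> same_gtan c d q (J c (snd c q) g) (J d (snd d q) h)) \<and>
     (\<forall>W s s' t t'.
        atlas_open A W \<and>
        smooth_gsection A W s \<and> smooth_gsection A W s' \<and> in_eigenbundle A J W s s' \<and>
        smooth_gsection A W t \<and> smooth_gsection A W t' \<and> in_eigenbundle A J W t t' \<longrightarrow>
        in_eigenbundle A J W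
          (\<lambda>c x. courant (H c) (s c) (t c) x - courant (H c) (s' c) (t' c) x)
          (\<lambda>c x. courant (H c) (s c) (t' c) x + courant (H c) (s' c) (t c) x))"

end

theory Submission
  imports Defs
begin

text \<open>
  Both sides of the equivalence are true, for all \<open>p \<ge> 1\<close> and \<open>k\<close>, because the manifold underlies a
  complex surface. Scalar multiplication by \<open>p\<close>-th roots of unity and by \<open>exp (2 * pi)\<close> generates a
  group acting freely on \<open>\<complex>\<^sup>2 - {0}\<close> whose quotient is \<open>L(p,1) \<times> S\<^sup>1\<close>, a Hopf surface. Connected sum with
  \<open>CP2_bar\<close> is the smooth form of blowing up a point: the complement of a point in the projective
  plane is a disc bundle over the line at infinity, and reversing the orientation turns this bundle
  into the tautological one, whose total space is a blown-up ball. So the manifold is a Hopf surface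
  blown up at \<open>k\<close> points.

  A complex structure \<open>J\<close> is almost complex, and together with \<open>H = 0\<close> it gives the generalized complex
  structure sending \<open>X + \<xi>\<close> to \<open>J X - \<xi> \<circ> J\<close>. Its \<open>+\<i>\<close>-eigenbundle consists of vectors of type (1,0)
  and forms of type (0,1). In a chart, \<open>J\<close> is conjugate to a constant matrix under the differential of a
  map, so its Nijenhuis tensor vanishes (\<open>nijenhuis_zero\<close>), and this is what closure of the
  eigenbundle under the Courant bracket needs (\<open>courant_type\<close>).

  To have \<open>J\<close> on the given atlas it suffices to parametrize the manifold locally by maps from \<open>\<complex>\<^sup>2\<close>
  which are diffeomorphisms in the given charts and differ by holomorphic maps; this is the
  locale \<open>holomorphic_cover\<close>. The parametrizations are the covering \<open>hopf\<close> of \<open>L(p,1) \<times> S\<^sup>1\<close> and the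
  two standard coordinate systems \<open>(a, b)\<close> of a blown-up ball, with blow-down maps \<open>(a, ab)\<close> and
  \<open>(ab, a)\<close>. The gluing map of the connected sum turns out to be exactly the blow-down
  (\<open>CP2_ball_blowdown\<close>), provided that the fibres of the projective plane are
  rescaled by a tangent (\<open>fibre_coord\<close>). As the balls in \<open>L(p,1) \<times> S\<^sup>1\<close> are affine in the coordinates
  of \<open>\<complex>\<^sup>2\<close>, all changes of parameters are holomorphic (\<open>pieces_linked\<close>).
\<close>

section \<open>Germs of smooth maps\<close>

lemma Ck_on_cong:
  assumes "open S" "\<And>x. x \<in> S \<Longrightarrow> f x = g x" "Ck_on n S f"
  shows "Ck_on n S g"
  using assms(2,3)
proof (induction n arbitrary: f g)
  case 0
  then show ?case using continuous_on_cong by force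
next
  case (Suc n)
  have *: "(g has_derivative frechet_derivative f (at x)) (at x)" if "x \<in> S" for x
    using has_derivative_transform_within_open[OF _ assms(1) that] Suc.prems that frechet_derivative_works
    by (metis Ck_on.simps(2))
  have "Ck_on n S (\<lambda>x. frechet_derivative g (at x) v)" for v
    by (rule Suc.IH[of "\<lambda>x. frechet_derivative f (at x) v"])
      (use Suc.prems frechet_derivative_at[OF *] in auto)
  then show ?case using * by (auto simp: differentiable_def)
qed

lemma Ck_onI:
  assumes "open S" "\<And>x. x \<in> S \<Longrightarrow> (f has_derivative f' x) (at x)"
    "\<And>v. Ck_on n S (\<lambda>x. f' x v)"
  shows "Ck_on (Suc n) S f"
proof -
  have *: "f' x = frechet_derivative f (at x)" if "x \<in> S" for x
    using frechet_derivative_at[OF assms(2)[OF that]] .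
  have "Ck_on n S (\<lambda>x. frechet_derivative f (at x) v)" for v
    by (rule Ck_on_cong[OF assms(1) _ assms(3)[of v]]) (simp add: *)
  then show ?thesis using assms(2) by (auto simp: differentiable_def)
qed

lemma Ck_on_subset: "Ck_on n S f \<Longrightarrow> T \<subseteq> S \<Longrightarrow> Ck_on n T f"
  by (induction n arbitrary: f) (auto intro: continuous_on_subset)

lemma Ck_on_Int: "Ck_on n S f \<Longrightarrow> Ck_on n (S \<inter> T) f" "Ck_on n T f \<Longrightarrow> Ck_on n (S \<inter> T) f"
  by (auto elim: Ck_on_subset)

lemma Ck_on_local:
  "(\<And>x. x \<in> S \<Longrightarrow> \<exists>T. open T \<and> x \<in> T \<and> Ck_on n T f) \<Longrightarrow> Ck_on n S f"
proof (induction n arbitrary: f)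
  case 0
  have "isCont f x" if "x \<in> S" for x
    using 0[OF that] by (auto simp: continuous_on_eq_continuous_at)
  then show ?case by (simp add: continuous_at_imp_continuous_on)
next
  case (Suc n)
  show ?case
  proof (simp, intro conjI ballI allI)
    fix x assume "x \<in> S" then show "f differentiable at x" using Suc.prems by fastforce
  next
    fix v show "Ck_on n S (\<lambda>x. frechet_derivative f (at x) v)"
      by (rule Suc.IH) (use Suc.prems in fastforce)
  qed
qed

lemma Ck_on_Suc_imp: "open S \<Longrightarrow> Ck_on (Suc n) S f \<Longrightarrow> Ck_on n S f"
proof (induction n arbitrary: f)
  case 0
  then show ?case
    by (auto intro!: continuous_at_imp_continuous_on differentiable_imp_continuous_within)
next
  case (Suc n)
  have "\<forall>v. Ck_on n S (\<lambda>x. frechet_derivative f (at x) v)"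
    using Suc by (metis Ck_on.simps(2))
  then show ?case using Suc.prems by simp
qed

lemma Ck_on_const [simp]: "Ck_on n S (\<lambda>x. c)"
  by (induction n arbitrary: c) auto

lemma Ck_on_bounded_linear:
  assumes "bounded_linear f"
  shows "Ck_on n S f"
proof (cases n)
  case 0
  then show ?thesis using assms by (simp add: linear_continuous_on)
next
  case (Suc m)
  have *: "frechet_derivative f (at x) = f" for x
    using frechet_derivative_at[OF bounded_linear_imp_has_derivative[OF assms]] by simp
  show ?thesis unfolding Suc
    using bounded_linear_imp_differentiable[OF assms] by (simp add: *)
qed

lemma Ck_on_add:
  "open S \<Longrightarrow> Ck_on n S f \<Longrightarrow> Ck_on n S g \<Longrightarrow> Ck_on n S (\<lambda>x. f x + g x)"
proof (induction n arbitrary: f g)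
  case 0
  then show ?case by (auto intro: continuous_on_add)
next
  case (Suc n)
  have "((\<lambda>x. f x + g x) has_derivative
      (\<lambda>v. frechet_derivative f (at x) v + frechet_derivative g (at x) v)) (at x)" if "x \<in> S" for x
    using Suc.prems that by (auto intro!: has_derivative_add simp flip: frechet_derivative_works)
  then show ?case by (rule Ck_onI[OF Suc.prems(1)]) (use Suc in auto)
qed

lemma Ck_on_bilinear:
  assumes "bounded_bilinear m" "open S"
  shows "Ck_on n S f \<Longrightarrow> Ck_on n S g \<Longrightarrow> Ck_on n S (\<lambda>x. m (f x) (g x))"
proof (induction n arbitrary: f g)
  case 0
  then show ?case using bounded_bilinear.continuous_on[OF assms(1)] by auto
next
  case (Suc n)
  have "((\<lambda>x. m (f x) (g x)) has_derivative
      (\<lambda>v. m (f x) (frechet_derivative g (at x) v) + m (frechet_derivative f (at x) v) (g x))) (at x)"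
    if "x \<in> S" for x
    using Suc.prems that
    by (intro bounded_bilinear.FDERIV[OF assms(1)]) (simp_all flip: frechet_derivative_works)
  then show ?case
  proof (rule Ck_onI[OF assms(2)])
    show "Ck_on n S (\<lambda>x. m (f x) (frechet_derivative g (at x) v) + m (frechet_derivative f (at x) v) (g x))" for v
      using Ck_on_Suc_imp[OF assms(2) Suc.prems(1)] Ck_on_Suc_imp[OF assms(2) Suc.prems(2)] Suc.prems
      by (intro Ck_on_add[OF assms(2)] Suc.IH) auto
  qed
qed

lemma Ck_on_sum:
  assumes "open S" "\<And>i. i \<in> I \<Longrightarrow> Ck_on n S (f i)"
  shows "Ck_on n S (\<lambda>x. \<Sum>i\<in>I. f i x)"
  using assms(2) by (induction I rule: infinite_finite_induct) (auto intro: Ck_on_add[OF assms(1)])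

lemma linear_sum_Basis:
  fixes L :: "'a::euclidean_space \<Rightarrow> 'b::real_vector"
  assumes "linear L"
  shows "L v = (\<Sum>b\<in>Basis. (v \<bullet> b) *\<^sub>R L b)"
  by (subst euclidean_representation[symmetric]) (simp add: linear_sum[OF assms] linear_cmul[OF assms])

lemma Ck_on_compose:
  fixes f :: "'a::euclidean_space \<Rightarrow> 'b::euclidean_space"
  assumes "open S" "open T" "f ` S \<subseteq> T"
  shows "Ck_on n S f \<Longrightarrow> Ck_on n T g \<Longrightarrow> Ck_on n S (\<lambda>x. g (f x))"
proof (induction n arbitrary: g)
  case 0
  then show ?case using assms(3) by (auto intro: continuous_on_compose2)
next
  case (Suc n)
  let ?D = "\<lambda>x v. frechet_derivative g (at (f x)) (frechet_derivative f (at x) v)"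
  have d: "g differentiable (at (f x))" if "x \<in> S" for x
    using Suc.prems that assms(3) by auto
  have 1: "((\<lambda>x. g (f x)) has_derivative ?D x) (at x)" if "x \<in> S" for x
    by (rule has_derivative_compose) (use Suc.prems that d[OF that] in \<open>simp_all flip: frechet_derivative_works\<close>)
  have 2: "Ck_on n S (\<lambda>x. \<Sum>b\<in>Basis. (frechet_derivative f (at x) v \<bullet> b) *\<^sub>R frechet_derivative g (at (f x)) b)" for v
  proof (rule Ck_on_sum[OF assms(1)])
    fix b :: 'b
    have "Ck_on n S (\<lambda>x. frechet_derivative f (at x) v)" "Ck_on n T (\<lambda>y. frechet_derivative g (at y) b)"
      using Suc.prems by auto
    then have "Ck_on n S (\<lambda>x. frechet_derivative g (at (f x)) b)"
      "Ck_on n S (\<lambda>x. frechet_derivative f (at x) v \<bullet> b)"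
      using Suc.IH[of "\<lambda>y. frechet_derivative g (at y) b"] Ck_on_Suc_imp[OF assms(1) Suc.prems(1)]
        Ck_on_bilinear[OF bounded_bilinear_inner assms(1) _ Ck_on_const[of n S b]]
      by blast+
    then show "Ck_on n S (\<lambda>x. (frechet_derivative f (at x) v \<bullet> b) *\<^sub>R frechet_derivative g (at (f x)) b)"
      using Ck_on_bilinear[OF bounded_bilinear_scaleR assms(1)] by blast
  qed
  have 3: "(\<Sum>b\<in>Basis. (frechet_derivative f (at x) v \<bullet> b) *\<^sub>R frechet_derivative g (at (f x)) b) = ?D x v"
    if "x \<in> S" for x v
    using linear_sum_Basis[OF linear_frechet_derivative[OF d[OF that]]] by metis
  show ?case
    by (rule Ck_onI[OF assms(1) 1 Ck_on_cong[OF assms(1) 3 2]])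
qed

text \<open>Smoothness of the germ of a map at a point: composing such germs needs no bookkeeping of
  domains.\<close>

definition smooth_at :: "('a::euclidean_space \<Rightarrow> 'b::real_normed_vector) \<Rightarrow> 'a \<Rightarrow> bool" where
  "smooth_at f x \<longleftrightarrow> (\<exists>N. open N \<and> x \<in> N \<and> smooth_on N f)"

lemma smooth_atI: "open N \<Longrightarrow> x \<in> N \<Longrightarrow> (\<And>n. Ck_on n N f) \<Longrightarrow> smooth_at f x"
  by (auto simp: smooth_at_def smooth_on_def)

lemma smooth_at_imp_smooth_on: "(\<And>x. x \<in> S \<Longrightarrow> smooth_at f x) \<Longrightarrow> smooth_on S f"
  unfolding smooth_on_def smooth_at_def by (intro allI Ck_on_local) blast

lemma smooth_on_imp_smooth_at: "smooth_on S f \<Longrightarrow> open S \<Longrightarrow> x \<in> S \<Longrightarrow> smooth_at f x"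
  by (auto simp: smooth_at_def)

lemma smooth_at_eventually: "smooth_at f x \<Longrightarrow> eventually (smooth_at f) (nhds x)"
  unfolding smooth_at_def eventually_nhds by blast

lemma smooth_at_cong:
  assumes "eventually (\<lambda>z. f z = g z) (nhds x)" "smooth_at f x"
  shows "smooth_at g x"
proof -
  obtain N T where "open N" "x \<in> N" "\<And>n. Ck_on n N f" "open T" "x \<in> T" "\<And>z. z \<in> T \<Longrightarrow> f z = g z"
    using assms by (auto simp: smooth_at_def smooth_on_def eventually_nhds)
  then show ?thesis
    using Ck_on_cong[of "N \<inter> T" f g]
    by (intro smooth_atI[of "N \<inter> T"]) (auto simp: Ck_on_Int)
qed

lemma smooth_at_differentiable: "smooth_at f x \<Longrightarrow> f differentiable (at x)"
  unfolding smooth_at_def smooth_on_def by (metis Ck_on.simps(2))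

lemma smooth_at_has_derivative:
  "smooth_at f x \<Longrightarrow> (f has_derivative frechet_derivative f (at x)) (at x)"
  using smooth_at_differentiable frechet_derivative_works by blast

lemma smooth_at_linear: "smooth_at f x \<Longrightarrow> linear (frechet_derivative f (at x))"
  using smooth_at_differentiable linear_frechet_derivative by blast

lemma smooth_at_isCont: "smooth_at f x \<Longrightarrow> isCont f x"
  using smooth_at_differentiable differentiable_imp_continuous_within by blast

lemma smooth_at_filterlim: "smooth_at f x \<Longrightarrow> filterlim f (nhds (f x)) (nhds x)"
  using smooth_at_isCont by (simp add: isCont_def tendsto_nhds_iff)

lemma smooth_at_eventually_comp:
  "smooth_at f x \<Longrightarrow> eventually Q (nhds (f x)) \<Longrightarrow> eventually (\<lambda>z. Q (f z)) (nhds x)"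
  using smooth_at_filterlim[of f x] by (simp add: filterlim_iff)

lemma smooth_at_derivative: "smooth_at f x \<Longrightarrow> smooth_at (\<lambda>z. frechet_derivative f (at z) v) x"
  unfolding smooth_at_def smooth_on_def by (metis Ck_on.simps(2))

lemma smooth_at_const [simp, intro]: "smooth_at (\<lambda>x. c) x"
  by (rule smooth_atI[of UNIV]) auto

lemma smooth_at_bounded_linear: "bounded_linear f \<Longrightarrow> smooth_at f x"
  by (rule smooth_atI[of UNIV]) (auto intro: Ck_on_bounded_linear)

lemma smooth_at_compose:
  fixes f :: "'a::euclidean_space \<Rightarrow> 'b::euclidean_space"
  assumes "smooth_at g (f x)" "smooth_at f x"
  shows "smooth_at (\<lambda>z. g (f z)) x"
proof -
  obtain N T where N: "open N" "x \<in> N" "\<And>n. Ck_on n N f" and T: "open T" "f x \<in> T" "\<And>n. Ck_on n T g"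
    using assms by (auto simp: smooth_at_def smooth_on_def)
  have "continuous_on N f" using N(3)[of 0] by simp
  then have o: "open (f -` T \<inter> N)" by (simp add: continuous_on_open_vimage N T)
  show ?thesis
    using N T o Ck_on_compose[of "f -` T \<inter> N" T f _ g] Ck_on_subset[OF N(3), of "f -` T \<inter> N"]
    by (intro smooth_atI[OF o]) auto
qed

lemma smooth_at_bilinear:
  assumes "bounded_bilinear m" "smooth_at f x" "smooth_at g x"
  shows "smooth_at (\<lambda>x. m (f x) (g x)) x"
proof -
  obtain N T where "open N" "x \<in> N" "\<And>n. Ck_on n N f" "open T" "x \<in> T" "\<And>n. Ck_on n T g"
    using assms by (auto simp: smooth_at_def smooth_on_def)
  then show ?thesis
    using Ck_on_bilinear[OF assms(1), of "N \<inter> T" _ f g]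
    by (intro smooth_atI[of "N \<inter> T"]) (auto simp: Ck_on_Int)
qed

lemma smooth_at_add:
  assumes "smooth_at f x" "smooth_at g x"
  shows "smooth_at (\<lambda>x. f x + g x) x"
proof -
  obtain N T where "open N" "x \<in> N" "\<And>n. Ck_on n N f" "open T" "x \<in> T" "\<And>n. Ck_on n T g"
    using assms by (auto simp: smooth_at_def smooth_on_def)
  then show ?thesis
    using Ck_on_add[of "N \<inter> T" _ f g]
    by (intro smooth_atI[of "N \<inter> T"]) (auto simp: Ck_on_Int)
qed

named_theorems smooth "closure properties of smooth germs"

lemma smooth_at_linear_comp:
  assumes "bounded_linear L" "smooth_at f x"
  shows "smooth_at (\<lambda>x. L (f x)) x"
proof -
  have "bounded_bilinear (\<lambda>(r::real) y. r *\<^sub>R L y)"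
    using bounded_bilinear.comp[OF bounded_bilinear_scaleR bounded_linear_ident assms(1)] .
  \<comment> \<open>composition is available only between Euclidean spaces, but the values of \<open>f\<close> may be linear forms\<close>
  then show ?thesis using smooth_at_bilinear[of _ "\<lambda>_. 1" x f] assms by fastforce
qed

lemma smooth_at_ident [smooth]: "smooth_at (\<lambda>x. x) x"
  using smooth_at_bounded_linear bounded_linear_ident .

lemmas smooth_at_rules [smooth] =
  smooth_at_add smooth_at_const
  smooth_at_bilinear[OF bounded_bilinear_mult] smooth_at_bilinear[OF bounded_bilinear_scaleR]
  smooth_at_bilinear[OF bounded_bilinear_inner]
  smooth_at_linear_comp[OF bounded_linear_fst] smooth_at_linear_comp[OF bounded_linear_snd]
  smooth_at_linear_comp[OF bounded_linear_Re] smooth_at_linear_comp[OF bounded_linear_Im]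
  smooth_at_linear_comp[OF bounded_linear_cnj] smooth_at_linear_comp[OF bounded_linear_of_real]
  smooth_at_linear_comp[OF bounded_linear_minus[OF bounded_linear_ident]]

lemma smooth_at_minus [smooth]: "smooth_at f x \<Longrightarrow> smooth_at g x \<Longrightarrow> smooth_at (\<lambda>x. f x - g x) x"
  using smooth_at_add[OF _ smooth_at_rules(12), of f x g] by simp

lemma smooth_at_sum [smooth]:
  "(\<And>i. i \<in> I \<Longrightarrow> smooth_at (f i) x) \<Longrightarrow> smooth_at (\<lambda>x. \<Sum>i\<in>I. f i x) x"
  by (induction I rule: infinite_finite_induct) (simp_all add: smooth_at_add)

lemma smooth_at_Pair [smooth]:
  fixes f :: "_ \<Rightarrow> 'b::real_normed_vector" and g :: "_ \<Rightarrow> 'c::real_normed_vector"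
  assumes "smooth_at f x" "smooth_at g x"
  shows "smooth_at (\<lambda>x. (f x, g x)) x"
proof -
  have "bounded_linear (\<lambda>y :: 'b. (y, 0 :: 'c))" "bounded_linear (\<lambda>y :: 'c. (0 :: 'b, y))"
    using bounded_linear_Pair[OF bounded_linear_ident bounded_linear_zero]
      bounded_linear_Pair[OF bounded_linear_zero bounded_linear_ident] by auto
  then have "smooth_at (\<lambda>x. (f x, 0) + (0, g x)) x"
    using smooth_at_add[OF smooth_at_linear_comp[OF _ assms(1)] smooth_at_linear_comp[OF _ assms(2)]] by blast
  then show ?thesis by simp
qed

lemma Ck_on_inverse:
  "Ck_on n (- {0}) (inverse :: 'a \<Rightarrow> 'a::{euclidean_space, real_normed_field})"
proof (induction n)
  case 0
  then show ?case by (auto intro!: continuous_on_inverse continuous_on_id)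
next
  case (Suc n)
  show ?case
  proof (rule Ck_onI)
    show "(inverse has_derivative (\<lambda>h. - (inverse x * h * inverse x))) (at x)" if "x \<in> - {0}" for x :: 'a
      using Deriv.has_derivative_inverse[OF _ has_derivative_ident, of x UNIV] that by simp
    fix v :: 'a
    have "Ck_on n (- {0}) (\<lambda>x. - v * inverse x * inverse x)"
      by (intro Ck_on_bilinear[OF bounded_bilinear_mult] Suc.IH Ck_on_const) auto
    then show "Ck_on n (- {0}) (\<lambda>x. - (inverse x * v * inverse x))" by (simp add: mult.commute)
  qed auto
qed

lemma smooth_at_inverse [smooth]:
  fixes f :: "'a::euclidean_space \<Rightarrow> 'b::{euclidean_space, real_normed_field}"
  assumes "smooth_at f x" "f x \<noteq> 0"
  shows "smooth_at (\<lambda>x. inverse (f x)) x"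
  by (rule smooth_at_compose[OF smooth_atI[of "- {0}"] assms(1)]) (use assms(2) Ck_on_inverse in auto)

lemma smooth_at_divide [smooth]:
  fixes f g :: "'a::euclidean_space \<Rightarrow> 'b::{euclidean_space, real_normed_field}"
  assumes "smooth_at f x" "smooth_at g x" "g x \<noteq> 0"
  shows "smooth_at (\<lambda>x. f x / g x) x"
  using smooth_at_rules(3)[OF assms(1) smooth_at_inverse[OF assms(2,3)]] by (simp add: divide_inverse)

lemma Ck_on_real:
  fixes f :: "real \<Rightarrow> real"
  assumes "open S" "\<And>x. x \<in> S \<Longrightarrow> (f has_real_derivative f' x) (at x)" "Ck_on n S f'"
  shows "Ck_on (Suc n) S f"
proof (rule Ck_onI[OF assms(1)])
  show "(f has_derivative (\<lambda>h. f' x * h)) (at x)" if "x \<in> S" for x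
    using assms(2)[OF that] by (simp add: has_field_derivative_def)
  show "Ck_on n S (\<lambda>x. f' x * v)" for v
    by (intro Ck_on_bilinear[OF bounded_bilinear_mult] assms Ck_on_const)
qed

lemma smooth_at_real:
  fixes f :: "real \<Rightarrow> real"
  assumes "open S" "x \<in> S" "\<And>x. x \<in> S \<Longrightarrow> (f has_real_derivative f' x) (at x)"
    "\<And>x. x \<in> S \<Longrightarrow> smooth_at f' x"
  shows "smooth_at f x"
proof (rule smooth_atI[OF assms(1,2)])
  have "Ck_on n S f'" for n
    using smooth_at_imp_smooth_on[of S f'] assms(4) by (simp add: smooth_on_def)
  then show "Ck_on n S f" for n
    using Ck_on_Suc_imp[OF assms(1) Ck_on_real[OF assms(1,3)]] by blast
qed

lemma Ck_on_sqrt: "Ck_on n {0<..} sqrt"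
proof (induction n)
  case 0
  then show ?case by (auto intro!: continuous_on_real_sqrt continuous_on_id)
next
  case (Suc n)
  have "Ck_on n {0<..} (\<lambda>x. inverse (sqrt x))"
    by (rule Ck_on_compose[OF _ _ _ Suc Ck_on_inverse]) auto
  then have "Ck_on n {0<..} (\<lambda>x. inverse (sqrt x) * (1/2))"
    by (intro Ck_on_bilinear[OF bounded_bilinear_mult] Ck_on_const) auto
  then show ?case
    by (intro Ck_on_real[of _ _ "\<lambda>x. inverse (sqrt x) * (1/2)"]) (auto intro!: derivative_eq_intros)
qed

lemma smooth_at_sqrt [smooth]: "smooth_at f x \<Longrightarrow> f x > 0 \<Longrightarrow> smooth_at (\<lambda>x. sqrt (f x)) x"
  by (rule smooth_at_compose[OF smooth_atI[of "{0<..}"]]) (use Ck_on_sqrt in auto)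

lemma smooth_at_norm [smooth]:
  fixes f :: "'a::euclidean_space \<Rightarrow> 'b::euclidean_space"
  assumes "smooth_at f x" "f x \<noteq> 0"
  shows "smooth_at (\<lambda>x. norm (f x)) x"
  unfolding norm_eq_sqrt_inner by (intro smooth_at_sqrt smooth_at_rules assms) (simp add: assms)

lemma smooth_at_ln [smooth]:
  assumes "smooth_at f x" "f x > 0"
  shows "smooth_at (\<lambda>x. ln (f x :: real)) x"
proof (rule smooth_at_compose[OF _ assms(1)])
  show "smooth_at ln (f x)"
    by (rule smooth_at_real[of "{0<..}" _ _ inverse])
      (use assms(2) in \<open>auto intro!: derivative_eq_intros smooth_at_inverse smooth_at_ident simp: divide_inverse\<close>)
qed

lemma Ck_on_exp: "Ck_on n UNIV (exp :: real \<Rightarrow> real)"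
  by (induction n) (auto intro: Ck_on_real DERIV_exp simp del: Ck_on.simps(2) intro!: continuous_on_exp continuous_on_id)

lemma smooth_at_exp [smooth]: "smooth_at f x \<Longrightarrow> smooth_at (\<lambda>x. exp (f x :: real)) x"
  by (rule smooth_at_compose[OF smooth_atI[of UNIV]]) (use Ck_on_exp in auto)

lemma smooth_at_arctan [smooth]:
  assumes "smooth_at f x"
  shows "smooth_at (\<lambda>x. arctan (f x)) x"
proof -
  have "1 + y * y \<noteq> 0" for y :: real by (smt (verit) zero_le_square)
  then have "smooth_at (\<lambda>y. inverse (1 + y * y)) y" for y :: real
    by (intro smooth_at_inverse smooth_at_rules smooth_at_ident)
  then have "smooth_at arctan (f x)"
    by (intro smooth_at_real[of UNIV _ arctan "\<lambda>y. inverse (1 + y * y)"])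
      (use DERIV_arctan in \<open>auto simp: power2_eq_square\<close>)
  then show ?thesis using assms by (rule smooth_at_compose)
qed

text \<open>Differentiation turns a power series into another one with the same disc of convergence, so the
  induction has to range over all coefficient sequences.\<close>

lemma Ck_on_power_series:
  fixes c :: "nat \<Rightarrow> real"
  assumes "\<And>x. \<bar>x\<bar> < K \<Longrightarrow> summable (\<lambda>n. c n * x ^ n)"
  shows "Ck_on m (ball 0 K) (\<lambda>x. \<Sum>n. c n * x ^ n)"
  using assms
proof (induction m arbitrary: c)
  case 0
  show ?case
    using DERIV_isCont[OF termdiffs_strong'[of K c]] 0
    by (auto intro!: continuous_at_imp_continuous_on)
next
  case (Suc m)
  have "Ck_on m (ball 0 K) (\<lambda>x. \<Sum>n. diffs c n * x ^ n)"
    by (rule Suc.IH) (use termdiff_converges[of _ K c] Suc.prems in auto)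
  then show ?case
    by (rule Ck_on_real[rotated 2]) (use termdiffs_strong'[of K c] Suc.prems in auto)
qed

lemma smooth_at_power_series:
  fixes c :: "nat \<Rightarrow> real"
  assumes "\<And>x. \<bar>x\<bar> < K \<Longrightarrow> summable (\<lambda>n. c n * x ^ n)" "\<bar>x\<bar> < K"
  shows "smooth_at (\<lambda>x. \<Sum>n. c n * x ^ n) x"
  by (rule smooth_atI[of "ball 0 K"]) (use assms Ck_on_power_series in auto)

subsection \<open>Symmetry of second derivatives\<close>

lemma line_has_derivative:
  fixes f :: "'a::euclidean_space \<Rightarrow> real"
  assumes "f differentiable (at (a + s *\<^sub>R u))"
  shows "((\<lambda>s. f (a + s *\<^sub>R u)) has_real_derivative frechet_derivative f (at (a + s *\<^sub>R u)) u) (at s)"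
proof -
  have "((\<lambda>s. a + s *\<^sub>R u) has_derivative (\<lambda>h. h *\<^sub>R u)) (at s)"
    by (auto intro!: derivative_eq_intros)
  from has_derivative_compose[OF this, of f] assms
  have "((\<lambda>s. f (a + s *\<^sub>R u)) has_derivative (\<lambda>h. frechet_derivative f (at (a + s *\<^sub>R u)) (h *\<^sub>R u))) (at s)"
    unfolding frechet_derivative_works by blast
  moreover have "frechet_derivative f (at (a + s *\<^sub>R u)) (h *\<^sub>R u) = frechet_derivative f (at (a + s *\<^sub>R u)) u * h" for h
    using linear_cmul[OF linear_frechet_derivative[OF assms]] by (simp add: mult.commute)
  ultimately show ?thesis by (simp add: has_field_derivative_def)
qed

text \<open>Two applications of the mean value theorem. The left-hand side is symmetric in \<open>u\<close> and \<open>v\<close>, so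
  exchanging them yields both mixed second derivatives at points close to \<open>x\<close>.\<close>

lemma second_difference:
  fixes f :: "'a::euclidean_space \<Rightarrow> real"
  assumes "smooth_on (ball x r) f" "0 < h" "h * (norm u + norm v) < r"
  shows "\<exists>y \<in> cball x (h * (norm u + norm v)).
    f (x + h *\<^sub>R u + h *\<^sub>R v) - f (x + h *\<^sub>R u) - f (x + h *\<^sub>R v) + f x
    = h * h * frechet_derivative (\<lambda>z. frechet_derivative f (at z) u) (at y) v"
proof -
  have in': "s *\<^sub>R u + t *\<^sub>R v \<in> cball 0 (h * (norm u + norm v))"
    if "0 \<le> s" "s \<le> h" "0 \<le> t" "t \<le> h" for s t
  proof -
    have "norm (s *\<^sub>R u + t *\<^sub>R v) \<le> s * norm u + t * norm v"
      using norm_triangle_ineq[of "s *\<^sub>R u" "t *\<^sub>R v"] that by simp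
    also have "\<dots> \<le> h * norm u + h * norm v"
      by (intro add_mono mult_right_mono) (use that in auto)
    finally show ?thesis by (simp add: distrib_left)
  qed
  have sm: "smooth_at f (x + s *\<^sub>R u + t *\<^sub>R v)" if "0 \<le> s" "s \<le> h" "0 \<le> t" "t \<le> h" for s t
    by (rule smooth_on_imp_smooth_at[OF assms(1)])
      (use in'[OF that] assms(3) in \<open>auto simp: dist_norm norm_minus_commute algebra_simps\<close>)
  have 1: "(\<lambda>s. f (x + h *\<^sub>R v + s *\<^sub>R u) - f (x + s *\<^sub>R u)) = (\<lambda>s. f (x + s *\<^sub>R u + h *\<^sub>R v) - f (x + s *\<^sub>R u + 0 *\<^sub>R v))"
    by (simp add: algebra_simps)
  have d1: "((\<lambda>s. f (x + h *\<^sub>R v + s *\<^sub>R u) - f (x + s *\<^sub>R u)) has_real_derivative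
      frechet_derivative f (at (x + h *\<^sub>R v + s *\<^sub>R u)) u - frechet_derivative f (at (x + s *\<^sub>R u)) u) (at s)"
    if "0 \<le> s" "s \<le> h" for s
    using smooth_at_differentiable[OF sm[OF that, of h]] smooth_at_differentiable[OF sm[OF that, of 0]] assms(2)
    by (intro DERIV_diff line_has_derivative) (simp_all add: algebra_simps)
  obtain \<xi> where \<xi>: "0 < \<xi>" "\<xi> < h"
    "(f (x + h *\<^sub>R v + h *\<^sub>R u) - f (x + h *\<^sub>R u)) - (f (x + h *\<^sub>R v + 0 *\<^sub>R u) - f (x + 0 *\<^sub>R u))
      = (h - 0) * (frechet_derivative f (at (x + h *\<^sub>R v + \<xi> *\<^sub>R u)) u - frechet_derivative f (at (x + \<xi> *\<^sub>R u)) u)"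
    using MVT2[OF assms(2) d1] by auto
  have d2: "((\<lambda>t. frechet_derivative f (at (x + \<xi> *\<^sub>R u + t *\<^sub>R v)) u) has_real_derivative
      frechet_derivative (\<lambda>z. frechet_derivative f (at z) u) (at (x + \<xi> *\<^sub>R u + t *\<^sub>R v)) v) (at t)"
    if "0 \<le> t" "t \<le> h" for t
    using smooth_at_differentiable[OF smooth_at_derivative[OF sm[of \<xi> t]]] \<xi> that
    by (intro line_has_derivative[of "\<lambda>z. frechet_derivative f (at z) u"]) auto
  obtain \<eta> where \<eta>: "0 < \<eta>" "\<eta> < h"
    "frechet_derivative f (at (x + \<xi> *\<^sub>R u + h *\<^sub>R v)) u - frechet_derivative f (at (x + \<xi> *\<^sub>R u + 0 *\<^sub>R v)) u
      = (h - 0) * frechet_derivative (\<lambda>z. frechet_derivative f (at z) u) (at (x + \<xi> *\<^sub>R u + \<eta> *\<^sub>R v)) v"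
    using MVT2[OF assms(2) d2] by auto
  have "x + \<xi> *\<^sub>R u + \<eta> *\<^sub>R v \<in> cball x (h * (norm u + norm v))"
    using in'[of \<xi> \<eta>] \<xi> \<eta> by (simp add: dist_norm norm_minus_commute algebra_simps)
  moreover have "f (x + h *\<^sub>R u + h *\<^sub>R v) - f (x + h *\<^sub>R u) - f (x + h *\<^sub>R v) + f x
    = h * h * frechet_derivative (\<lambda>z. frechet_derivative f (at z) u) (at (x + \<xi> *\<^sub>R u + \<eta> *\<^sub>R v)) v"
    using \<xi>(3) \<eta>(3) by (simp add: add.commute add.left_commute)
  ultimately show ?thesis by blast
qed

lemma symmetric_second_derivative_real:
  fixes f :: "'a::euclidean_space \<Rightarrow> real"
  assumes "smooth_at f x"
  shows "frechet_derivative (\<lambda>z. frechet_derivative f (at z) u) (at x) v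
       = frechet_derivative (\<lambda>z. frechet_derivative f (at z) v) (at x) u" (is "?H u v x = ?H v u x")
proof (rule ccontr)
  assume ne: "?H u v x \<noteq> ?H v u x"
  define e where "e = \<bar>?H u v x - ?H v u x\<bar> / 2"
  have e: "e > 0" using ne by (simp add: e_def)
  have cont: "(?H u' v' \<longlongrightarrow> ?H u' v' x) (nhds x)" for u' v'
    using smooth_at_filterlim[OF smooth_at_derivative[OF smooth_at_derivative[OF assms]]] .
  have near: "eventually (\<lambda>y. \<bar>?H u' v' y - ?H u' v' x\<bar> < e) (nhds x)" for u' v'
    using tendstoD[OF cont[of u' v'] e]
    by (simp add: dist_real_def)
  obtain N where N: "open N" "x \<in> N" "smooth_on N f" using assms by (auto simp: smooth_at_def)
  have "eventually (\<lambda>y. y \<in> N \<and> \<bar>?H u v y - ?H u v x\<bar> < e \<and> \<bar>?H v u y - ?H v u x\<bar> < e) (nhds x)"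
    using N near by (intro eventually_conj eventually_nhds_in_open) auto
  then obtain r where r: "r > 0" "\<And>y. dist y x < r \<Longrightarrow> y \<in> N \<and> \<bar>?H u v y - ?H u v x\<bar> < e \<and> \<bar>?H v u y - ?H v u x\<bar> < e"
    by (auto simp: eventually_nhds_metric)
  define h where "h = r / (2 * (norm u + norm v + 1))"
  have pos: "norm u + norm v + 1 > 0" by (smt (verit) norm_ge_zero)
  have h: "h > 0" using r(1) pos by (simp add: h_def)
  have "h * (norm u + norm v) \<le> h * (norm u + norm v + 1)" using h by simp
  also have "\<dots> = r / 2" using pos by (simp add: h_def field_simps)
  finally have hr: "h * (norm u + norm v) < r" "h * (norm v + norm u) < r" using r(1) by (auto simp: add.commute)
  have "ball x r \<subseteq> N" using r(2) by (auto simp: dist_commute)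
  then have sm: "smooth_on (ball x r) f"
    using N(3) Ck_on_subset unfolding smooth_on_def by blast
  obtain y where y: "y \<in> cball x (h * (norm u + norm v))"
    "f (x + h *\<^sub>R u + h *\<^sub>R v) - f (x + h *\<^sub>R u) - f (x + h *\<^sub>R v) + f x = h * h * ?H u v y"
    using second_difference[OF sm h hr(1)] by blast
  obtain z where z: "z \<in> cball x (h * (norm v + norm u))"
    "f (x + h *\<^sub>R v + h *\<^sub>R u) - f (x + h *\<^sub>R v) - f (x + h *\<^sub>R u) + f x = h * h * ?H v u z"
    using second_difference[OF sm h hr(2)] by blast
  have "h * h * ?H u v y = h * h * ?H v u z"
    using y(2) z(2) by (simp add: algebra_simps)
  then have "?H u v y = ?H v u z" using h by simp
  moreover have "\<bar>?H u v y - ?H u v x\<bar> < e" "\<bar>?H v u z - ?H v u x\<bar> < e"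
    using r(2)[of y] r(2)[of z] y(1) z(1) hr by (auto simp: dist_commute)
  ultimately show False unfolding e_def by (smt (verit) field_sum_of_halves)
qed

lemma symmetric_second_derivative:
  fixes f :: "'a::euclidean_space \<Rightarrow> 'b::euclidean_space"
  assumes "smooth_at f x"
  shows "frechet_derivative (\<lambda>z. frechet_derivative f (at z) u) (at x) v
       = frechet_derivative (\<lambda>z. frechet_derivative f (at z) v) (at x) u"
proof (rule euclidean_eqI)
  fix b :: 'b assume "b \<in> Basis"
  have inner: "frechet_derivative (\<lambda>z. g z \<bullet> b) (at y) w = frechet_derivative g (at y) w \<bullet> b"
    if "smooth_at g y" for g :: "'a \<Rightarrow> 'b" and y w
    using frechet_derivative_at[OF has_derivative_inner_left[OF smooth_at_has_derivative[OF that], of b]] by metis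
  have *: "frechet_derivative (\<lambda>z. frechet_derivative f (at z) u) (at x) v \<bullet> b =
     frechet_derivative (\<lambda>z. frechet_derivative (\<lambda>z. f z \<bullet> b) (at z) u) (at x) v" for u v
  proof -
    have "eventually (\<lambda>z. frechet_derivative f (at z) u \<bullet> b = frechet_derivative (\<lambda>z. f z \<bullet> b) (at z) u) (nhds x)"
      using smooth_at_eventually[OF assms] by eventually_elim (simp add: inner)
    then obtain T where T: "open T" "x \<in> T"
      "\<And>z. z \<in> T \<Longrightarrow> frechet_derivative f (at z) u \<bullet> b = frechet_derivative (\<lambda>z. f z \<bullet> b) (at z) u"
      by (auto simp: eventually_nhds)
    have sm: "smooth_at (\<lambda>z. frechet_derivative f (at z) u) x" by (rule smooth_at_derivative[OF assms])
    have "((\<lambda>z. frechet_derivative (\<lambda>z. f z \<bullet> b) (at z) u) has_derivative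
      (\<lambda>v. frechet_derivative (\<lambda>z. frechet_derivative f (at z) u) (at x) v \<bullet> b)) (at x)"
      by (rule has_derivative_transform_within_open[OF has_derivative_inner_left[OF smooth_at_has_derivative[OF sm]] T(1,2)])
        (use T(3) in auto)
    then show ?thesis using frechet_derivative_at by metis
  qed
  show "frechet_derivative (\<lambda>z. frechet_derivative f (at z) u) (at x) v \<bullet> b
     = frechet_derivative (\<lambda>z. frechet_derivative f (at z) v) (at x) u \<bullet> b"
    unfolding * by (rule symmetric_second_derivative_real) (intro smooth_at_rules smooth_at_const assms)
qed

section \<open>Structures conjugate to a constant one, and the Courant bracket\<close>

lemma has_derivative_eventually_eq:
  assumes "(f has_derivative f') (at x)" "eventually (\<lambda>y. f y = g y) (nhds x)"
  shows "(g has_derivative f') (at x)"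
proof -
  obtain T where "open T" "x \<in> T" "\<And>y. y \<in> T \<Longrightarrow> f y = g y"
    using assms(2) by (auto simp: eventually_nhds)
  then show ?thesis using has_derivative_transform_within_open[OF assms(1)] by blast
qed

lemma frechet_derivative_cong:
  assumes "smooth_at f x" "eventually (\<lambda>y. f y = g y) (nhds x)"
  shows "frechet_derivative g (at x) = frechet_derivative f (at x)"
  using frechet_derivative_at[OF has_derivative_eventually_eq[OF smooth_at_has_derivative[OF assms(1)] assms(2)]]
  by simp

text \<open>The covariant derivative of the tensor field \<open>L\<close> in the direction \<open>u\<close>, for the flat connection of
  the vector space.\<close>

definition field_deriv :: "('e::euclidean_space \<Rightarrow> 'v \<Rightarrow> 'b::real_normed_vector) \<Rightarrow> 'e \<Rightarrow> 'e \<Rightarrow> 'v \<Rightarrow> 'b"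
  where "field_deriv L x u v = frechet_derivative (\<lambda>y. L y v) (at x) u"

text \<open>The product rule, for tensor fields whose smoothness is only given on constant vectors:
  expanding the argument in a basis reduces it to products of scalars with vectors.\<close>

lemma has_derivative_apply_field:
  fixes L :: "'e::euclidean_space \<Rightarrow> 'v::euclidean_space \<Rightarrow> 'b::real_normed_vector"
  assumes lin: "eventually (\<lambda>y. linear (L y)) (nhds x)"
    and L: "\<And>v. smooth_at (\<lambda>y. L y v) x" and V: "(V has_derivative V') (at x)"
  shows "((\<lambda>y. L y (V y)) has_derivative (\<lambda>u. field_deriv L x u (V x) + L x (V' u))) (at x)"
    and "\<And>u. linear (field_deriv L x u)"
proof -
  have lx: "linear (L x)" using eventually_nhds_x_imp_x[OF lin] .
  have gen: "((\<lambda>y. L y (W y)) has_derivative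
    (\<lambda>u. \<Sum>b\<in>Basis. (W x \<bullet> b) *\<^sub>R field_deriv L x u b + (W' u \<bullet> b) *\<^sub>R L x b)) (at x)"
    if W: "(W has_derivative W') (at x)" for W W'
  proof (rule has_derivative_eventually_eq)
    show "((\<lambda>y. \<Sum>b\<in>Basis. (W y \<bullet> b) *\<^sub>R L y b) has_derivative
      (\<lambda>u. \<Sum>b\<in>Basis. (W x \<bullet> b) *\<^sub>R field_deriv L x u b + (W' u \<bullet> b) *\<^sub>R L x b)) (at x)"
      unfolding field_deriv_def
      by (intro has_derivative_sum has_derivative_scaleR has_derivative_inner_left[OF W] smooth_at_has_derivative[OF L])
    show "eventually (\<lambda>y. (\<Sum>b\<in>Basis. (W y \<bullet> b) *\<^sub>R L y b) = L y (W y)) (nhds x)"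
      using lin by eventually_elim (simp flip: linear_sum_Basis)
  qed
  have fd: "field_deriv L x u v = (\<Sum>b\<in>Basis. (v \<bullet> b) *\<^sub>R field_deriv L x u b)" for u v
    using frechet_derivative_at[OF gen[OF has_derivative_const[of v]]]
    by (subst field_deriv_def) (metis (no_types, lifting) add.right_neutral inner_zero_left scale_zero_left sum.cong)
  show lf: "linear (field_deriv L x u)" for u
    by (subst fd[abs_def]) (auto intro!: linearI simp: inner_add_left scaleR_add_left sum.distrib scaleR_sum_right)
  show "((\<lambda>y. L y (V y)) has_derivative
    (\<lambda>u. field_deriv L x u (V x) + L x (V' u))) (at x)"
    using gen[OF V] by (simp add: sum.distrib fd[of _ "V x"] linear_sum_Basis[OF lx, of "V' _"])
qed

text \<open>The two identities are the vanishing of the Nijenhuis tensor of \<open>J\<close>. They hold because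
  \<open>J\<close> is conjugate to the constant \<open>I\<close> under the differential of \<open>g\<close>: differentiating this
  relation expresses the derivative of \<open>J\<close> through the second derivative of \<open>g\<close>, which is symmetric.\<close>

lemma nijenhuis_zero:
  fixes g :: "'e::euclidean_space \<Rightarrow> 'e"
  assumes g: "smooth_at g x"
    and conj: "eventually (\<lambda>y. \<forall>v. frechet_derivative g (at y) (J y v) = I (frechet_derivative g (at y) v)) (nhds x)"
    and inj: "inj (frechet_derivative g (at x))"
    and J: "\<And>v. smooth_at (\<lambda>y. J y v) x" "eventually (\<lambda>y. linear (J y)) (nhds x)"
    and I: "linear I" "\<And>v. I (I v) = - v"
  defines "B \<equiv> field_deriv J x"
  shows "B u v - B v u + J x (B (J x u) v) - J x (B (J x v) u) = 0"
    and "B u v - B v u = B (J x u) (J x v) - B (J x v) (J x u)"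
proof -
  define M where "M = frechet_derivative g (at x)"
  define S where "S = field_deriv (\<lambda>y. frechet_derivative g (at y)) x"
  have S: "S u v = S v u" for u v
    unfolding S_def field_deriv_def by (rule symmetric_second_derivative[OF g])
  have linM: "linear M" unfolding M_def by (rule smooth_at_linear[OF g])
  have Mlin: "eventually (\<lambda>y. linear (frechet_derivative g (at y))) (nhds x)"
    using smooth_at_eventually[OF g] by eventually_elim (rule smooth_at_linear)
  have linS: "linear (S u)" for u
    unfolding S_def by (rule has_derivative_apply_field(2)[OF Mlin smooth_at_derivative[OF g] smooth_at_has_derivative[OF g]])
  have MJ: "M (J x v) = I (M v)" for v
    using eventually_nhds_x_imp_x[OF conj] by (simp add: M_def)
  have key: "M (B u v) = I (S u v) - S u (J x v)" for u v
  proof -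
    have "((\<lambda>y. frechet_derivative g (at y) (J y v)) has_derivative (\<lambda>u. S u (J x v) + M (B u v))) (at x)"
      unfolding S_def M_def B_def
      using has_derivative_apply_field(1)[OF Mlin smooth_at_derivative[OF g] smooth_at_has_derivative[OF J(1)[of v]]]
      by (simp add: field_deriv_def)
    moreover have "((\<lambda>y. I (frechet_derivative g (at y) v)) has_derivative (\<lambda>u. I (S u v))) (at x)"
      unfolding S_def field_deriv_def
      by (rule bounded_linear.has_derivative[OF linear_conv_bounded_linear[THEN iffD1, OF I(1)]
            smooth_at_has_derivative[OF smooth_at_derivative[OF g]]])
    then have "((\<lambda>y. frechet_derivative g (at y) (J y v)) has_derivative (\<lambda>u. I (S u v))) (at x)"
      by (rule has_derivative_eventually_eq) (use conj in eventually_elim, simp)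
    ultimately have "(\<lambda>u. S u (J x v) + M (B u v)) = (\<lambda>u. I (S u v))"
      by (rule has_derivative_unique)
    then show ?thesis by (metis add_diff_cancel_left')
  qed
  have JJ: "J x (J x v) = - v" for v
  proof -
    have "M (J x (J x v)) = M (- v)" by (simp add: MJ I linear_neg[OF linM])
    then show ?thesis using inj by (simp add: M_def inj_eq)
  qed
  note lin = linear_diff[OF linM] linear_add[OF linM] linear_diff[OF I(1)] linear_neg[OF linS] linear_neg[OF I(1)] linear_neg[OF linM]
  have Sg: "S v u = S u v" "S v (J x u) = S (J x u) v" "S u (J x v) = S (J x v) u"
    "S (J x v) (J x u) = S (J x u) (J x v)"
    by (rule S)+
  have "M (B u v - B v u + J x (B (J x u) v) - J x (B (J x v) u)) = M 0"
    by (simp add: lin MJ key I Sg linear_0[OF linM])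
  then show "B u v - B v u + J x (B (J x u) v) - J x (B (J x v) u) = 0"
    using inj by (simp add: M_def inj_eq)
  have "M (B u v - B v u) = M (B (J x u) (J x v) - B (J x v) (J x u))"
    by (simp add: lin MJ JJ key I Sg)
  then show "B u v - B v u = B (J x u) (J x v) - B (J x v) (J x u)"
    using inj by (simp add: M_def inj_eq)
qed

lemma blinfun_apply_Blinfun_linear:
  "linear f \<Longrightarrow> blinfun_apply (Blinfun f) v = (f (v::'a::euclidean_space) :: real)"
  by (simp add: bounded_linear_Blinfun_apply linear_conv_bounded_linear)

lemma fst_courant:
  "fst (courant H s t x) = frechet_derivative (fst \<circ> t) (at x) (fst (s x)) - frechet_derivative (fst \<circ> s) (at x) (fst (t x))"
  by (simp add: courant_def Let_def lie_bracket_def)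

lemma smooth_at_fst_snd:
  assumes "smooth_at s x"
  shows "smooth_at (fst \<circ> s) x" "smooth_at (snd \<circ> s) x"
  using smooth_at_linear_comp[OF bounded_linear_fst assms] smooth_at_linear_comp[OF bounded_linear_snd assms]
  by (simp_all add: o_def)

lemma blinfun_apply_lie_deriv:
  assumes "smooth_at X x"
  shows "blinfun_apply (lie_deriv_1form X \<eta> x) v =
    blinfun_apply (frechet_derivative \<eta> (at x) (X x)) v + blinfun_apply (\<eta> x) (frechet_derivative X (at x) v)"
  unfolding lie_deriv_1form_def
  by (subst blinfun_apply_Blinfun_linear)
    (simp_all add: linear_iff blinfun.add_right blinfun.scaleR_right algebra_simps
      linear_add[OF smooth_at_linear[OF assms]] linear_cmul[OF smooth_at_linear[OF assms]])

lemma has_derivative_blinfun_apply: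
  assumes "smooth_at \<eta> x" "smooth_at X x"
  shows "((\<lambda>y. blinfun_apply (\<eta> y) (X y)) has_derivative
    (\<lambda>u. blinfun_apply (\<eta> x) (frechet_derivative X (at x) u) + blinfun_apply (frechet_derivative \<eta> (at x) u) (X x))) (at x)"
  by (rule bounded_bilinear.FDERIV[OF bounded_bilinear_blinfun_apply assms[THEN smooth_at_has_derivative]])

lemma smooth_at_blinfun_apply:
  "smooth_at \<eta> x \<Longrightarrow> smooth_at X x \<Longrightarrow> smooth_at (\<lambda>y. blinfun_apply (\<eta> y) (X y)) x"
  by (rule smooth_at_bilinear[OF bounded_bilinear_blinfun_apply])

text \<open>The function whose differential enters the Courant bracket.\<close>

definition pairing_diff :: "('e::euclidean_space \<Rightarrow> 'e gtan) \<Rightarrow> ('e \<Rightarrow> 'e gtan) \<Rightarrow> 'e \<Rightarrow> real" where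
  "pairing_diff s t y = blinfun_apply (snd (t y)) (fst (s y)) - blinfun_apply (snd (s y)) (fst (t y))"

lemma smooth_at_pairing_diff:
  assumes "smooth_at s x" "smooth_at t x"
  shows "smooth_at (pairing_diff s t) x"
  unfolding pairing_diff_def
  using smooth_at_blinfun_apply smooth_at_fst_snd[OF assms(1)] smooth_at_fst_snd[OF assms(2)]
  by (intro smooth_at_minus) (simp_all add: o_def)

lemma snd_courant:
  assumes "smooth_at s x" "smooth_at t x"
  shows "blinfun_apply (snd (courant (\<lambda>_ _ _ _. 0) s t x)) v =
    blinfun_apply (lie_deriv_1form (fst \<circ> s) (snd \<circ> t) x) v - blinfun_apply (lie_deriv_1form (fst \<circ> t) (snd \<circ> s) x) v
    - frechet_derivative (pairing_diff s t) (at x) v / 2"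
proof -
  have "Blinfun (\<lambda>_::'a. 0::real) = 0"
    using zero_blinfun_def by metis
  moreover have "blinfun_apply (d_fun (pairing_diff s t) x) v = frechet_derivative (pairing_diff s t) (at x) v"
    unfolding d_fun_def
    by (rule blinfun_apply_Blinfun_linear[OF smooth_at_linear[OF smooth_at_pairing_diff[OF assms]]])
  ultimately show ?thesis
    by (simp add: courant_def Let_def pairing_diff_def[abs_def] o_def blinfun.diff_left blinfun.scaleR_left blinfun.add_left)
qed

locale conjugate_to_constant =
  fixes g :: "'e::euclidean_space \<Rightarrow> 'e" and J :: "'e \<Rightarrow> 'e \<Rightarrow> 'e" and I :: "'e \<Rightarrow> 'e" and x :: 'e
  assumes g: "smooth_at g x"
    and conj: "eventually (\<lambda>y. \<forall>v. frechet_derivative g (at y) (J y v) = I (frechet_derivative g (at y) v)) (nhds x)"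
    and inj: "inj (frechet_derivative g (at x))"
    and J: "\<And>v. smooth_at (\<lambda>y. J y v) x" "eventually (\<lambda>y. linear (J y)) (nhds x)"
      "eventually (\<lambda>y. \<forall>v. J y (J y v) = - v) (nhds x)"
    and I: "linear I" "\<And>v. I (I v) = - v"
begin

definition B where "B = field_deriv J x"

lemmas nijenhuis = nijenhuis_zero[OF g conj inj J(1,2) I, folded B_def]

lemma linear_J: "linear (J x)" and J_J [simp]: "J x (J x v) = - v"
  using eventually_nhds_x_imp_x[OF J(2)] eventually_nhds_x_imp_x[OF J(3)] by auto

lemmas lin = linear_add[OF linear_J] linear_diff[OF linear_J] linear_neg[OF linear_J]

lemma linear_B: "linear (B u)"
  unfolding B_def by (rule has_derivative_apply_field(2)[OF J(2,1) has_derivative_ident])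

lemma linear_B_left: "linear (\<lambda>u. B u v)"
  unfolding B_def field_deriv_def by (rule smooth_at_linear[OF J(1)])

lemma B_J: "B u (J x v) = - J x (B u v)"
proof -
  have "((\<lambda>y. J y (J y v)) has_derivative (\<lambda>u. B u (J x v) + J x (B u v))) (at x)"
    using has_derivative_apply_field(1)[OF J(2,1) smooth_at_has_derivative[OF J(1)[of v]]]
    by (simp add: B_def field_deriv_def)
  moreover have "((\<lambda>y. J y (J y v)) has_derivative (\<lambda>u. 0)) (at x)"
    by (rule has_derivative_eventually_eq[OF has_derivative_const[of "- v"]]) (use J(3) in eventually_elim, simp)
  ultimately have "(\<lambda>u. B u (J x v) + J x (B u v)) = (\<lambda>u. 0)"
    by (rule has_derivative_unique)
  then show ?thesis by (metis add_eq_0_iff2)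
qed

text \<open>The section \<open>s + \<i> s'\<close> is of type (1,0) in its vector part and (0,1) in its form part.\<close>

definition eigen_pair :: "('e \<Rightarrow> 'e gtan) \<Rightarrow> ('e \<Rightarrow> 'e gtan) \<Rightarrow> bool" where
  "eigen_pair s s' \<longleftrightarrow> smooth_at s x \<and> smooth_at s' x \<and>
     eventually (\<lambda>y. fst (s' y) = - J y (fst (s y)) \<and>
       (\<forall>v. blinfun_apply (snd (s' y)) v = blinfun_apply (snd (s y)) (J y v))) (nhds x)"

context
  fixes s s' assumes ss: "eigen_pair s s'"
begin

lemma eigen_smooth:
  "smooth_at s x" "smooth_at s' x"
  "smooth_at (fst \<circ> s) x" "smooth_at (fst \<circ> s') x" "smooth_at (snd \<circ> s) x" "smooth_at (snd \<circ> s') x"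
  using ss smooth_at_fst_snd by (auto simp: eigen_pair_def)

lemma eigen_at:
  "fst (s' x) = - J x (fst (s x))" "blinfun_apply (snd (s' x)) v = blinfun_apply (snd (s x)) (J x v)"
  using ss by (auto simp: eigen_pair_def dest!: eventually_nhds_x_imp_x)

lemma eigen_deriv_fst:
  "frechet_derivative (fst \<circ> s') (at x) u = - (B u (fst (s x)) + J x (frechet_derivative (fst \<circ> s) (at x) u))"
proof -
  have "((\<lambda>y. - J y ((fst \<circ> s) y)) has_derivative
      (\<lambda>u. - (B u (fst (s x)) + J x (frechet_derivative (fst \<circ> s) (at x) u)))) (at x)"
    using has_derivative_minus[OF has_derivative_apply_field(1)[OF J(2,1) smooth_at_has_derivative[OF eigen_smooth(3)]]]
    by (simp add: B_def)
  moreover have "eventually (\<lambda>y. - J y ((fst \<circ> s) y) = (fst \<circ> s') y) (nhds x)"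
    using ss by (auto simp: eigen_pair_def elim: eventually_mono)
  ultimately have "(fst \<circ> s' has_derivative
      (\<lambda>u. - (B u (fst (s x)) + J x (frechet_derivative (fst \<circ> s) (at x) u)))) (at x)"
    by (rule has_derivative_eventually_eq)
  from fun_cong[OF frechet_derivative_at[OF this], of u] show ?thesis by simp
qed

lemma eigen_deriv_snd:
  "blinfun_apply (frechet_derivative (snd \<circ> s') (at x) u) v =
     blinfun_apply (frechet_derivative (snd \<circ> s) (at x) u) (J x v) + blinfun_apply (snd (s x)) (B u v)"
proof -
  have 1: "((\<lambda>y. blinfun_apply ((snd \<circ> s') y) v) has_derivative
      (\<lambda>u. blinfun_apply (frechet_derivative (snd \<circ> s') (at x) u) v)) (at x)"
    using has_derivative_blinfun_apply[OF eigen_smooth(6) smooth_at_const[of v]]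
    by (simp add: blinfun.zero_right)
  have "((\<lambda>y. blinfun_apply ((snd \<circ> s) y) (J y v)) has_derivative
     (\<lambda>u. blinfun_apply (snd (s x)) (B u v) + blinfun_apply (frechet_derivative (snd \<circ> s) (at x) u) (J x v))) (at x)"
    using has_derivative_blinfun_apply[OF eigen_smooth(5) J(1)[of v]] by (simp add: B_def field_deriv_def)
  moreover have "eventually (\<lambda>y. blinfun_apply ((snd \<circ> s) y) (J y v) = blinfun_apply ((snd \<circ> s') y) v) (nhds x)"
    using ss by (auto simp: eigen_pair_def elim: eventually_mono)
  ultimately have "((\<lambda>y. blinfun_apply ((snd \<circ> s') y) v) has_derivative
     (\<lambda>u. blinfun_apply (snd (s x)) (B u v) + blinfun_apply (frechet_derivative (snd \<circ> s) (at x) u) (J x v))) (at x)"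
    by (rule has_derivative_eventually_eq)
  from fun_cong[OF has_derivative_unique[OF 1 this], of u] show ?thesis by simp
qed

end

text \<open>The contraction of a (1,0) vector with the differential of a (0,1) form is of type (0,1), as the
  latter has no (2,0) part; the second Nijenhuis identity says so.\<close>

lemma lie_deriv_type:
  assumes s: "eigen_pair s s'" and t: "eigen_pair t t'"
  shows "blinfun_apply (lie_deriv_1form (fst \<circ> s) (snd \<circ> t') x) v + blinfun_apply (lie_deriv_1form (fst \<circ> s') (snd \<circ> t) x) v
    = blinfun_apply (lie_deriv_1form (fst \<circ> s) (snd \<circ> t) x) (J x v) - blinfun_apply (lie_deriv_1form (fst \<circ> s') (snd \<circ> t') x) (J x v)"
proof -
  let ?X = "fst (s x)"
  have "blinfun_apply (snd (t x)) (B ?X v - B v ?X) = blinfun_apply (snd (t x)) (B (J x ?X) (J x v) - B (J x v) (J x ?X))"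
    using nijenhuis(2)[of ?X v] by simp
  then show ?thesis
    using linear_neg[OF linear_B_left] linear_neg[OF linear_B] linear_neg[OF smooth_at_linear[OF eigen_smooth(5)[OF t]]]
    by (simp add: blinfun_apply_lie_deriv eigen_smooth[OF s] eigen_at[OF s] eigen_at[OF t] eigen_deriv_fst[OF s]
        eigen_deriv_snd[OF t] B_J lin blinfun.diff_right blinfun.add_right blinfun.minus_right blinfun.minus_left)
qed

text \<open>A (0,1) form vanishes on a (1,0) vector, so the complex bilinear extension of \<open>pairing_diff\<close> vanishes
  near \<open>x\<close> on sections of the eigenbundle; hence the exact terms of the Courant brackets cancel.\<close>

lemma pairing_diff_type:
  assumes s: "eigen_pair s s'" and t: "eigen_pair t t'"
  shows "frechet_derivative (pairing_diff s' t') (at x) = frechet_derivative (pairing_diff s t) (at x)"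
    and "frechet_derivative (pairing_diff s' t) (at x) v = - frechet_derivative (pairing_diff s t') (at x) v"
proof -
  have ev: "eventually (\<lambda>y. (fst (s' y) = - J y (fst (s y)) \<and>
       (\<forall>v. blinfun_apply (snd (s' y)) v = blinfun_apply (snd (s y)) (J y v))) \<and> (fst (t' y) = - J y (fst (t y)) \<and>
       (\<forall>v. blinfun_apply (snd (t' y)) v = blinfun_apply (snd (t y)) (J y v))) \<and> linear (J y) \<and> (\<forall>v. J y (J y v) = - v)) (nhds x)"
    using s t J(2,3) unfolding eigen_pair_def eventually_conj_iff by blast
  have "eventually (\<lambda>y. pairing_diff s t y = pairing_diff s' t' y) (nhds x)"
    using ev by eventually_elim (simp add: pairing_diff_def linear_neg)
  then show "frechet_derivative (pairing_diff s' t') (at x) = frechet_derivative (pairing_diff s t) (at x)"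
    by (rule frechet_derivative_cong[OF smooth_at_pairing_diff[OF eigen_smooth(1)[OF s] eigen_smooth(1)[OF t]]])
  have "eventually (\<lambda>y. - pairing_diff s t' y = pairing_diff s' t y) (nhds x)"
    using ev by eventually_elim (simp add: pairing_diff_def linear_neg blinfun.minus_right)
  from fun_cong[OF frechet_derivative_at[OF has_derivative_eventually_eq[OF has_derivative_minus[OF smooth_at_has_derivative[OF
          smooth_at_pairing_diff[OF eigen_smooth(1)[OF s] eigen_smooth(2)[OF t]]]] this]], of v]
  show "frechet_derivative (pairing_diff s' t) (at x) v = - frechet_derivative (pairing_diff s t') (at x) v"
    by simp
qed

lemma courant_type:
  assumes s: "eigen_pair s s'" and t: "eigen_pair t t'"
  defines "H \<equiv> (\<lambda>_ _ _ _. 0)"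
  shows "J x (fst (courant H s t x - courant H s' t' x)) = - fst (courant H s t' x + courant H s' t x)"
    and "blinfun_apply (snd (courant H s t' x + courant H s' t x)) v
       = blinfun_apply (snd (courant H s t x - courant H s' t' x)) (J x v)"
proof -
  let ?X = "fst (s x)" and ?Y = "fst (t x)"
  have "B ?X ?Y - B ?Y ?X + J x (B (J x ?X) ?Y) - J x (B (J x ?Y) ?X) = 0" by (rule nijenhuis(1))
  then have *: "B ?X ?Y = B ?Y ?X - J x (B (J x ?X) ?Y) + J x (B (J x ?Y) ?X)" by (simp add: algebra_simps)
  show "J x (fst (courant H s t x - courant H s' t' x)) = - fst (courant H s t' x + courant H s' t x)"
    using linear_neg[OF linear_B_left] linear_neg[OF smooth_at_linear[OF eigen_smooth(3)[OF t]]]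
      linear_neg[OF smooth_at_linear[OF eigen_smooth(3)[OF s]]]
    by (simp add: fst_courant eigen_at[OF s] eigen_at[OF t] eigen_deriv_fst[OF s] eigen_deriv_fst[OF t] lin *)
  show "blinfun_apply (snd (courant H s t' x + courant H s' t x)) v
       = blinfun_apply (snd (courant H s t x - courant H s' t' x)) (J x v)"
    using lie_deriv_type[OF s t, of v] lie_deriv_type[OF t s, of v] pairing_diff_type[OF s t]
    by (simp add: H_def snd_courant eigen_smooth[OF s] eigen_smooth[OF t] blinfun.add_left blinfun.diff_left)
qed

end

section \<open>Germs of local diffeomorphisms\<close>

text \<open>The smooth inverse is part of the definition, rather than an invertible differential, because all
  maps below have explicit inverses.\<close>

definition ldiff :: "('e::euclidean_space \<Rightarrow> 'f::euclidean_space) \<Rightarrow> 'e \<Rightarrow> bool" where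
  "ldiff f w \<longleftrightarrow> (\<exists>g. smooth_at f w \<and> smooth_at g (f w) \<and>
     eventually (\<lambda>z. g (f z) = z) (nhds w) \<and> eventually (\<lambda>y. f (g y) = y) (nhds (f w)))"

lemma ldiffI:
  "smooth_at f w \<Longrightarrow> smooth_at g (f w) \<Longrightarrow> eventually (\<lambda>z. g (f z) = z) (nhds w)
    \<Longrightarrow> eventually (\<lambda>y. f (g y) = y) (nhds (f w)) \<Longrightarrow> ldiff f w"
  by (auto simp: ldiff_def)

lemma ldiff_smooth: "ldiff f w \<Longrightarrow> smooth_at f w"
  by (auto simp: ldiff_def)

lemma ldiff_comp:
  assumes "ldiff f w" "ldiff g (f w)"
  shows "ldiff (\<lambda>z. g (f z)) w"
proof -
  obtain f' where f: "smooth_at f w" "smooth_at f' (f w)"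
    "eventually (\<lambda>z. f' (f z) = z) (nhds w)" "eventually (\<lambda>y. f (f' y) = y) (nhds (f w))"
    using assms(1) by (auto simp: ldiff_def)
  obtain g' where g: "smooth_at g (f w)" "smooth_at g' (g (f w))"
    "eventually (\<lambda>z. g' (g z) = z) (nhds (f w))" "eventually (\<lambda>y. g (g' y) = y) (nhds (g (f w)))"
    using assms(2) by (auto simp: ldiff_def)
  have [simp]: "g' (g (f w)) = f w" using eventually_nhds_x_imp_x[OF g(3)] .
  show ?thesis
  proof (rule ldiffI[where g = "\<lambda>y. f' (g' y)"])
    show "smooth_at (\<lambda>z. g (f z)) w" "smooth_at (\<lambda>y. f' (g' y)) (g (f w))"
      using f g by (auto intro: smooth_at_compose)
    show "eventually (\<lambda>z. f' (g' (g (f z))) = z) (nhds w)"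
      using f(3) smooth_at_eventually_comp[OF f(1) g(3)] by eventually_elim simp
    have "eventually (\<lambda>y. f (f' (g' y)) = g' y) (nhds (g (f w)))"
      by (rule smooth_at_eventually_comp[OF g(2)]) (simp add: f(4))
    then show "eventually (\<lambda>y. g (f (f' (g' y))) = y) (nhds (g (f w)))"
      using g(4) by eventually_elim simp
  qed
qed

lemma ldiff_cong:
  assumes "ldiff f w" "eventually (\<lambda>z. f z = g z) (nhds w)"
  shows "ldiff g w"
proof -
  obtain f' where f: "smooth_at f w" "smooth_at f' (f w)"
    "eventually (\<lambda>z. f' (f z) = z) (nhds w)" "eventually (\<lambda>y. f (f' y) = y) (nhds (f w))"
    using assms(1) by (auto simp: ldiff_def)
  have w: "f w = g w" "f' (f w) = w" using eventually_nhds_x_imp_x assms(2) f(3) by blast+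
  show ?thesis
  proof (rule ldiffI[where g = f'])
    show "smooth_at g w" using smooth_at_cong[OF assms(2) f(1)] .
    show "smooth_at f' (g w)" using f(2) w by simp
    show "eventually (\<lambda>z. f' (g z) = z) (nhds w)" using f(3) assms(2) by eventually_elim simp
    have "eventually (\<lambda>y. f (f' y) = g (f' y)) (nhds (f w))"
      by (rule smooth_at_eventually_comp[OF f(2)]) (simp only: w(2) assms(2))
    then show "eventually (\<lambda>y. g (f' y) = y) (nhds (g w))"
      using f(4) unfolding w(1) by eventually_elim simp
  qed
qed

lemma ldiff_ident: "ldiff (\<lambda>z. z) w"
  by (rule ldiffI[where g = "\<lambda>z. z"]) (auto intro: smooth_at_ident)

lemma frechet_derivative_chain:
  fixes f :: "'a::euclidean_space \<Rightarrow> 'b::euclidean_space"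
  assumes "smooth_at f w" "smooth_at g (f w)"
  shows "frechet_derivative (\<lambda>z. g (f z)) (at w) v = frechet_derivative g (at (f w)) (frechet_derivative f (at w) v)"
  using fun_cong[OF frechet_derivative_at[OF has_derivative_compose[OF
      smooth_at_has_derivative[OF assms(1)] smooth_at_has_derivative[OF assms(2)]]], of v] by simp

lemma frechet_derivative_left_inverse:
  fixes f :: "'a::euclidean_space \<Rightarrow> 'b::euclidean_space"
  assumes "smooth_at f w" "smooth_at g (f w)" "eventually (\<lambda>z. g (f z) = z) (nhds w)"
  shows "frechet_derivative g (at (f w)) (frechet_derivative f (at w) v) = v"
  using fun_cong[OF frechet_derivative_cong[OF smooth_at_compose[OF assms(2,1)] assms(3)], of v]
    frechet_derivative_chain[OF assms(1,2), of v] by simp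

text \<open>A local diffeomorphism which is holomorphic with respect to the linear complex structure \<open>I\<close>.\<close>

definition hdiff :: "('e::euclidean_space \<Rightarrow> 'e) \<Rightarrow> ('e \<Rightarrow> 'e) \<Rightarrow> 'e \<Rightarrow> bool" where
  "hdiff I h w \<longleftrightarrow> ldiff h w \<and>
     eventually (\<lambda>z. \<forall>v. frechet_derivative h (at z) (I v) = I (frechet_derivative h (at z) v)) (nhds w)"

lemma hdiff_ldiff: "hdiff I h w \<Longrightarrow> ldiff h w"
  by (simp add: hdiff_def)

lemma hdiff_ident: "hdiff I (\<lambda>z. z) w"
  by (simp add: hdiff_def ldiff_ident)

lemma hdiff_comp:
  assumes "hdiff I f w" "hdiff I g (f w)"
  shows "hdiff I (\<lambda>z. g (f z)) w"
  unfolding hdiff_def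
proof
  have l: "ldiff f w" "ldiff g (f w)" using assms by (auto simp: hdiff_def)
  show "ldiff (\<lambda>z. g (f z)) w" using ldiff_comp[OF l] .
  have g: "eventually (\<lambda>y. smooth_at g y \<and> (\<forall>v. frechet_derivative g (at y) (I v) = I (frechet_derivative g (at y) v))) (nhds (f w))"
    using smooth_at_eventually[OF ldiff_smooth[OF l(2)]] assms(2) unfolding hdiff_def eventually_conj_iff by blast
  show "eventually (\<lambda>z. \<forall>v. frechet_derivative (\<lambda>z. g (f z)) (at z) (I v) =
      I (frechet_derivative (\<lambda>z. g (f z)) (at z) v)) (nhds w)"
    using smooth_at_eventually[OF ldiff_smooth[OF l(1)]] assms(1)[unfolded hdiff_def, THEN conjunct2]
      smooth_at_eventually_comp[OF ldiff_smooth[OF l(1)] g]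
    by eventually_elim (simp add: frechet_derivative_chain)
qed

lemma hdiff_inverse:
  assumes "hdiff I f w"
  shows "\<exists>g. hdiff I g (f w) \<and> g (f w) = w \<and> eventually (\<lambda>y. f (g y) = y) (nhds (f w))"
proof -
  obtain g where g: "smooth_at f w" "smooth_at g (f w)"
    "eventually (\<lambda>z. g (f z) = z) (nhds w)" "eventually (\<lambda>y. f (g y) = y) (nhds (f w))"
    using assms by (auto simp: ldiff_def hdiff_def)
  have gw [simp]: "g (f w) = w" using eventually_nhds_x_imp_x[OF g(3)] .
  have l: "ldiff g (f w)" by (rule ldiffI[where g = f]) (simp_all add: g)
  have f: "eventually (\<lambda>z. smooth_at f z \<and> eventually (\<lambda>z. g (f z) = z) (nhds z) \<and>
      (\<forall>v. frechet_derivative f (at z) (I v) = I (frechet_derivative f (at z) v))) (nhds w)"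
    using smooth_at_eventually[OF g(1)] assms g(3) unfolding hdiff_def eventually_conj_iff
    by (simp add: eventually_eventually)
  have "eventually (\<lambda>y. \<forall>v. frechet_derivative g (at y) (I v) = I (frechet_derivative g (at y) v)) (nhds (f w))"
    using smooth_at_eventually_comp[OF g(2), unfolded gw, OF f] smooth_at_eventually[OF g(2)]
      g(4) eventually_eventually[THEN iffD2, OF g(4)]
  proof eventually_elim
    case (elim y)
    show ?case
    proof
      fix v
      let ?F = "frechet_derivative f (at (g y))" and ?G = "frechet_derivative g (at y)"
      have 1: "?G (?F u) = u" for u
        using frechet_derivative_left_inverse[of f "g y" g u] elim by simp
      have 2: "?F (?G u) = u" for u
        using frechet_derivative_left_inverse[of g y f u] elim by simp
      have "?G (I v) = ?G (I (?F (?G v)))" by (simp add: 2)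
      also have "\<dots> = ?G (?F (I (?G v)))" using elim by simp
      finally show "?G (I v) = I (?G v)" by (simp add: 1)
    qed
  qed
  then show ?thesis using l g(4) by (auto simp: hdiff_def)
qed


section \<open>Complex structures from holomorphic parametrizations\<close>

text \<open>A complex atlas on \<open>A\<close>, given by germs of parametrizations: \<open>(P, w) \<in> G\<close> means that \<open>P\<close>
  is a local diffeomorphism from the model space at \<open>w\<close>. Admitting covering maps as
  parametrizations avoids a choice of sheets.\<close>

locale holomorphic_cover =
  fixes A :: "('a, 'e::euclidean_space) atlas" and G :: "(('e \<Rightarrow> 'a) \<times> 'e) set" and I :: "'e \<Rightarrow> 'e"
  assumes I: "linear I" "\<And>v. I (I v) = - v"
    and inj: "\<And>U \<phi>. (U, \<phi>) \<in> A \<Longrightarrow> inj_on \<phi> U"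
    and cover: "\<And>U \<phi> q. (U, \<phi>) \<in> A \<Longrightarrow> q \<in> U \<Longrightarrow> \<exists>P w. (P, w) \<in> G \<and> P w = q"
    and open_G: "\<And>P w. (P, w) \<in> G \<Longrightarrow> eventually (\<lambda>z. (P, z) \<in> G) (nhds w)"
    and chart_open: "\<And>P w U \<phi>. (P, w) \<in> G \<Longrightarrow> (U, \<phi>) \<in> A \<Longrightarrow> P w \<in> U \<Longrightarrow> eventually (\<lambda>z. P z \<in> U) (nhds w)"
    and chart_ldiff: "\<And>P w U \<phi>. (P, w) \<in> G \<Longrightarrow> (U, \<phi>) \<in> A \<Longrightarrow> P w \<in> U \<Longrightarrow> ldiff (\<lambda>z. \<phi> (P z)) w"
    and transition: "\<And>P w P' w'. (P, w) \<in> G \<Longrightarrow> (P', w') \<in> G \<Longrightarrow> P w = P' w' \<Longrightarrow>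
      \<exists>h. hdiff I h w \<and> h w = w' \<and> eventually (\<lambda>z. P z = P' (h z)) (nhds w)"
begin

definition inverse_at :: "('e \<Rightarrow> 'e) \<Rightarrow> ('e \<Rightarrow> 'e) \<Rightarrow> 'e \<Rightarrow> bool" where
  "inverse_at F g y \<longleftrightarrow> smooth_at F (g y) \<and> smooth_at g y \<and>
     (\<forall>v. frechet_derivative g (at y) (frechet_derivative F (at (g y)) v) = v) \<and>
     (\<forall>v. frechet_derivative F (at (g y)) (frechet_derivative g (at y) v) = v)"

text \<open>\<open>K\<close> is multiplication by \<open>\<i>\<close>, transported to the chart \<open>c\<close> by every parametrization through \<open>x\<close>.\<close>

definition is_J :: "('a, 'e) chart \<Rightarrow> 'e \<Rightarrow> ('e \<Rightarrow> 'e) \<Rightarrow> bool" where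
  "is_J c x K \<longleftrightarrow> (\<forall>P w. (P, w) \<in> G \<and> P w \<in> fst c \<and> snd c (P w) = x \<longrightarrow>
     (\<forall>v. K (frechet_derivative (\<lambda>z. snd c (P z)) (at w) v) = frechet_derivative (\<lambda>z. snd c (P z)) (at w) (I v)))"

definition J :: "('a, 'e) chart \<Rightarrow> 'e \<Rightarrow> 'e \<Rightarrow> 'e" where "J c x = (SOME K. is_J c x K)"

text \<open>Two parametrizations of the same point differ by a map whose differential commutes with \<open>I\<close>, so
  the structure transported by one of them serves for all.\<close>

lemma is_J_exists:
  assumes "(U, \<phi>) \<in> A" "q \<in> U"
  shows "\<exists>K. is_J (U, \<phi>) (\<phi> q) K"
proof -
  obtain P0 w0 where P0: "(P0, w0) \<in> G" "P0 w0 = q" using cover[OF assms] by blast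
  define F where "F = (\<lambda>z. \<phi> (P0 z))"
  have Fl: "ldiff F w0" unfolding F_def using chart_ldiff[OF P0(1) assms(1)] P0 assms by simp
  then obtain g where g: "smooth_at F w0" "smooth_at g (F w0)" "eventually (\<lambda>z. g (F z) = z) (nhds w0)"
    by (auto simp: ldiff_def)
  define K where "K v = frechet_derivative F (at w0) (I (frechet_derivative g (at (F w0)) v))" for v
  have "K (frechet_derivative (\<lambda>z. \<phi> (P z)) (at w) v) = frechet_derivative (\<lambda>z. \<phi> (P z)) (at w) (I v)"
    if P: "(P, w) \<in> G" "P w \<in> U" "\<phi> (P w) = \<phi> q" for P w v
  proof -
    have "P w = P0 w0" using inj[OF assms(1)] P assms(2) P0 by (auto dest: inj_onD)
    then obtain h where h: "hdiff I h w" "h w = w0" "eventually (\<lambda>z. P z = P0 (h z)) (nhds w)"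
      using transition[OF P(1) P0(1)] by blast
    have hs: "smooth_at h w" using h(1) ldiff_smooth hdiff_ldiff by blast
    have gh: "smooth_at F (h w)" using g h by simp
    have "eventually (\<lambda>z. F (h z) = \<phi> (P z)) (nhds w)" using h(3) by eventually_elim (simp add: F_def)
    from frechet_derivative_cong[OF smooth_at_compose[OF gh hs] this]
    have D: "frechet_derivative (\<lambda>z. \<phi> (P z)) (at w) u = frechet_derivative F (at w0) (frechet_derivative h (at w) u)" for u
      using frechet_derivative_chain[OF hs gh] h(2) by simp
    have "frechet_derivative h (at w) (I v) = I (frechet_derivative h (at w) v)"
      using h(1) eventually_nhds_x_imp_x unfolding hdiff_def by blast
    then show ?thesis by (simp add: D K_def frechet_derivative_left_inverse[OF g])
  qed
  then show ?thesis unfolding is_J_def by auto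
qed

lemma J_eq:
  assumes "(P, w) \<in> G" "(U, \<phi>) \<in> A" "P w \<in> U"
  shows "J (U, \<phi>) (\<phi> (P w)) (frechet_derivative (\<lambda>z. \<phi> (P z)) (at w) v) = frechet_derivative (\<lambda>z. \<phi> (P z)) (at w) (I v)"
proof -
  have "is_J (U, \<phi>) (\<phi> (P w)) (J (U, \<phi>) (\<phi> (P w)))"
    unfolding J_def using someI_ex[OF is_J_exists[OF assms(2,3)]] .
  then show ?thesis using assms by (simp add: is_J_def)
qed

lemma local_inverse:
  assumes "(P, w) \<in> G" "(U, \<phi>) \<in> A" "P w \<in> U"
  defines "F \<equiv> \<lambda>z. \<phi> (P z)"
  obtains g where "g (F w) = w" "smooth_at F w" "smooth_at g (F w)"
    "eventually (\<lambda>y. (P, g y) \<in> G \<and> P (g y) \<in> U \<and> F (g y) = y \<and> inverse_at F g y) (nhds (F w))"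
proof -
  have "ldiff F w" unfolding F_def by (rule chart_ldiff[OF assms(1-3)])
  then obtain g where g: "smooth_at F w" "smooth_at g (F w)"
    "eventually (\<lambda>z. g (F z) = z) (nhds w)" "eventually (\<lambda>y. F (g y) = y) (nhds (F w))"
    by (auto simp: ldiff_def)
  have gw [simp]: "g (F w) = w" using eventually_nhds_x_imp_x[OF g(3)] .
  have "eventually (\<lambda>z. (P, z) \<in> G \<and> P z \<in> U \<and> smooth_at F z \<and> eventually (\<lambda>z. g (F z) = z) (nhds z)) (nhds w)"
    using open_G[OF assms(1)] chart_open[OF assms(1-3)] smooth_at_eventually[OF g(1)] g(3)
    by (simp add: eventually_conj_iff eventually_eventually)
  then have "eventually (\<lambda>z. (P, z) \<in> G \<and> P z \<in> U \<and> smooth_at F z \<and> eventually (\<lambda>z. g (F z) = z) (nhds z)) (nhds (g (F w)))"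
    by simp
  from smooth_at_eventually_comp[OF g(2) this] smooth_at_eventually[OF g(2)]
      g(4) eventually_eventually[THEN iffD2, OF g(4)]
  have "eventually (\<lambda>y. (P, g y) \<in> G \<and> P (g y) \<in> U \<and> F (g y) = y \<and> inverse_at F g y) (nhds (F w))"
  proof eventually_elim
    case (elim y)
    then show ?case
      using frechet_derivative_left_inverse[of F "g y" g] frechet_derivative_left_inverse[of g y F]
      by (simp add: inverse_at_def)
  qed
  then show ?thesis using that g gw by blast
qed

lemma J_local:
  assumes "(U, \<phi>) \<in> A" "x \<in> \<phi> ` U"
  obtains g F where "smooth_at g x" "smooth_at F (g x)"
    "eventually (\<lambda>y. (\<forall>v. J (U, \<phi>) y v = frechet_derivative F (at (g y)) (I (frechet_derivative g (at y) v))) \<and> inverse_at F g y) (nhds x)"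
proof -
  obtain q where "q \<in> U" "x = \<phi> q" using assms(2) by blast
  with cover[OF assms(1)] obtain P w where P: "(P, w) \<in> G" "P w \<in> U" "x = \<phi> (P w)" by metis
  define F where "F = (\<lambda>z. \<phi> (P z))"
  obtain g where g: "g (F w) = w" "smooth_at F w" "smooth_at g (F w)"
    "eventually (\<lambda>y. (P, g y) \<in> G \<and> P (g y) \<in> U \<and> F (g y) = y \<and> inverse_at F g y) (nhds (F w))"
    unfolding F_def by (rule local_inverse[OF P(1) assms(1) P(2)])
  show ?thesis
  proof (rule that[of g F])
    show "smooth_at g x" "smooth_at F (g x)" using g P(3) by (simp_all add: F_def)
    have "eventually (\<lambda>y. (\<forall>v. J (U, \<phi>) y v = frechet_derivative F (at (g y)) (I (frechet_derivative g (at y) v))) \<and> inverse_at F g y) (nhds (F w))"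
      using g(4)
    proof eventually_elim
      case (elim y)
      then have y: "(P, g y) \<in> G" "P (g y) \<in> U" "\<phi> (P (g y)) = y" and inv: "inverse_at F g y"
        by (auto simp: F_def)
      have "J (U, \<phi>) y (frechet_derivative F (at (g y)) u) = frechet_derivative F (at (g y)) (I u)" for u
        using J_eq[OF y(1) assms(1) y(2)] by (simp add: y(3) F_def)
      from this[of "frechet_derivative g (at y) _"] show ?case using inv by (simp add: inverse_at_def)
    qed
    then show "eventually (\<lambda>y. (\<forall>v. J (U, \<phi>) y v = frechet_derivative F (at (g y)) (I (frechet_derivative g (at y) v))) \<and> inverse_at F g y) (nhds x)"
      by (simp add: P(3) F_def)
  qed
qed

lemma J_conjugate:
  assumes "(U, \<phi>) \<in> A" "x \<in> \<phi> ` U"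
  shows "\<exists>g. conjugate_to_constant g (J (U, \<phi>)) I x"
proof -
  obtain g F where g: "smooth_at g x" "smooth_at F (g x)"
    and ev: "eventually (\<lambda>y. (\<forall>v. J (U, \<phi>) y v = frechet_derivative F (at (g y)) (I (frechet_derivative g (at y) v))) \<and> inverse_at F g y) (nhds x)"
    by (rule J_local[OF assms])
  have "conjugate_to_constant g (J (U, \<phi>)) I x"
  proof
    show "smooth_at g x" by fact
    show "eventually (\<lambda>y. \<forall>v. frechet_derivative g (at y) (J (U, \<phi>) y v) = I (frechet_derivative g (at y) v)) (nhds x)"
      using ev by eventually_elim (simp add: inverse_at_def)
    show "inj (frechet_derivative g (at x))"
      using eventually_nhds_x_imp_x[OF ev] unfolding inverse_at_def by (metis injI)
    show "eventually (\<lambda>y. linear (J (U, \<phi>) y)) (nhds x)"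
      using ev
    proof eventually_elim
      case (elim y)
      then have "J (U, \<phi>) y = frechet_derivative F (at (g y)) \<circ> (I \<circ> frechet_derivative g (at y))" by auto
      then show ?case using elim by (auto intro!: linear_compose I smooth_at_linear simp: inverse_at_def)
    qed
    show "eventually (\<lambda>y. \<forall>v. J (U, \<phi>) y (J (U, \<phi>) y v) = - v) (nhds x)"
      using ev by eventually_elim (simp add: inverse_at_def I linear_neg smooth_at_linear)
    show "smooth_at (\<lambda>y. J (U, \<phi>) y v) x" for v
    proof (rule smooth_at_cong)
      have "smooth_at (\<lambda>y. frechet_derivative F (at (g y)) b) x" for b
        using smooth_at_compose[OF smooth_at_derivative[OF g(2)] g(1)] .
      moreover have "smooth_at (\<lambda>y. I (frechet_derivative g (at y) v)) x"
        by (rule smooth_at_linear_comp[OF linear_conv_bounded_linear[THEN iffD1, OF I(1)] smooth_at_derivative[OF g(1)]])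
      ultimately show "smooth_at (\<lambda>y. \<Sum>b\<in>Basis. (I (frechet_derivative g (at y) v) \<bullet> b) *\<^sub>R frechet_derivative F (at (g y)) b) x"
        by (intro smooth_at_sum smooth_at_rules)
      show "eventually (\<lambda>y. (\<Sum>b\<in>Basis. (I (frechet_derivative g (at y) v) \<bullet> b) *\<^sub>R frechet_derivative F (at (g y)) b)
        = J (U, \<phi>) y v) (nhds x)"
        using ev by eventually_elim (simp add: inverse_at_def smooth_at_linear flip: linear_sum_Basis)
    qed
  qed (simp_all add: I linear_add linear_cmul)
  then show ?thesis by blast
qed

lemma transition_J:
  assumes "(U, \<phi>) \<in> A" "(U', \<phi>') \<in> A" "q \<in> U" "q \<in> U'"
  shows "transition_deriv (U, \<phi>) (U', \<phi>') q (J (U, \<phi>) (\<phi> q) v) = J (U', \<phi>') (\<phi>' q) (transition_deriv (U, \<phi>) (U', \<phi>') q v)"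
proof -
  obtain P w where P: "(P, w) \<in> G" "P w = q" using cover assms by blast
  have PU: "P w \<in> U" "P w \<in> U'" using P assms by auto
  define F where "F = (\<lambda>z. \<phi> (P z))"
  define F' where "F' = (\<lambda>z. \<phi>' (P z))"
  obtain g where g: "g (F w) = w" "smooth_at F w" "smooth_at g (F w)"
    "eventually (\<lambda>y. (P, g y) \<in> G \<and> P (g y) \<in> U \<and> F (g y) = y \<and> inverse_at F g y) (nhds (F w))"
    unfolding F_def by (rule local_inverse[OF P(1) assms(1) PU(1)])
  have F': "smooth_at F' w" unfolding F'_def by (rule ldiff_smooth[OF chart_ldiff[OF P(1) assms(2) PU(2)]])
  have F'g: "smooth_at F' (g (F w))" using F' g by simp
  have "eventually (\<lambda>y. F' (g y) = (\<phi>' \<circ> the_inv_into U \<phi>) y) (nhds (F w))"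
    using g(4)
  proof eventually_elim
    case (elim y)
    then have "the_inv_into U \<phi> y = P (g y)"
      by (intro the_inv_into_f_eq[OF inj[OF assms(1)]]) (auto simp: F_def)
    then show ?case by (simp add: F'_def)
  qed
  from frechet_derivative_cong[OF smooth_at_compose[OF F'g g(3)] this]
  have T: "transition_deriv (U, \<phi>) (U', \<phi>') q u = frechet_derivative F' (at w) (frechet_derivative g (at (F w)) u)" for u
    using frechet_derivative_chain[OF g(3) F'g] g(1) P(2) by (simp add: transition_deriv_def F_def comp_def)
  have gF: "frechet_derivative g (at (F w)) (frechet_derivative F (at w) u) = u"
    "frechet_derivative F (at w) (frechet_derivative g (at (F w)) u) = u" for u
    using eventually_nhds_x_imp_x[OF g(4)] g(1) by (auto simp: inverse_at_def)
  define u where "u = frechet_derivative g (at (F w)) v"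
  have v: "v = frechet_derivative F (at w) u" by (simp add: u_def gF)
  have JF: "J (U, \<phi>) (\<phi> q) (frechet_derivative F (at w) u) = frechet_derivative F (at w) (I u)"
    using J_eq[OF P(1) assms(1) PU(1)] P(2) by (simp add: F_def)
  have JF': "J (U', \<phi>') (\<phi>' q) (frechet_derivative F' (at w) u) = frechet_derivative F' (at w) (I u)"
    using J_eq[OF P(1) assms(2) PU(2)] P(2) by (simp add: F'_def)
  show ?thesis by (simp add: v T gF JF JF')
qed

lemma J_at:
  assumes "(U, \<phi>) \<in> A" "x \<in> \<phi> ` U"
  shows "smooth_at (\<lambda>y. J (U, \<phi>) y v) x" "linear (J (U, \<phi>) x)" "J (U, \<phi>) x (J (U, \<phi>) x v) = - v"
  using J_conjugate[OF assms] conjugate_to_constant.J(1) conjugate_to_constant.linear_J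
    conjugate_to_constant.J_J by blast+

theorem almost_complex: "almost_complex_structure A J"
  unfolding almost_complex_structure_def
  using J_at transition_J by (auto intro!: smooth_at_imp_smooth_on)

text \<open>The generalized complex structure of a complex structure; the sign on forms makes it orthogonal.\<close>

definition GJ :: "('a, 'e) chart \<Rightarrow> 'e \<Rightarrow> 'e gtan \<Rightarrow> 'e gtan" where
  "GJ c x s = (J c x (fst s), - Blinfun (\<lambda>v. blinfun_apply (snd s) (J c x v)))"

lemma GJ_at:
  assumes "(U, \<phi>) \<in> A" "x \<in> \<phi> ` U"
  shows "fst (GJ (U, \<phi>) x s) = J (U, \<phi>) x (fst s)"
    and "blinfun_apply (snd (GJ (U, \<phi>) x s)) v = - blinfun_apply (snd s) (J (U, \<phi>) x v)"
  using J_at(2)[OF assms]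
  by (simp_all add: GJ_def blinfun.minus_left blinfun_apply_Blinfun_linear linear_iff blinfun.add_right blinfun.scaleR_right)

lemma gtan_eqI: "fst s = fst t \<Longrightarrow> (\<And>v. blinfun_apply (snd s) v = blinfun_apply (snd t) v) \<Longrightarrow> s = t"
  for s t :: "'e gtan"
  by (simp add: prod_eq_iff blinfun_eqI)

lemma GJ_algebra:
  assumes "(U, \<phi>) \<in> A" "x \<in> \<phi> ` U"
  shows "linear (GJ (U, \<phi>) x)" "GJ (U, \<phi>) x (GJ (U, \<phi>) x s) = - s"
    "pairing (GJ (U, \<phi>) x s) (GJ (U, \<phi>) x t) = pairing s t"
proof -
  note J = J_at(2,3)[OF assms] and G = GJ_at[OF assms]
  show "linear (GJ (U, \<phi>) x)"
    using J(1) by (auto intro!: linearI gtan_eqI simp: G blinfun.add_left blinfun.scaleR_left linear_iff)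
  show "GJ (U, \<phi>) x (GJ (U, \<phi>) x s) = - s"
    by (rule gtan_eqI) (simp_all add: G J blinfun.minus_left blinfun.minus_right)
  show "pairing (GJ (U, \<phi>) x s) (GJ (U, \<phi>) x t) = pairing s t"
    by (simp add: pairing_def case_prod_beta G J blinfun.minus_right)
qed

lemma smooth_at_GJ:
  assumes "(U, \<phi>) \<in> A" "x \<in> \<phi> ` U"
  shows "smooth_at (\<lambda>y. GJ (U, \<phi>) y s) x"
proof -
  obtain g where "conjugate_to_constant g (J (U, \<phi>)) I x" using J_conjugate[OF assms] by blast
  then interpret conjugate_to_constant g "J (U, \<phi>)" I x .
  have "smooth_at (\<lambda>y. \<Sum>b\<in>Basis. blinfun_apply (snd s) (J (U, \<phi>) y b) *\<^sub>R Blinfun (\<lambda>v. v \<bullet> b)) x"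
    using smooth_at_blinfun_apply[OF smooth_at_const J(1)] by (intro smooth_at_sum smooth_at_rules)
  moreover have "eventually (\<lambda>y. (\<Sum>b\<in>Basis. blinfun_apply (snd s) (J (U, \<phi>) y b) *\<^sub>R Blinfun (\<lambda>v. v \<bullet> b))
     = Blinfun (\<lambda>v. blinfun_apply (snd s) (J (U, \<phi>) y v))) (nhds x)"
    using J(2)
  proof eventually_elim
    case (elim y)
    have l: "linear (\<lambda>v. blinfun_apply (snd s) (J (U, \<phi>) y v))"
      using elim by (simp add: linear_iff blinfun.add_right blinfun.scaleR_right)
    have l': "linear (\<lambda>v. v \<bullet> b)" for b :: 'e by (simp add: linear_iff inner_add_left)
    show ?case
    proof (rule blinfun_eqI)
      fix v :: 'e
      show "blinfun_apply (\<Sum>b\<in>Basis. blinfun_apply (snd s) (J (U, \<phi>) y b) *\<^sub>R Blinfun (\<lambda>v. v \<bullet> b)) v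
        = blinfun_apply (Blinfun (\<lambda>v. blinfun_apply (snd s) (J (U, \<phi>) y v))) v"
        unfolding blinfun.sum_left blinfun.scaleR_left blinfun_apply_Blinfun_linear[OF l]
          blinfun_apply_Blinfun_linear[OF l']
        using linear_sum_Basis[OF l, of v] by (simp add: mult.commute)
    qed
  qed
  ultimately have "smooth_at (\<lambda>y. Blinfun (\<lambda>v. blinfun_apply (snd s) (J (U, \<phi>) y v))) x"
    by (rule smooth_at_cong[rotated])
  then show ?thesis unfolding GJ_def by (intro smooth_at_Pair J(1) smooth_at_rules)
qed

theorem generalized_complex:
  "twisted_generalized_complex_structure A (\<lambda>_ _ _ _ _. 0) GJ"
  unfolding twisted_generalized_complex_structure_def
proof (intro conjI)
  show "closed_3form A (\<lambda>_ _ _ _ _. 0)"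
    using smooth_at_imp_smooth_on[OF smooth_at_const] by (auto simp: closed_3form_def linear_iff)
  show "\<forall>c\<in>A. (\<forall>g. smooth_on (snd c ` fst c) (\<lambda>x. GJ c x g)) \<and>
        (\<forall>x \<in> snd c ` fst c. linear (GJ c x) \<and> (\<forall>g. GJ c x (GJ c x g) = - g) \<and>
           (\<forall>g h. pairing (GJ c x g) (GJ c x h) = pairing g h))"
    using GJ_algebra smooth_at_GJ by (auto intro!: smooth_at_imp_smooth_on simp del: split_paired_All)
  show "\<forall>c\<in>A. \<forall>d\<in>A. \<forall>q \<in> fst c \<inter> fst d. \<forall>g h.
        same_gtan c d q g h \<longrightarrow> same_gtan c d q (GJ c (snd c q) g) (GJ d (snd d q) h)"
    using transition_J by (auto simp: same_gtan_def GJ_at simp del: split_paired_All)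
  show "\<forall>W s s' t t'.
        atlas_open A W \<and>
        smooth_gsection A W s \<and> smooth_gsection A W s' \<and> in_eigenbundle A GJ W s s' \<and>
        smooth_gsection A W t \<and> smooth_gsection A W t' \<and> in_eigenbundle A GJ W t t' \<longrightarrow>
        in_eigenbundle A GJ W
          (\<lambda>c x. courant (\<lambda>_ _ _ _. 0) (s c) (t c) x - courant (\<lambda>_ _ _ _. 0) (s' c) (t' c) x)
          (\<lambda>c x. courant (\<lambda>_ _ _ _. 0) (s c) (t' c) x + courant (\<lambda>_ _ _ _. 0) (s' c) (t c) x)"
  proof (intro allI impI, elim conjE)
    fix W s s' t t'
    assume W: "atlas_open A W" and sm: "smooth_gsection A W s" "smooth_gsection A W s'"
        "smooth_gsection A W t" "smooth_gsection A W t'"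
      and eig: "in_eigenbundle A GJ W s s'" "in_eigenbundle A GJ W t t'"
    let ?C = "courant (\<lambda>_ _ _ _. 0)"
    have "GJ c x (?C (s c) (t c) x - ?C (s' c) (t' c) x) = - (?C (s c) (t' c) x + ?C (s' c) (t c) x) \<and>
      GJ c x (?C (s c) (t' c) x + ?C (s' c) (t c) x) = ?C (s c) (t c) x - ?C (s' c) (t' c) x"
      (is "GJ c x ?R = - ?M \<and> _") if "c \<in> A" and x: "x \<in> snd c ` (fst c \<inter> W)" for c x
    proof -
      obtain U \<phi> where c: "c = (U, \<phi>)" by (cases c)
      have cA: "(U, \<phi>) \<in> A" and xU: "x \<in> \<phi> ` U" using that c by auto
      have op: "open (snd c ` (fst c \<inter> W))" using W \<open>c \<in> A\<close> by (auto simp: atlas_open_def)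
      obtain g where "conjugate_to_constant g (J (U, \<phi>)) I x" using J_conjugate[OF cA xU] by blast
      then interpret conjugate_to_constant g "J (U, \<phi>)" I x .
      have ep: "eigen_pair (r c) (r' c)"
        if "smooth_gsection A W r" "smooth_gsection A W r'" "in_eigenbundle A GJ W r r'" for r r'
        unfolding eigen_pair_def
      proof (intro conjI)
        show "smooth_at (r c) x" "smooth_at (r' c) x"
          using that(1,2) \<open>c \<in> A\<close> by (auto simp: smooth_gsection_def intro!: smooth_on_imp_smooth_at[OF _ op x] simp del: split_paired_All)
        have "eventually (\<lambda>y. y \<in> snd c ` (fst c \<inter> W)) (nhds x)"
          using eventually_nhds_in_open[OF op x] .
        then show "eventually (\<lambda>y. fst (r' c y) = - J (U, \<phi>) y (fst (r c y)) \<and>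
          (\<forall>v. blinfun_apply (snd (r' c y)) v = blinfun_apply (snd (r c y)) (J (U, \<phi>) y v))) (nhds x)"
        proof eventually_elim
          case (elim y)
          then have yU: "y \<in> \<phi> ` U" by (auto simp: c)
          have "r' c y = - GJ (U, \<phi>) y (r c y)"
            using that(3) elim \<open>c \<in> A\<close> unfolding in_eigenbundle_def c by force
          then show ?case by (simp add: GJ_at[OF cA yU] blinfun.minus_left)
        qed
      qed
      have 1: "GJ c x ?R = - ?M"
        using courant_type[OF ep[OF sm(1,2) eig(1)] ep[OF sm(3,4) eig(2)]]
        by (intro gtan_eqI)
          (simp_all add: c GJ_at[OF cA xU] blinfun.minus_left blinfun.diff_left blinfun.add_left algebra_simps)
      have "GJ c x (- ?M) = - ?R"
        using GJ_algebra(2)[OF cA xU, of ?R] by (simp only: 1 flip: c)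
      then have "GJ c x ?M = ?R"
        using linear_neg[OF GJ_algebra(1)[OF cA xU], of ?M] unfolding c by (metis neg_equal_iff_equal)
      with 1 show ?thesis ..
    qed
    then show "in_eigenbundle A GJ W
          (\<lambda>c x. ?C (s c) (t c) x - ?C (s' c) (t' c) x) (\<lambda>c x. ?C (s c) (t' c) x + ?C (s' c) (t c) x)"
      unfolding in_eigenbundle_def by blast
  qed
qed

end

section \<open>Smooth parametrizations of constructed atlases\<close>

text \<open>A parametrization is a local diffeomorphism in all charts at once. This replaces an inspection of
  the transition maps, which would have to go through the layers of arbitrary
  domains introduced by \<open>push_atlas\<close>.\<close>

definition smooth_param :: "('a, 'e::euclidean_space) atlas \<Rightarrow> ('f::euclidean_space \<Rightarrow> 'a) \<Rightarrow> 'f \<Rightarrow> bool" where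
  "smooth_param A P w \<longleftrightarrow> (\<forall>U \<phi>. (U, \<phi>) \<in> A \<longrightarrow> P w \<in> U \<longrightarrow>
     eventually (\<lambda>z. P z \<in> U) (nhds w) \<and> ldiff (\<lambda>z. \<phi> (P z)) w)"

definition inj_charts :: "('a, 'e) atlas \<Rightarrow> bool" where
  "inj_charts A \<longleftrightarrow> (\<forall>U \<phi>. (U, \<phi>) \<in> A \<longrightarrow> inj_on \<phi> U)"

lemma smooth_param_cong:
  assumes "smooth_param A P w" "eventually (\<lambda>z. P z = P' z) (nhds w)"
  shows "smooth_param A P' w"
  unfolding smooth_param_def
proof (intro allI impI)
  fix U \<phi> assume c: "(U, \<phi>) \<in> A" "P' w \<in> U"
  have "P w \<in> U" using eventually_nhds_x_imp_x[OF assms(2)] c by simp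
  then have *: "eventually (\<lambda>z. P z \<in> U) (nhds w)" "ldiff (\<lambda>z. \<phi> (P z)) w"
    using assms(1) c by (auto simp: smooth_param_def)
  have "eventually (\<lambda>z. \<phi> (P z) = \<phi> (P' z)) (nhds w)" using assms(2) by eventually_elim simp
  then have "ldiff (\<lambda>z. \<phi> (P' z)) w" using ldiff_cong[OF *(2)] by simp
  moreover have "eventually (\<lambda>z. P' z \<in> U) (nhds w)" using assms(2) *(1) by eventually_elim simp
  ultimately show "eventually (\<lambda>z. P' z \<in> U) (nhds w) \<and> ldiff (\<lambda>z. \<phi> (P' z)) w" by simp
qed

lemma smooth_param_comp:
  assumes "smooth_param A P (h w)" "ldiff h w"
  shows "smooth_param A (\<lambda>z. P (h z)) w"
  unfolding smooth_param_def
proof (intro allI impI)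
  fix U \<phi> assume c: "(U, \<phi>) \<in> A" "P (h w) \<in> U"
  then have *: "eventually (\<lambda>z. P z \<in> U) (nhds (h w))" "ldiff (\<lambda>z. \<phi> (P z)) (h w)"
    using assms(1) by (auto simp: smooth_param_def)
  show "eventually (\<lambda>z. P (h z) \<in> U) (nhds w) \<and> ldiff (\<lambda>z. \<phi> (P (h z))) w"
    using smooth_at_eventually_comp[OF ldiff_smooth[OF assms(2)] *(1)] ldiff_comp[OF assms(2) *(2)] by simp
qed

lemma smooth_param_Un:
  "smooth_param A P w \<Longrightarrow> smooth_param B P w \<Longrightarrow> smooth_param (A \<union> B) P w"
  by (auto simp: smooth_param_def)

lemma smooth_param_UN:
  "(\<And>l. l \<in> L \<Longrightarrow> smooth_param (A l) P w) \<Longrightarrow> smooth_param (\<Union>l\<in>L. A l) P w"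
  by (auto simp: smooth_param_def)

text \<open>A chart of a pushed atlas is a chart composed with a local section of \<open>\<pi>\<close>. Along a parametrization
  this section agrees with any continuous lift through the right point, so it is enough to find such
  a lift for each preimage.\<close>

lemma smooth_param_push:
  assumes inj: "inj_charts A"
    and lift: "\<And>U \<phi> x. (U, \<phi>) \<in> A \<Longrightarrow> x \<in> U \<Longrightarrow> \<pi> x = P w \<Longrightarrow>
      \<exists>R. R w = x \<and> smooth_param A R w \<and> eventually (\<lambda>z. \<pi> (R z) = P z) (nhds w)"
  shows "smooth_param (push_atlas \<pi> A) P w"
  unfolding smooth_param_def
proof (intro allI impI)
  fix U' \<phi>' assume "(U', \<phi>') \<in> push_atlas \<pi> A" "P w \<in> U'"
  then obtain U \<phi> V x where V: "U' = \<pi> ` V" "\<phi>' = \<phi> \<circ> the_inv_into V \<pi>" "(U, \<phi>) \<in> A" "V \<subseteq> U"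
    "atlas_open A V" "inj_on \<pi> V" and x: "x \<in> V" "\<pi> x = P w"
    by (auto simp: push_atlas_def)
  then obtain R where R: "R w = x" "smooth_param A R w" "eventually (\<lambda>z. \<pi> (R z) = P z) (nhds w)"
    using lift[OF V(3) subsetD[OF V(4) x(1)] x(2)] by blast
  have RU: "eventually (\<lambda>z. R z \<in> U) (nhds w)" "ldiff (\<lambda>z. \<phi> (R z)) w"
    using R V x unfolding smooth_param_def by blast+
  have "open (\<phi> ` V)" using V unfolding atlas_open_def by (auto simp: Int_absorb1)
  then have "eventually (\<lambda>y. y \<in> \<phi> ` V) (nhds (\<phi> (R w)))"
    using x R by (intro eventually_nhds_in_open) auto
  from smooth_at_eventually_comp[OF ldiff_smooth[OF RU(2)] this] RU(1)
  have RV: "eventually (\<lambda>z. R z \<in> V) (nhds w)"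
  proof eventually_elim
    case (elim z)
    then obtain v where v: "v \<in> V" "\<phi> (R z) = \<phi> v" by blast
    moreover have "inj_on \<phi> U" using inj V by (auto simp: inj_charts_def)
    ultimately have "R z = v" using elim V(4) by (auto dest: inj_onD)
    then show ?case using v by simp
  qed
  have "eventually (\<lambda>z. \<phi> (R z) = \<phi>' (P z)) (nhds w)"
    using RV R(3)
  proof eventually_elim
    case (elim z)
    then have "the_inv_into V \<pi> (P z) = R z" by (intro the_inv_into_f_eq[OF V(6)]) auto
    then show ?case by (simp add: V(2))
  qed
  then have "ldiff (\<lambda>z. \<phi>' (P z)) w" by (rule ldiff_cong[OF RU(2)])
  moreover have "eventually (\<lambda>z. P z \<in> U') (nhds w)"
    using RV R(3) by eventually_elim (metis V(1) imageI)
  ultimately show "eventually (\<lambda>z. P z \<in> U') (nhds w) \<and> ldiff (\<lambda>z. \<phi>' (P z)) w" by simp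
qed

lemma smooth_param_restrict:
  assumes "smooth_param A P w" "P w \<in> W \<Longrightarrow> eventually (\<lambda>z. P z \<in> W) (nhds w)"
  shows "smooth_param (restrict_atlas W A) P w"
  using assms by (auto simp: smooth_param_def restrict_atlas_def eventually_conj_iff)

text \<open>Points are closed in the topology of an atlas; this lets parametrizations be restricted to the
  complement of the centres of the balls.\<close>

lemma smooth_param_avoid:
  assumes "inj_charts A" "smooth_param A P w" "(U, \<phi>) \<in> A" "P w \<in> U" "P w \<noteq> x"
  shows "eventually (\<lambda>z. P z \<noteq> x) (nhds w)"
proof (cases "x \<in> U")
  case True
  have P: "eventually (\<lambda>z. P z \<in> U) (nhds w)" "ldiff (\<lambda>z. \<phi> (P z)) w"
    using assms by (auto simp: smooth_param_def)
  have "\<phi> (P w) \<noteq> \<phi> x" using assms True by (auto simp: inj_charts_def dest: inj_onD)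
  then have "eventually (\<lambda>y. y \<noteq> \<phi> x) (nhds (\<phi> (P w)))"
    by (intro t1_space_nhds)
  from smooth_at_eventually_comp[OF ldiff_smooth[OF P(2)] this]
  show ?thesis by eventually_elim auto
next
  case False
  have "eventually (\<lambda>z. P z \<in> U) (nhds w)" using assms by (auto simp: smooth_param_def)
  then show ?thesis by eventually_elim (use False in auto)
qed

lemma ldiff_map_prod:
  assumes "ldiff f v" "ldiff g w"
  shows "ldiff (map_prod f g) (v, w)"
proof -
  obtain f' where f: "smooth_at f v" "smooth_at f' (f v)"
    "eventually (\<lambda>z. f' (f z) = z) (nhds v)" "eventually (\<lambda>y. f (f' y) = y) (nhds (f v))"
    using assms(1) by (auto simp: ldiff_def)
  obtain g' where g: "smooth_at g w" "smooth_at g' (g w)"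
    "eventually (\<lambda>z. g' (g z) = z) (nhds w)" "eventually (\<lambda>y. g (g' y) = y) (nhds (g w))"
    using assms(2) by (auto simp: ldiff_def)
  have sm: "smooth_at (map_prod f g) (v, w)" if "smooth_at f v" "smooth_at g w"
    for f :: "'x::euclidean_space \<Rightarrow> 'y::euclidean_space" and g :: "'z::euclidean_space \<Rightarrow> 'u::euclidean_space" and v w
    unfolding map_prod_def case_prod_beta
    using smooth_at_compose[of f fst "(v, w)"] smooth_at_compose[of g snd "(v, w)"] that
      smooth_at_bounded_linear[OF bounded_linear_fst] smooth_at_bounded_linear[OF bounded_linear_snd]
    by (intro smooth_at_Pair) auto
  have ev: "eventually (\<lambda>z. Q (fst z) \<and> R (snd z)) (nhds (v, w))" if "eventually Q (nhds v)" "eventually R (nhds w)"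
    for Q :: "'x::euclidean_space \<Rightarrow> bool" and R :: "'z::euclidean_space \<Rightarrow> bool" and v w
    using smooth_at_eventually_comp[OF smooth_at_bounded_linear[OF bounded_linear_fst, of "(v, w)"], of Q]
      smooth_at_eventually_comp[OF smooth_at_bounded_linear[OF bounded_linear_snd, of "(v, w)"], of R] that
    by (simp add: eventually_conj_iff)
  show ?thesis
  proof (rule ldiffI[where g = "map_prod f' g'"])
    show "eventually (\<lambda>z. map_prod f' g' (map_prod f g z) = z) (nhds (v, w))"
      using ev[OF f(3) g(3)] by eventually_elim (auto simp: map_prod_def case_prod_beta)
    show "eventually (\<lambda>z. map_prod f g (map_prod f' g' z) = z) (nhds (map_prod f g (v, w)))"
      using ev[OF f(4) g(4)] unfolding map_prod_simp
      by eventually_elim (auto simp: map_prod_def case_prod_beta)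
  qed (use sm f g in auto)
qed

lemma smooth_param_product:
  assumes "smooth_param A P v" "smooth_param B Q w"
  shows "smooth_param (product_atlas A B) (map_prod P Q) (v, w)"
  unfolding smooth_param_def
proof (intro allI impI)
  fix U' \<phi>' assume "(U', \<phi>') \<in> product_atlas A B" "map_prod P Q (v, w) \<in> U'"
  then obtain U \<phi> V \<psi> where U: "U' = U \<times> V" "\<phi>' = map_prod \<phi> \<psi>" "(U, \<phi>) \<in> A" "(V, \<psi>) \<in> B" "P v \<in> U" "Q w \<in> V"
    by (auto simp: product_atlas_def)
  have P: "eventually (\<lambda>z. P z \<in> U) (nhds v)" "ldiff (\<lambda>z. \<phi> (P z)) v"
    and Q: "eventually (\<lambda>z. Q z \<in> V) (nhds w)" "ldiff (\<lambda>z. \<psi> (Q z)) w"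
    using assms U by (auto simp: smooth_param_def)
  have "(\<lambda>z. \<phi>' (map_prod P Q z)) = map_prod (\<lambda>z. \<phi> (P z)) (\<lambda>z. \<psi> (Q z))"
    by (auto simp: U fun_eq_iff)
  then have "ldiff (\<lambda>z. \<phi>' (map_prod P Q z)) (v, w)" using ldiff_map_prod[OF P(2) Q(2)] by simp
  moreover have "eventually (\<lambda>z. map_prod P Q z \<in> U') (nhds (v, w))"
    using smooth_at_eventually_comp[OF smooth_at_bounded_linear[OF bounded_linear_fst, of "(v, w)"], of "\<lambda>z. P z \<in> U"]
      smooth_at_eventually_comp[OF smooth_at_bounded_linear[OF bounded_linear_snd, of "(v, w)"], of "\<lambda>z. Q z \<in> V"] P(1) Q(1)
    by (simp add: eventually_conj_iff U(1) mem_Times_iff)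
  ultimately show "eventually (\<lambda>z. map_prod P Q z \<in> U') (nhds (v, w)) \<and> ldiff (\<lambda>z. \<phi>' (map_prod P Q z)) (v, w)"
    by simp
qed

lemma smooth_param_remodel:
  assumes "smooth_param A P w" "\<And>x. ldiff T x"
  shows "smooth_param (remodel_atlas T A) P w"
  using assms ldiff_comp[of "\<lambda>z. _ (P z)" w T] by (auto simp: smooth_param_def remodel_atlas_def)

lemma inj_charts_push: "inj_charts A \<Longrightarrow> inj_charts (push_atlas \<pi> A)"
  unfolding inj_charts_def push_atlas_def
  by (auto intro!: comp_inj_on inj_on_the_inv_into simp: the_inv_into_onto) (blast intro: inj_on_subset)

lemma inj_charts_restrict: "inj_charts A \<Longrightarrow> inj_charts (restrict_atlas W A)"
  unfolding inj_charts_def restrict_atlas_def by (auto intro: inj_on_subset)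

lemma inj_charts_remodel: "inj_charts A \<Longrightarrow> inj T \<Longrightarrow> inj_charts (remodel_atlas T A)"
  unfolding inj_charts_def remodel_atlas_def by (auto intro!: comp_inj_on intro: inj_on_subset)

lemma inj_charts_product: "inj_charts A \<Longrightarrow> inj_charts B \<Longrightarrow> inj_charts (product_atlas A B)"
  unfolding inj_charts_def product_atlas_def by (auto intro!: map_prod_inj_on)

lemma ldiff_linear:
  assumes "linear f" "linear g" "\<And>x. g (f x) = x" "\<And>y. f (g y) = y"
  shows "ldiff f w"
  by (rule ldiffI[where g = g])
    (use assms in \<open>auto intro: smooth_at_bounded_linear simp: linear_conv_bounded_linear\<close>)


section \<open>The product of a lens space with the circle\<close>

definition cmul :: "complex \<Rightarrow> complex \<times> complex \<Rightarrow> complex \<times> complex" where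
  "cmul c v = (c * fst v, c * snd v)"

lemma linear_cmul_complex: "linear (cmul c)"
  by (auto intro!: linearI simp: cmul_def algebra_simps)

lemma cmul_cmul [simp]: "cmul c (cmul d v) = cmul (c * d) v"
  by (simp add: cmul_def mult.assoc)

lemma cmul_1 [simp]: "cmul 1 v = v"
  by (simp add: cmul_def)

lemma cmul_scaleR: "cmul c (r *\<^sub>R v) = r *\<^sub>R cmul c v"
  by (simp add: cmul_def scaleR_prod_def)

lemma norm_cmul: "norm (cmul c v) = cmod c * norm v"
  by (cases v) (simp add: cmul_def norm_Pair norm_mult power_mult_distrib real_sqrt_mult flip: distrib_left)

lemma scaleR_eq_cmul: "r *\<^sub>R v = cmul (of_real r) v"
  by (cases v) (simp add: cmul_def scaleR_conv_of_real)

lemma lens_proj_eq: "lens_proj p v = {cmul \<zeta> v | \<zeta>. \<zeta> ^ p = 1}"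
  by (cases v) (simp add: lens_proj_def cmul_def)

lemma lens_proj_cmul:
  assumes "p \<ge> 1" "\<zeta> ^ p = 1"
  shows "lens_proj p (cmul \<zeta> v) = lens_proj p v"
proof -
  have z: "\<zeta> \<noteq> 0" using assms by (auto simp: power_0_left split: if_splits)
  show ?thesis unfolding lens_proj_eq
  proof (intro equalityI subsetI; elim CollectE exE conjE)
    fix u \<xi> assume "u = cmul \<xi> (cmul \<zeta> v)" "\<xi> ^ p = 1"
    then have "u = cmul (\<xi> * \<zeta>) v" "(\<xi> * \<zeta>) ^ p = 1" using assms(2) by (simp_all add: power_mult_distrib)
    then show "u \<in> {cmul \<zeta> v |\<zeta>. \<zeta> ^ p = 1}" by blast
  next
    fix u \<xi> assume "u = cmul \<xi> v" "\<xi> ^ p = 1"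
    then have "u = cmul (\<xi> / \<zeta>) (cmul \<zeta> v)" "(\<xi> / \<zeta>) ^ p = 1" using assms(2) z by (simp_all add: power_divide)
    then show "u \<in> {cmul \<xi> (cmul \<zeta> v) |\<xi>. \<xi> ^ p = 1}" by blast
  qed
qed

lemma lens_proj_eqD:
  assumes "p \<ge> 1" "lens_proj p x = lens_proj p v"
  shows "\<exists>\<zeta>. \<zeta> ^ p = 1 \<and> cmod \<zeta> = 1 \<and> x = cmul \<zeta> v"
proof -
  have "x \<in> lens_proj p x" by (auto simp: lens_proj_eq intro: exI[of _ 1])
  then obtain \<zeta> where "\<zeta> ^ p = 1" "x = cmul \<zeta> v" using assms by (auto simp: lens_proj_eq)
  moreover from this have "cmod \<zeta> = 1" using assms(1) power_eq_1_iff[of \<zeta> p] by auto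
  ultimately show ?thesis by blast
qed

definition stereo :: "complex \<times> complex \<Rightarrow> complex \<times> real" where
  "stereo v = (fst v / of_real (1 - Im (snd v)), Re (snd v) / (1 - Im (snd v)))"

definition inv_stereo :: "complex \<times> real \<Rightarrow> complex \<times> complex" where
  "inv_stereo y = (let n = fst y \<bullet> fst y + snd y * snd y in
     (of_real (2 / (n + 1)) * fst y, of_real (2 * snd y / (n + 1)) + \<i> * of_real ((n - 1) / (n + 1))))"

lemma inv_stereo_denom: "fst y \<bullet> fst y + snd y * snd y + 1 > 0" for y :: "complex \<times> real"
  using inner_ge_zero[of "fst y"] zero_le_square[of "snd y"] by linarith

lemma stereo_inv_stereo [simp]: "stereo (inv_stereo y) = y"
proof -
  define n where "n = fst y \<bullet> fst y + snd y * snd y"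
  have n: "n + 1 > 0" using inv_stereo_denom[of y] by (simp add: n_def)
  have im: "1 - (n - 1) / (n + 1) = 2 / (n + 1)" using n by (simp add: field_simps)
  have ne: "complex_of_real (2 / (n + 1)) \<noteq> 0" unfolding of_real_eq_0_iff using n by simp
  have "stereo (inv_stereo y) =
    (of_real (2 / (n + 1)) * fst y / of_real (2 / (n + 1)), (2 * snd y / (n + 1)) / (2 / (n + 1)))"
    by (simp add: stereo_def inv_stereo_def Let_def im flip: n_def)
  also have "\<dots> = y" using n ne by (simp add: prod_eq_iff)
  finally show ?thesis .
qed

lemma norm_inv_stereo [simp]: "norm (inv_stereo y) = 1"
proof -
  define n where "n = fst y \<bullet> fst y + snd y * snd y"
  have n: "n + 1 > 0" using inv_stereo_denom[of y] by (simp add: n_def)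
  have "(norm (inv_stereo y))\<^sup>2 = (2 / (n + 1))\<^sup>2 * (fst y \<bullet> fst y) + (2 * snd y / (n + 1))\<^sup>2 + ((n - 1) / (n + 1))\<^sup>2"
  proof -
    have 1: "(cmod (of_real (2 / (n + 1)) * fst y))\<^sup>2 = (2 / (n + 1))\<^sup>2 * (fst y \<bullet> fst y)"
      unfolding norm_mult power_mult_distrib dot_square_norm norm_of_real power2_abs ..
    have 2: "(cmod (of_real (2 * snd y / (n + 1)) + \<i> * of_real ((n - 1) / (n + 1))))\<^sup>2
      = (2 * snd y / (n + 1))\<^sup>2 + ((n - 1) / (n + 1))\<^sup>2"
      unfolding cmod_power2 by simp
    show ?thesis unfolding inv_stereo_def Let_def n_def[symmetric] norm_Pair
      by (subst real_sqrt_pow2) (simp_all only: 1 2 add.assoc, simp add: 1 2 add_nonneg_nonneg)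
  qed
  also have "\<dots> = (4 * n + (n - 1)\<^sup>2) / (n + 1)\<^sup>2"
  proof -
    have f: "fst y \<bullet> fst y = n - snd y * snd y" by (simp add: n_def)
    show ?thesis unfolding f power_divide by (simp add: power2_eq_square algebra_simps flip: add_divide_distrib)
  qed
  also have "4 * n + (n - 1)\<^sup>2 = (n + 1)\<^sup>2" by (simp add: power2_eq_square algebra_simps)
  finally have "(norm (inv_stereo y))\<^sup>2 = 1" using n by simp
  then show ?thesis by (simp add: power2_eq_1_iff) (smt (verit) norm_ge_zero)
qed

lemma inv_stereo_stereo:
  assumes "norm v = 1" "v \<noteq> (0, \<i>)"
  shows "Im (snd v) \<noteq> 1" "inv_stereo (stereo v) = v"
proof -
  obtain z w where v: "v = (z, w)" by (cases v)
  have 1: "(cmod z)\<^sup>2 + (Re w)\<^sup>2 + (Im w)\<^sup>2 = 1"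
    using assms(1) by (simp add: v norm_Pair cmod_power2)
  show i: "Im (snd v) \<noteq> 1"
  proof
    assume "Im (snd v) = 1"
    then have "(cmod z)\<^sup>2 + (Re w)\<^sup>2 = 0" using 1 by (simp add: v)
    then have "z = 0" "Re w = 0" by (simp_all add: sum_power2_eq_zero_iff)
    then show False using assms(2) \<open>Im (snd v) = 1\<close> by (simp add: v complex_eq_iff)
  qed
  define d where "d = 1 - Im w"
  have d: "d \<noteq> 0" "Im w = 1 - d" using i by (simp_all add: v d_def)
  have n: "fst (stereo v) \<bullet> fst (stereo v) + snd (stereo v) * snd (stereo v) = 2 / d - 1"
  proof -
    have "fst (stereo v) \<bullet> fst (stereo v) + snd (stereo v) * snd (stereo v) = ((cmod z)\<^sup>2 + (Re w)\<^sup>2) / d\<^sup>2"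
      unfolding stereo_def v fst_conv snd_conv d_def[symmetric] dot_square_norm norm_divide norm_of_real
        power_divide power2_abs by (simp add: power2_eq_square add_divide_distrib)
    also have "(cmod z)\<^sup>2 + (Re w)\<^sup>2 = d * (2 - d)"
      using 1 by (simp add: d(2) power2_eq_square algebra_simps)
    also have "\<dots> / d\<^sup>2 = 2 / d - 1" using d(1) by (simp add: power2_eq_square field_simps)
    finally show ?thesis .
  qed
  have 2: "2 / (2 / d - 1 + 1) = d" "(2 / d - 1 - 1) / (2 / d - 1 + 1) = 1 - d"
    using d(1) by (simp_all add: field_simps)
  have "inv_stereo (stereo v) = (of_real d * (z / of_real d), of_real (d * (Re w / d)) + \<i> * of_real (1 - d))"
    unfolding inv_stereo_def Let_def n 2 using d(1)
    by (simp add: stereo_def v field_simps flip: d_def)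
  also have "\<dots> = v" using d by (simp add: v complex_eq_iff)
  finally show "inv_stereo (stereo v) = v" .
qed

lemma smooth_at_stereo: "Im (snd v) \<noteq> 1 \<Longrightarrow> smooth_at stereo v"
  unfolding stereo_def[abs_def] by (intro smooth) (auto simp: complex_eq_iff)

lemma smooth_at_inv_stereo: "smooth_at inv_stereo y"
  unfolding inv_stereo_def[abs_def] Let_def
  by (intro smooth) (use inv_stereo_denom[of y] in \<open>auto\<close>)

definition isometry :: "('v::real_inner \<Rightarrow> 'v) \<Rightarrow> ('v \<Rightarrow> 'v) \<Rightarrow> bool" where
  "isometry R R' \<longleftrightarrow> linear R \<and> linear R' \<and> (\<forall>v. norm (R v) = norm v) \<and> (\<forall>v. norm (R' v) = norm v) \<and>
     (\<forall>v. R (R' v) = v) \<and> (\<forall>v. R' (R v) = v)"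

lemma isometryD:
  assumes "isometry R R'"
  shows "norm (R v) = norm v" "norm (R' v) = norm v" "R (R' v) = v" "R' (R v) = v"
  using assms unfolding isometry_def by blast+

lemma isometry_sym: "isometry R R' \<Longrightarrow> isometry R' R"
  by (auto simp: isometry_def)

lemma isometry_comp: "isometry R R' \<Longrightarrow> isometry T T' \<Longrightarrow> isometry (\<lambda>v. R (T v)) (\<lambda>v. T' (R' v))"
  using linear_compose[of T R] linear_compose[of R' T'] by (simp add: isometry_def o_def)

lemma isometry_uminus: "isometry uminus uminus"
  by (simp add: isometry_def linear_uminus)

lemma isometry_ident: "isometry (\<lambda>v. v) (\<lambda>v. v)"
  by (simp add: isometry_def linear_ident)

lemma isometry_cmul:
  assumes "cmod \<zeta> = 1"
  shows "isometry (cmul \<zeta>) (cmul (inverse \<zeta>))"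
proof -
  have "\<zeta> \<noteq> 0" using assms by auto
  then show ?thesis by (simp add: isometry_def linear_cmul_complex norm_cmul assms norm_inverse)
qed

definition cnj2 :: "complex \<times> complex \<Rightarrow> complex \<times> complex" where
  "cnj2 v = (cnj (fst v), cnj (snd v))"

lemma isometry_cnj2: "isometry cnj2 cnj2"
  by (auto simp: isometry_def cnj2_def norm_prod_def intro!: linearI)

lemma smooth_at_isometry: "isometry R R' \<Longrightarrow> smooth_at R v"
  for R :: "'v::euclidean_space \<Rightarrow> 'v"
  by (intro smooth_at_bounded_linear) (auto simp: isometry_def linear_conv_bounded_linear)

lemma eventually_avoid_pole:
  assumes "smooth_at f w" "f w \<noteq> x"
  shows "eventually (\<lambda>z. f z \<noteq> x) (nhds w)"
  by (rule smooth_at_eventually_comp[OF assms(1) t1_space_nhds[OF assms(2)]])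

text \<open>The transition maps of the sphere, seen through an isometry of the ambient space: this
  covers both charts and all deck transformations at once.\<close>

lemma ldiff_stereo:
  assumes R: "isometry R R'" and ne: "R (inv_stereo y) \<noteq> (0, \<i>)"
  shows "ldiff (\<lambda>y. stereo (R (inv_stereo y))) y"
proof (rule ldiffI[where g = "\<lambda>y. stereo (R' (inv_stereo y))"])
  have sm: "smooth_at (\<lambda>y. stereo (R (inv_stereo y))) y"
    if "isometry R R'" "R (inv_stereo y) \<noteq> (0, \<i>)" for R R' y
  proof -
    have "norm (R (inv_stereo y)) = 1" by (simp add: isometryD[OF that(1)])
    then have "smooth_at stereo (R (inv_stereo y))" using inv_stereo_stereo(1) smooth_at_stereo that(2) by blast
    then show ?thesis
      by (intro smooth_at_compose[of stereo "\<lambda>y. R (inv_stereo y)"]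
          smooth_at_compose[of R inv_stereo] smooth_at_isometry[OF that(1)] smooth_at_inv_stereo)
  qed
  have ev: "eventually (\<lambda>z. stereo (R' (inv_stereo (stereo (R (inv_stereo z))))) = z) (nhds y)"
    if R: "isometry R R'" and "R (inv_stereo y) \<noteq> (0, \<i>)" for R R' y
  proof -
    have "eventually (\<lambda>z. R (inv_stereo z) \<noteq> (0, \<i>)) (nhds y)"
      by (intro eventually_avoid_pole smooth_at_compose[of R inv_stereo] smooth_at_isometry[OF R] smooth_at_inv_stereo that)
    then show ?thesis
    proof eventually_elim
      case (elim z)
      have "inv_stereo (stereo (R (inv_stereo z))) = R (inv_stereo z)"
        using elim by (intro inv_stereo_stereo(2)) (auto simp: isometryD[OF R])
      then show ?case by (simp add: isometryD[OF R])
    qed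
  qed
  have "inv_stereo (stereo (R (inv_stereo y))) = R (inv_stereo y)"
    using ne by (intro inv_stereo_stereo(2)) (auto simp: isometryD[OF R])
  then have eq: "R' (inv_stereo (stereo (R (inv_stereo y)))) = inv_stereo y"
    by (simp add: isometryD[OF R])
  have "inv_stereo y \<noteq> (0, \<i>)"
    using inv_stereo_denom[of y] by (auto simp: inv_stereo_def Let_def complex_eq_iff field_simps)
  then have ne2: "R' (inv_stereo (stereo (R (inv_stereo y)))) \<noteq> (0, \<i>)" unfolding eq .
  show "smooth_at (\<lambda>y. stereo (R (inv_stereo y))) y" by (rule sm[OF R ne])
  show "smooth_at (\<lambda>y. stereo (R' (inv_stereo y))) (stereo (R (inv_stereo y)))"
    by (rule sm[OF isometry_sym[OF R] ne2])
  show "eventually (\<lambda>z. stereo (R' (inv_stereo (stereo (R (inv_stereo z))))) = z) (nhds y)"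
    by (rule ev[OF R ne])
  show "eventually (\<lambda>z. stereo (R (inv_stereo (stereo (R' (inv_stereo z))))) = z) (nhds (stereo (R (inv_stereo y))))"
    by (rule ev[OF isometry_sym[OF R] ne2])
qed

lemma sphere3_eq:
  "sphere3 = {(sphere 0 1 - {(0, \<i>)}, stereo), (sphere 0 1 - {(0, - \<i>)}, \<lambda>v. stereo (cnj2 v))}"
proof -
  have "stereo = (\<lambda>(z, w). (z / of_real (1 - Im w), Re w / (1 - Im w)))"
    "(\<lambda>v. stereo (cnj2 v)) = (\<lambda>(z, w). (cnj z / of_real (1 + Im w), Re w / (1 + Im w)))"
    by (simp_all add: stereo_def cnj2_def fun_eq_iff)
  then show ?thesis by (simp only: sphere3_def)
qed

lemma smooth_param_sphere3:
  assumes R: "isometry R R'"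
  shows "smooth_param sphere3 (\<lambda>y. R (inv_stereo y)) y"
proof -
  have n: "norm (R (inv_stereo y)) = 1" for y by (simp add: isometryD[OF R])
  have sm: "smooth_at (\<lambda>y. R (inv_stereo y)) y"
    by (intro smooth_at_compose[of R inv_stereo] smooth_at_isometry[OF R] smooth_at_inv_stereo)
  have "ldiff (\<lambda>y. stereo (cnj2 (R (inv_stereo y)))) y" if "R (inv_stereo y) \<noteq> (0, - \<i>)"
    by (rule ldiff_stereo[OF isometry_comp[OF isometry_cnj2 R]])
      (use that in \<open>auto simp: cnj2_def prod_eq_iff complex_eq_iff\<close>)
  then show ?thesis
    using ldiff_stereo[OF R] eventually_avoid_pole[OF sm]
    by (auto simp: smooth_param_def sphere3_eq n)
qed

lemma inj_charts_sphere3: "inj_charts sphere3"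
proof -
  have "inj_on stereo (sphere 0 1 - {(0, \<i>)})"
    by (rule inj_on_inverseI[where g = inv_stereo]) (auto intro: inv_stereo_stereo)
  moreover have "inj_on (\<lambda>v. stereo (cnj2 v)) (sphere 0 1 - {(0, - \<i>)})"
  proof (rule inj_on_inverseI[where g = "\<lambda>y. cnj2 (inv_stereo y)"])
    fix v :: "complex \<times> complex" assume v: "v \<in> sphere 0 1 - {(0, - \<i>)}"
    then have "inv_stereo (stereo (cnj2 v)) = cnj2 v"
      by (intro inv_stereo_stereo)
        (simp_all add: isometryD[OF isometry_cnj2], auto simp: cnj2_def prod_eq_iff complex_eq_iff)
    then show "cnj2 (inv_stereo (stereo (cnj2 v))) = v" by (simp add: isometryD[OF isometry_cnj2])
  qed
  ultimately show ?thesis by (auto simp: inj_charts_def sphere3_eq)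
qed

lemma smooth_param_lens_space:
  assumes "p \<ge> 1" and R: "isometry R R'"
  shows "smooth_param (lens_space p) (\<lambda>y. lens_proj p (R (inv_stereo y))) y"
  unfolding lens_space_def
proof (rule smooth_param_push[OF inj_charts_sphere3])
  fix x assume "lens_proj p x = lens_proj p (R (inv_stereo y))"
  then obtain \<zeta> where z: "\<zeta> ^ p = 1" "cmod \<zeta> = 1" "x = cmul \<zeta> (R (inv_stereo y))"
    using lens_proj_eqD[OF assms(1)] by blast
  show "\<exists>S. S y = x \<and> smooth_param sphere3 S y \<and> eventually (\<lambda>z. lens_proj p (S z) = lens_proj p (R (inv_stereo z))) (nhds y)"
  proof (intro exI conjI)
    show "cmul \<zeta> (R (inv_stereo y)) = x" using z by simp
    show "smooth_param sphere3 (\<lambda>y. cmul \<zeta> (R (inv_stereo y))) y"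
      by (rule smooth_param_sphere3[OF isometry_comp[OF isometry_cmul[OF z(2)] R]])
    show "eventually (\<lambda>z. lens_proj p (cmul \<zeta> (R (inv_stereo z))) = lens_proj p (R (inv_stereo z))) (nhds y)"
      by (simp add: lens_proj_cmul[OF assms(1) z(1)])
  qed
qed

lemma smooth_param_circle: "smooth_param circle cis t"
  unfolding circle_def
proof (rule smooth_param_push)
  show "inj_charts {(UNIV, id :: real \<Rightarrow> real)}" by (simp add: inj_charts_def)
  fix s :: real assume s: "cis s = cis t"
  have c: "cis (z + (s - t)) = cis z" for z
  proof -
    have "cis (z + (s - t)) = cis z * (cis s / cis t)" by (simp add: cis_divide cis_mult)
    then show ?thesis using s by simp
  qed
  have l: "ldiff (\<lambda>z. z + (s - t)) t"
    by (rule ldiffI[where g = "\<lambda>z. z - (s - t)"]) (auto intro!: smooth)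
  show "\<exists>R. R t = s \<and> smooth_param {(UNIV, id :: real \<Rightarrow> real)} R t \<and> eventually (\<lambda>z. cis (R z) = cis z) (nhds t)"
    by (rule exI[of _ "\<lambda>z. z + (s - t)"]) (use l c in \<open>auto simp: smooth_param_def\<close>)
qed

text \<open>The quotient map from \<open>\<complex>\<^sup>2 - {0}\<close> onto the Hopf surface. The sign of the angle agrees with the one
  in \<open>lens_circle_ball\<close>, so the balls lift to round balls.\<close>

definition hopf :: "nat \<Rightarrow> complex \<times> complex \<Rightarrow> (complex \<times> complex) set \<times> complex" where
  "hopf p w = (lens_proj p (w /\<^sub>R norm w), cis (- ln (norm w)))"

lemma ldiff_remodel_circle: "ldiff (\<lambda>((z, s), t). (z, Complex s t)) x"
  by (rule ldiff_linear[where g = "\<lambda>(z, u). ((z, Re u), Im u)"])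
    (auto intro!: linearI simp: complex_eq_iff)

text \<open>Polar coordinates. The isometry \<open>R\<close> moves \<open>w\<close> away from the ray through the pole of the projection.\<close>

lemma ldiff_polar:
  assumes "w \<noteq> 0" and R: "isometry R R'" and ne: "R (w /\<^sub>R norm w) \<noteq> (0, \<i>)"
  shows "ldiff (\<lambda>w. (stereo (R (w /\<^sub>R norm w)), - ln (norm w))) w"
proof (rule ldiffI[where g = "\<lambda>(y, t). exp (- t) *\<^sub>R R' (inv_stereo y)"])
  have sm: "smooth_at (\<lambda>w. R (w /\<^sub>R norm w)) w"
    by (intro smooth_at_compose[of R "\<lambda>w. w /\<^sub>R norm w"] smooth_at_isometry[OF R] smooth_at_rules
        smooth_at_inverse smooth_at_norm smooth_at_ident) (use assms in auto)
  have n1: "norm (R (z /\<^sub>R norm z)) = 1" if "z \<noteq> 0" for z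
    using that by (simp add: isometryD[OF R])
  show "smooth_at (\<lambda>w. (stereo (R (w /\<^sub>R norm w)), - ln (norm w))) w"
    by (intro smooth_at_Pair smooth_at_compose[OF _ sm] smooth_at_stereo inv_stereo_stereo(1) n1 ne
        smooth_at_rules(12) smooth_at_ln smooth_at_norm smooth_at_ident) (use assms(1) in auto)
  show "smooth_at (\<lambda>(y, t). exp (- t) *\<^sub>R R' (inv_stereo y)) (stereo (R (w /\<^sub>R norm w)), - ln (norm w))"
    unfolding case_prod_beta
    by (intro smooth_at_rules smooth_at_exp smooth_at_compose[of R' "\<lambda>y. inv_stereo (fst y)"]
        smooth_at_isometry[OF isometry_sym[OF R]] smooth_at_compose[of inv_stereo fst]
        smooth_at_inv_stereo smooth_at_ident)
  have "eventually (\<lambda>z. z \<noteq> 0) (nhds w)" using t1_space_nhds[OF assms(1)] .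
  then show "eventually (\<lambda>z. (case (stereo (R (z /\<^sub>R norm z)), - ln (norm z)) of
      (y, t) \<Rightarrow> exp (- t) *\<^sub>R R' (inv_stereo y)) = z) (nhds w)"
    using eventually_avoid_pole[OF sm ne]
  proof eventually_elim
    case (elim z)
    then have "inv_stereo (stereo (R (z /\<^sub>R norm z))) = R (z /\<^sub>R norm z)"
      using n1 by (intro inv_stereo_stereo(2)) auto
    then show ?case using elim by (simp add: isometryD[OF R])
  qed
  have "(stereo (R (z /\<^sub>R norm z)), - ln (norm z)) = x" if "z = exp (- snd x) *\<^sub>R R' (inv_stereo (fst x))" for z x
  proof -
    have "norm z = exp (- snd x)" by (simp add: that isometryD[OF R])
    then have "z /\<^sub>R norm z = R' (inv_stereo (fst x))" "ln (norm z) = - snd x" by (simp_all add: that)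
    then show ?thesis by (simp only: isometryD[OF R] stereo_inv_stereo minus_minus prod.collapse)
  qed
  then show "eventually (\<lambda>x. (stereo (R ((case x of (y, t) \<Rightarrow> exp (- t) *\<^sub>R R' (inv_stereo y)) /\<^sub>R
       norm (case x of (y, t) \<Rightarrow> exp (- t) *\<^sub>R R' (inv_stereo y)))),
       - ln (norm (case x of (y, t) \<Rightarrow> exp (- t) *\<^sub>R R' (inv_stereo y)))) = x)
     (nhds (stereo (R (w /\<^sub>R norm w)), - ln (norm w)))"
    by (intro always_eventually) (simp only: case_prod_beta simp_thms)
qed

lemma smooth_param_lens_circle:
  assumes p: "p \<ge> 1" and w: "w \<noteq> 0"
  shows "smooth_param (lens_circle p) (hopf p) w"
proof -
  have "\<exists>R. isometry R R \<and> R (w /\<^sub>R norm w) \<noteq> (0, \<i>)"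
  proof (cases "w /\<^sub>R norm w = (0, \<i>)")
    case True
    then show ?thesis using isometry_uminus by (intro exI[of _ uminus]) (simp add: complex_eq_iff)
  next
    case False
    then show ?thesis using isometry_ident by blast
  qed
  then obtain R where R: "isometry R R" "R (w /\<^sub>R norm w) \<noteq> (0, \<i>)" by blast
  define P where "P = map_prod (\<lambda>y. lens_proj p (R (inv_stereo y))) cis"
  define \<kappa> where "\<kappa> = (\<lambda>w. (stereo (R (w /\<^sub>R norm w)), - ln (norm w)))"
  have "smooth_param (lens_circle p) P (\<kappa> w)"
    unfolding lens_circle_def P_def \<kappa>_def
    by (intro smooth_param_remodel smooth_param_product smooth_param_lens_space[OF p R(1)]
        smooth_param_circle ldiff_remodel_circle)
  then have "smooth_param (lens_circle p) (\<lambda>w. P (\<kappa> w)) w"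
    by (rule smooth_param_comp) (use ldiff_polar[OF w R] in \<open>simp add: \<kappa>_def\<close>)
  moreover have "eventually (\<lambda>z. P (\<kappa> z) = hopf p z) (nhds w)"
  proof -
    have sm: "smooth_at (\<lambda>w. R (w /\<^sub>R norm w)) w"
      by (intro smooth_at_compose[of R "\<lambda>w. w /\<^sub>R norm w"] smooth_at_isometry[OF R(1)] smooth_at_rules
          smooth_at_inverse smooth_at_norm smooth_at_ident) (use w in auto)
    show ?thesis
      using t1_space_nhds[OF w] eventually_avoid_pole[OF sm R(2)]
    proof eventually_elim
      case (elim z)
      then have "inv_stereo (stereo (R (z /\<^sub>R norm z))) = R (z /\<^sub>R norm z)"
        by (intro inv_stereo_stereo(2)) (auto simp: isometryD[OF R(1)])
      then show ?case by (simp add: P_def \<kappa>_def hopf_def isometryD[OF R(1)])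
    qed
  qed
  ultimately show ?thesis by (rule smooth_param_cong)
qed

lemma inj_charts_lens_circle: "inj_charts (lens_circle p)"
proof -
  have "inj (\<lambda>((z, s), t). (z :: complex, Complex s t))" by (auto intro!: injI)
  moreover have "inj_charts circle" unfolding circle_def by (rule inj_charts_push) (simp add: inj_charts_def)
  ultimately show ?thesis
    unfolding lens_circle_def lens_space_def
    by (intro inj_charts_remodel inj_charts_product inj_charts_push inj_charts_sphere3)
qed

lemma lens_circle_hopf:
  assumes "(U, \<phi>) \<in> lens_circle p" "x \<in> U"
  shows "\<exists>w. w \<noteq> 0 \<and> hopf p w = x"
proof -
  obtain v t where v: "x = (lens_proj p v, cis t)" "norm v = 1"
    using assms
    by (fastforce simp: lens_circle_def remodel_atlas_def product_atlas_def lens_space_def circle_def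
        push_atlas_def sphere3_eq)
  have "norm (exp (- t) *\<^sub>R v) = exp (- t)" using v by simp
  then have "hopf p (exp (- t) *\<^sub>R v) = x" by (simp add: hopf_def v)
  moreover have "exp (- t) *\<^sub>R v \<noteq> 0" using v by auto
  ultimately show ?thesis by blast
qed

section \<open>Radial profiles\<close>

definition sin_sqrt_div_sqrt :: "real \<Rightarrow> real" where
  "sin_sqrt_div_sqrt x = (\<Sum>n. (-1) ^ n / fact (2 * n + 1) * x ^ n)"

definition cos_sqrt :: "real \<Rightarrow> real" where
  "cos_sqrt x = (\<Sum>n. (-1) ^ n / fact (2 * n) * x ^ n)"

lemma sin_sqrt_sums:
  fixes r :: real
  assumes "r \<noteq> 0"
  shows "(\<lambda>n. (-1) ^ n / fact (2 * n + 1) * (r\<^sup>2) ^ n) sums (sin r / r)"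
proof -
  have "(\<lambda>n. (-1) ^ n / fact (2 * n + 1) * r ^ (2 * n + 1) / r) =
      (\<lambda>n. (-1) ^ n / fact (2 * n + 1) * (r\<^sup>2) ^ n)"
    using assms by (simp add: power_mult fun_eq_iff)
  then show ?thesis using sums_divide[OF sin_paired[of r], of r] by simp
qed

lemma cos_sqrt_sums: "(\<lambda>n. (-1) ^ n / fact (2 * n) * (r\<^sup>2) ^ n) sums cos (r :: real)"
  using cos_paired[of r] by (simp add: power_mult)

lemma smooth_at_sin_sqrt: "smooth_at sin_sqrt_div_sqrt x"
  unfolding sin_sqrt_div_sqrt_def[abs_def]
proof (rule smooth_at_power_series[where K = "\<bar>x\<bar> + 1"])
  fix z :: real assume z: "\<bar>z\<bar> < \<bar>x\<bar> + 1"
  have "summable (\<lambda>n. (-1) ^ n / fact (2 * n + 1) * ((sqrt (\<bar>x\<bar> + 1))\<^sup>2) ^ n)"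
    using sin_sqrt_sums[of "sqrt (\<bar>x\<bar> + 1)"] by (auto simp: sums_iff)
  then show "summable (\<lambda>n. (-1) ^ n / fact (2 * n + 1) * z ^ n)"
    by (rule powser_inside) (use z in auto)
qed auto

lemma smooth_at_cos_sqrt: "smooth_at cos_sqrt x"
  unfolding cos_sqrt_def[abs_def]
proof (rule smooth_at_power_series[where K = "\<bar>x\<bar> + 1"])
  fix z :: real assume z: "\<bar>z\<bar> < \<bar>x\<bar> + 1"
  have "summable (\<lambda>n. (-1) ^ n / fact (2 * n) * ((sqrt (\<bar>x\<bar> + 1))\<^sup>2) ^ n)"
    using cos_sqrt_sums[of "sqrt (\<bar>x\<bar> + 1)"] by (auto simp: sums_iff)
  then show "summable (\<lambda>n. (-1) ^ n / fact (2 * n) * z ^ n)"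
    by (rule powser_inside) (use z in auto)
qed auto

text \<open>
  At distance \<open>t\<close> from the line at infinity along a normal geodesic, where \<open>0 < t < 1\<close> is the
  parameter in the connected sum, the affine fibre coordinate over the point \<open>[0:1:b]\<close> has modulus
  \<open>tan (pi / 2 * t)\<close> times the norm of \<open>(1, b)\<close>. The quotients of the tangent function
  \<open>t \<mapsto> tan (pi / 2 * t)\<close> and of its inverse by their arguments extend smoothly over 0 as functions of the square of the argument. They are \<open>tan_profile\<close> and
  \<open>arctan_profile\<close>, and the change of coordinates between the projective plane and the
  blow-up is built from them.
\<close>

definition tan_profile :: "real \<Rightarrow> real" where
  "tan_profile x = pi / 2 * sin_sqrt_div_sqrt (pi\<^sup>2 / 4 * x) / cos_sqrt (pi\<^sup>2 / 4 * x)"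

definition arctan_profile :: "real \<Rightarrow> real" where
  "arctan_profile y = 2 / pi * (if y < 1 then \<Sum>n. (-1) ^ n / real (n * 2 + 1) * y ^ n else arctan (sqrt y) / sqrt y)"

lemma cos_sqrt_pos:
  assumes "0 \<le> x" "x < 1"
  shows "cos_sqrt (pi\<^sup>2 / 4 * x) > 0"
proof -
  have x: "pi\<^sup>2 / 4 * x = (pi / 2 * sqrt x)\<^sup>2" using assms by (simp add: power_mult_distrib power_divide)
  have "cos_sqrt (pi\<^sup>2 / 4 * x) = cos (pi / 2 * sqrt x)"
    unfolding x cos_sqrt_def using cos_sqrt_sums by (simp only: sums_iff)
  moreover have "sqrt x < 1" "sqrt x \<ge> 0" using assms by simp_all
  then have "pi / 2 * sqrt x < pi / 2" "pi / 2 * sqrt x \<ge> 0" by simp_all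
  ultimately show ?thesis using cos_gt_zero_pi[of "pi / 2 * sqrt x"] by (smt (verit) pi_gt_zero)
qed

lemma smooth_at_tan_profile:
  assumes "0 \<le> x" "x < 1"
  shows "smooth_at tan_profile x"
proof -
  have l: "smooth_at (\<lambda>x. pi\<^sup>2 / 4 * x) x" by (intro smooth_at_rules smooth_at_ident)
  show ?thesis
    unfolding tan_profile_def[abs_def]
    using smooth_at_compose[OF smooth_at_sin_sqrt l] smooth_at_compose[OF smooth_at_cos_sqrt l] cos_sqrt_pos[OF assms]
    by (intro smooth_at_divide smooth_at_rules) auto
qed

lemma tan_profile_0: "tan_profile 0 = pi / 2"
  using powser_zero[of "\<lambda>n. (-1) ^ n / fact (2 * n + 1) :: real"] powser_zero[of "\<lambda>n. (-1) ^ n / fact (2 * n) :: real"]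
  by (simp add: tan_profile_def sin_sqrt_div_sqrt_def cos_sqrt_def)

lemma tan_profile_square:
  assumes "r > 0"
  shows "tan_profile (r\<^sup>2) = tan (pi / 2 * r) / r"
proof -
  have x: "pi\<^sup>2 / 4 * r\<^sup>2 = (pi / 2 * r)\<^sup>2" by (simp add: power_mult_distrib power_divide)
  have "sin_sqrt_div_sqrt ((pi / 2 * r)\<^sup>2) = sin (pi / 2 * r) / (pi / 2 * r)"
    "cos_sqrt ((pi / 2 * r)\<^sup>2) = cos (pi / 2 * r)"
    unfolding sin_sqrt_div_sqrt_def cos_sqrt_def
    using sin_sqrt_sums[of "pi / 2 * r"] cos_sqrt_sums[of "pi / 2 * r"] assms by (simp_all only: sums_iff) auto
  then show ?thesis unfolding tan_profile_def x tan_def using assms by simp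
qed

lemma arctan_series_summable:
  assumes "\<bar>z\<bar> < 1"
  shows "summable (\<lambda>n. (-1) ^ n / real (n * 2 + 1) * z ^ n)"
  by (rule powser_inside[where x = 1]) (use assms summable_arctan_series[of 1] in auto)

lemma arctan_profile_pos:
  assumes "y > 0"
  shows "arctan_profile y = 2 / pi * arctan (sqrt y) / sqrt y"
proof (cases "y < 1")
  case True
  let ?s = "sqrt y"
  have "arctan ?s = (\<Sum>k. (-1) ^ k * (1 / real (k * 2 + 1) * ?s ^ (k * 2 + 1)))"
    using True assms by (intro arctan_series) simp
  also have "(\<lambda>k. (-1) ^ k * (1 / real (k * 2 + 1) * ?s ^ (k * 2 + 1))) =
      (\<lambda>k. ?s * ((-1) ^ k / real (k * 2 + 1) * y ^ k))"
  proof
    fix k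
    have "?s ^ (k * 2 + 1) = ?s * y ^ k" using assms by (simp add: power_mult mult.commute[of k])
    then show "(-1) ^ k * (1 / real (k * 2 + 1) * ?s ^ (k * 2 + 1)) = ?s * ((-1) ^ k / real (k * 2 + 1) * y ^ k)"
      by simp
  qed
  also have "(\<Sum>k. ?s * ((-1) ^ k / real (k * 2 + 1) * y ^ k)) = ?s * (\<Sum>k. (-1) ^ k / real (k * 2 + 1) * y ^ k)"
    using arctan_series_summable[of y] True assms by (intro suminf_mult) auto
  finally show ?thesis using True assms by (simp add: arctan_profile_def)
qed (simp add: arctan_profile_def)

lemma arctan_profile_0: "arctan_profile 0 = 2 / pi"
  using powser_zero[of "\<lambda>n. (-1) ^ n / real (n * 2 + 1)"] by (simp add: arctan_profile_def)

lemma smooth_at_arctan_profile: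
  assumes "0 \<le> y"
  shows "smooth_at arctan_profile y"
proof (cases "y = 0")
  case True
  have "smooth_at (\<lambda>y. 2 / pi * (\<Sum>n. (-1) ^ n / real (n * 2 + 1) * y ^ n)) y"
    using smooth_at_power_series[of 1 "\<lambda>n. (-1) ^ n / real (n * 2 + 1)" y] arctan_series_summable True
    by (intro smooth_at_rules) auto
  moreover have "eventually (\<lambda>z. z < 1) (nhds y)"
    using True eventually_nhds_in_open[of "{..<1}" y] by simp
  then have "eventually (\<lambda>y. 2 / pi * (\<Sum>n. (-1) ^ n / real (n * 2 + 1) * y ^ n) = arctan_profile y) (nhds y)"
    by eventually_elim (simp add: arctan_profile_def)
  ultimately show ?thesis by (rule smooth_at_cong[rotated])
next
  case False
  then have y: "y > 0" using assms by simp
  have "smooth_at (\<lambda>y. 2 / pi * arctan (sqrt y) / sqrt y) y"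
    by (intro smooth_at_divide smooth_at_rules smooth_at_arctan smooth_at_sqrt smooth_at_ident) (use y in auto)
  moreover have "eventually (\<lambda>z. z > 0) (nhds y)"
    using y eventually_nhds_in_open[of "{0<..}" y] by simp
  then have "eventually (\<lambda>y. 2 / pi * arctan (sqrt y) / sqrt y = arctan_profile y) (nhds y)"
    by eventually_elim (simp add: arctan_profile_pos)
  ultimately show ?thesis by (rule smooth_at_cong[rotated])
qed

text \<open>Multiplication by the radius turns the two profiles into a tangent and an arctangent; the
  lemma and the next one say that these are inverse to each other, including the limit at 0.\<close>

lemma profile_inverse1:
  assumes "0 \<le> x" "x < 1"
  shows "tan_profile x * arctan_profile (x * (tan_profile x)\<^sup>2) = 1"
proof (cases "x = 0")
  case True
  then show ?thesis by (simp add: tan_profile_0 arctan_profile_0)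
next
  case False
  define r where "r = sqrt x"
  have r: "0 < r" "r < 1" "x = r\<^sup>2" using assms False by (simp_all add: r_def)
  define T where "T = tan (pi / 2 * r)"
  have T: "T > 0" unfolding T_def using r by (intro tan_gt_zero) auto
  have t: "tan_profile x = T / r" using tan_profile_square[OF r(1)] by (simp add: r(3) T_def)
  have "x * (tan_profile x)\<^sup>2 = T\<^sup>2" using r(1) unfolding t by (simp add: power_divide r(3))
  moreover have "arctan_profile (T\<^sup>2) = 2 / pi * arctan T / T" using T arctan_profile_pos[of "T\<^sup>2"] by simp
  moreover have "pi / 2 * r < pi / 2" "- (pi / 2) < pi / 2 * r" using r pi_gt_zero
    by (simp, smt (verit) mult_pos_pos half_gt_zero)
  then have "arctan T = pi / 2 * r" unfolding T_def by (intro arctan_tan) auto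
  ultimately show ?thesis using r(1) T t by simp
qed

lemma profile_inverse2:
  assumes "0 \<le> y"
  shows "y * (arctan_profile y)\<^sup>2 < 1" "arctan_profile y * tan_profile (y * (arctan_profile y)\<^sup>2) = 1"
proof -
  have "y * (arctan_profile y)\<^sup>2 < 1 \<and> arctan_profile y * tan_profile (y * (arctan_profile y)\<^sup>2) = 1"
  proof (cases "y = 0")
    case True
    then show ?thesis by (simp add: tan_profile_0 arctan_profile_0)
  next
    case False
    define T where "T = sqrt y"
    have T: "T > 0" "y = T\<^sup>2" using assms False by (simp_all add: T_def)
    define r where "r = 2 / pi * arctan T"
    have r: "0 < r" "r < 1" using T arctan_ubound[of T] by (simp_all add: r_def field_simps)
    have a: "arctan_profile y = r / T" using arctan_profile_pos[of y] T by (simp add: r_def)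
    have "y * (arctan_profile y)\<^sup>2 = r\<^sup>2" unfolding a using T by (simp add: power_divide)
    moreover have "tan_profile (r\<^sup>2) = T / r" using tan_profile_square[OF r(1)] by (simp add: r_def tan_arctan)
    ultimately show ?thesis using r T(1) a by (simp add: power_less_one_iff)
  qed
  then show "y * (arctan_profile y)\<^sup>2 < 1" "arctan_profile y * tan_profile (y * (arctan_profile y)\<^sup>2) = 1" by auto
qed


section \<open>The blow-up of a ball as a punctured projective plane\<close>

text \<open>
  The total space of the tautological line bundle of the projective line is the blow-up of \<open>\<complex>\<^sup>2\<close>
  at the origin, and it is covered by two copies of \<open>\<complex>\<^sup>2\<close> with blow-down maps \<open>(a, b) \<mapsto> (a, ab)\<close>
  and \<open>(a, b) \<mapsto> (ab, a)\<close>. Over the unit ball these two copies become \<open>blowup_dom\<close>.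
\<close>

text \<open>The square of the norm of \<open>(1, b)\<close>, so that \<open>(fst z \<bullet> fst z) * wt (snd z)\<close> is the squared distance of
  the blown-down point from the origin.\<close>

definition wt :: "complex \<Rightarrow> real" where "wt b = 1 + b \<bullet> b"

definition blowup_dom :: "(complex \<times> complex) set" where
  "blowup_dom = {z. (fst z \<bullet> fst z) * wt (snd z) < 1}"

text \<open>The point with blow-up coordinates \<open>z\<close>, in affine coordinates of the projective plane.
  The conjugation is the antilinear isomorphism between the tautological line bundle and its dual,
  the normal bundle of the line at infinity.\<close>

definition fibre_coord :: "complex \<times> complex \<Rightarrow> complex \<times> complex" where
  "fibre_coord z = (cnj (fst z) * of_real (wt (snd z) * tan_profile ((fst z \<bullet> fst z) * wt (snd z))), snd z)"

definition fibre_coord_inv :: "complex \<times> complex \<Rightarrow> complex \<times> complex" where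
  "fibre_coord_inv y = (cnj (fst y) * of_real (arctan_profile ((fst y \<bullet> fst y) / wt (snd y)) / wt (snd y)), snd y)"

lemma wt_pos: "wt b > 0" by (simp add: wt_def add_pos_nonneg)

lemma inner_mult_of_real: "(cnj a * of_real r) \<bullet> (cnj a * of_real r) = (a \<bullet> a) * r\<^sup>2" for a :: complex
  by (simp add: dot_square_norm norm_mult power_mult_distrib)

lemma fibre_coord_inverse1:
  assumes "z \<in> blowup_dom"
  shows "fibre_coord_inv (fibre_coord z) = z"
proof -
  obtain a b where z: "z = (a, b)" by (cases z)
  define N where "N = wt b"
  define x where "x = (a \<bullet> a) * N"
  have N: "N > 0" by (simp add: N_def wt_pos)
  have x: "0 \<le> x" "x < 1" using assms N by (simp_all add: x_def z N_def blowup_dom_def)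
  have y: "(a \<bullet> a) * (N * tan_profile x)\<^sup>2 / N = x * (tan_profile x)\<^sup>2"
    using N by (simp add: x_def power2_eq_square)
  have "fibre_coord_inv (fibre_coord z) =
    (a * of_real (N * tan_profile x) * of_real (arctan_profile (x * (tan_profile x)\<^sup>2) / N), b)"
    unfolding z fibre_coord_def fibre_coord_inv_def fst_conv snd_conv N_def[symmetric] x_def[symmetric]
      inner_mult_of_real y by simp
  also have "a * of_real (N * tan_profile x) * of_real (arctan_profile (x * (tan_profile x)\<^sup>2) / N)
    = a * of_real (tan_profile x * arctan_profile (x * (tan_profile x)\<^sup>2))"
    unfolding mult.assoc of_real_mult[symmetric] using N by simp
  finally show ?thesis by (simp add: profile_inverse1[OF x] z)
qed

lemma fibre_coord_inverse2: "fibre_coord_inv y \<in> blowup_dom" "fibre_coord (fibre_coord_inv y) = y"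
proof -
  obtain s b where y: "y = (s, b)" by (cases y)
  define N where "N = wt b"
  define v where "v = (s \<bullet> s) / N"
  have N: "N > 0" by (simp add: N_def wt_pos)
  have v: "0 \<le> v" using N by (simp add: v_def)
  have x: "(s \<bullet> s) * (arctan_profile v / N)\<^sup>2 * N = v * (arctan_profile v)\<^sup>2"
    using N by (simp add: v_def power2_eq_square)
  show "fibre_coord_inv y \<in> blowup_dom"
    unfolding y blowup_dom_def fibre_coord_inv_def mem_Collect_eq fst_conv snd_conv N_def[symmetric] v_def[symmetric]
      inner_mult_of_real x by (rule profile_inverse2(1)[OF v])
  have "fibre_coord (fibre_coord_inv y) =
    (s * of_real (arctan_profile v / N) * of_real (N * tan_profile (v * (arctan_profile v)\<^sup>2)), b)"
    unfolding y fibre_coord_def fibre_coord_inv_def fst_conv snd_conv N_def[symmetric] v_def[symmetric]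
      inner_mult_of_real x by simp
  also have "s * of_real (arctan_profile v / N) * of_real (N * tan_profile (v * (arctan_profile v)\<^sup>2))
    = s * of_real (arctan_profile v * tan_profile (v * (arctan_profile v)\<^sup>2))"
    unfolding mult.assoc of_real_mult[symmetric] using N by simp
  finally show "fibre_coord (fibre_coord_inv y) = y" by (simp add: profile_inverse2(2)[OF v] y)
qed

lemma open_blowup_dom: "open blowup_dom"
  unfolding blowup_dom_def wt_def by (intro open_Collect_less continuous_intros)

lemma ldiff_fibre_coord:
  assumes "z \<in> blowup_dom"
  shows "ldiff fibre_coord z"
proof (rule ldiffI[where g = fibre_coord_inv])
  have wt: "smooth_at (\<lambda>z. wt (snd z)) y" for y :: "complex \<times> complex"
    unfolding wt_def by (intro smooth)
  have nn: "0 \<le> (fst y \<bullet> fst y) / wt (snd y)" for y :: "complex \<times> complex"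
    using wt_pos[of "snd y"] by simp
  have n: "wt b \<noteq> 0" for b using wt_pos[of b] by simp
  show "smooth_at fibre_coord z"
    unfolding fibre_coord_def[abs_def]
    by (intro smooth_at_Pair smooth_at_rules smooth_at_ident wt
        smooth_at_compose[of tan_profile "\<lambda>z. (fst z \<bullet> fst z) * wt (snd z)"] smooth_at_tan_profile)
      (use assms wt_pos[of "snd z"] in \<open>auto simp: blowup_dom_def\<close>)
  show "smooth_at fibre_coord_inv (fibre_coord z)"
    unfolding fibre_coord_inv_def[abs_def]
    by (intro smooth_at_Pair smooth_at_rules smooth_at_ident wt smooth_at_divide n
        smooth_at_compose[of arctan_profile "\<lambda>y. (fst y \<bullet> fst y) / wt (snd y)"] smooth_at_arctan_profile nn)
  show "eventually (\<lambda>z. fibre_coord_inv (fibre_coord z) = z) (nhds z)"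
    using eventually_nhds_in_open[OF open_blowup_dom assms] by eventually_elim (rule fibre_coord_inverse1)
  show "eventually (\<lambda>y. fibre_coord (fibre_coord_inv y) = y) (nhds (fibre_coord z))"
    by (simp add: fibre_coord_inverse2)
qed

section \<open>Affine charts of the projective plane\<close>

lemma cline_scale:
  assumes "c \<noteq> 0"
  shows "cline (c * x, c * y, c * z) = cline (x, y, z)"
proof -
  show ?thesis unfolding cline_def prod.case
  proof (intro equalityI subsetI; elim CollectE exE conjE)
    fix u a assume "u = (a * (c * x), a * (c * y), a * (c * z))"
    then have "u = ((a * c) * x, (a * c) * y, (a * c) * z)" by (simp add: mult.assoc)
    then show "u \<in> {(a * x, a * y, a * z) |a. True}" by blast
  next
    fix u a assume "u = (a * x, a * y, a * z)"
    then have "u = ((a / c) * (c * x), (a / c) * (c * y), (a / c) * (c * z))" using assms by simp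
    then show "u \<in> {(a * (c * x), a * (c * y), a * (c * z)) |a. True}" by blast
  qed
qed

lemma cline_eqD:
  assumes "cline (x, y, z) = cline (x', y', z')"
  shows "\<exists>c. x = c * x' \<and> y = c * y' \<and> z = c * z'"
proof -
  have "(x, y, z) \<in> cline (x, y, z)" unfolding cline_def by (simp, rule exI[of _ 1], simp)
  then show ?thesis unfolding assms by (auto simp: cline_def)
qed

definition affine_chart0 :: "complex \<times> complex \<Rightarrow> (complex \<times> complex \<times> complex) set" where
  "affine_chart0 z = cline (1, fst z, snd z)"

text \<open>The two affine charts which meet the line at infinity. They cover the complement of \<open>[1:0:0]\<close>, and
  the line is where the first coordinate vanishes.\<close>

definition affine_chart :: "bool \<Rightarrow> complex \<times> complex \<Rightarrow> (complex \<times> complex \<times> complex) set" where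
  "affine_chart j z = (if j then cline (fst z, 1, snd z) else cline (fst z, snd z, 1))"

lemma CP2_eq: "CP2 = {(range \<psi>, the_inv \<psi>) | \<psi>. \<psi> = affine_chart0 \<or> (\<exists>j. \<psi> = affine_chart j)}"
proof -
  have eqs: "affine_chart0 = (\<lambda>(a, b). cline (1, a, b))" "affine_chart True = (\<lambda>(a, b). cline (a, 1, b))"
    "affine_chart False = (\<lambda>(a, b). cline (a, b, 1))"
    by (auto simp: affine_chart0_def affine_chart_def)
  have "\<psi> \<in> {affine_chart0, affine_chart True, affine_chart False} \<longleftrightarrow> \<psi> = affine_chart0 \<or> (\<exists>j. \<psi> = affine_chart j)"
    for \<psi> unfolding ex_bool_eq insert_iff empty_iff by blast
  then show ?thesis unfolding CP2_def eqs[symmetric] by (simp only:)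
qed

lemma inj_affine_chart0: "inj affine_chart0"
  by (rule injI) (auto simp: affine_chart0_def prod_eq_iff dest!: cline_eqD)

lemma inj_affine: "inj (affine_chart j)"
  by (rule injI) (auto simp: affine_chart_def prod_eq_iff dest!: cline_eqD split: if_splits)

text \<open>The transition map between these two charts, in both directions.\<close>

definition affine_swap :: "complex \<times> complex \<Rightarrow> complex \<times> complex" where
  "affine_swap z = (fst z / snd z, 1 / snd z)"

lemma affine_swap:
  assumes "snd z \<noteq> 0"
  shows "affine_chart j z = affine_chart (\<not> j) (affine_swap z)"
  using cline_scale[OF assms, of "fst z / snd z" "if j then 1 / snd z else 1" "if j then 1 else 1 / snd z"] assms
  by (auto simp: affine_chart_def affine_swap_def)

lemma affine_neq_snd: "affine_chart j z = affine_chart (\<not> j) z' \<Longrightarrow> snd z \<noteq> 0"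
  by (auto simp: affine_chart_def split: if_splits dest!: cline_eqD)

lemma affine_chart_eq_chart0:
  assumes "fst z \<noteq> 0"
  shows "affine_chart True z = affine_chart0 (1 / fst z, snd z / fst z)" "affine_chart False z = affine_chart0 (snd z / fst z, 1 / fst z)"
  using cline_scale[OF assms, of 1 "1 / fst z" "snd z / fst z"] cline_scale[OF assms, of 1 "snd z / fst z" "1 / fst z"] assms
  by (simp_all add: affine_chart_def affine_chart0_def)

lemma affine_chart_eq_chart0D: "affine_chart j z = affine_chart0 z' \<Longrightarrow> fst z \<noteq> 0"
  by (cases z') (auto simp: affine_chart_def affine_chart0_def split: if_splits dest!: cline_eqD)

lemma inj_charts_CP2: "inj_charts CP2"
  unfolding inj_charts_def CP2_eq using inj_affine inj_affine_chart0 by (auto intro!: inj_on_the_inv_into)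

lemma smooth_param_CP2_chart:
  assumes "inj \<psi>" "eventually (\<lambda>z. P z = \<psi> (m z)) (nhds w)" "ldiff m w"
  shows "eventually (\<lambda>z. P z \<in> range \<psi>) (nhds w) \<and> ldiff (\<lambda>z. the_inv \<psi> (P z)) w"
proof
  show "eventually (\<lambda>z. P z \<in> range \<psi>) (nhds w)" using assms(2) by eventually_elim simp
  have "eventually (\<lambda>z. m z = the_inv \<psi> (P z)) (nhds w)"
    using assms(2) by eventually_elim (simp add: the_inv_f_f[OF assms(1)])
  then show "ldiff (\<lambda>z. the_inv \<psi> (P z)) w" by (rule ldiff_cong[OF assms(3)])
qed

lemma eventually_fst_neq: "fst w \<noteq> x \<Longrightarrow> eventually (\<lambda>z. fst z \<noteq> x) (nhds w)"
  for w :: "complex \<times> complex"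
  by (rule eventually_avoid_pole[of fst]) (auto intro: smooth_at_bounded_linear bounded_linear_fst)

lemma eventually_snd_neq: "snd w \<noteq> x \<Longrightarrow> eventually (\<lambda>z. snd z \<noteq> x) (nhds w)"
  for w :: "complex \<times> complex"
  by (rule eventually_avoid_pole[of snd]) (auto intro: smooth_at_bounded_linear bounded_linear_snd)

lemma ldiff_affine_swap:
  assumes "snd w \<noteq> 0"
  shows "ldiff affine_swap w"
proof (rule ldiffI[where g = affine_swap])
  have ev: "eventually (\<lambda>z. affine_swap (affine_swap z) = z) (nhds w)" if "snd w \<noteq> 0" for w
    using eventually_snd_neq[OF that] by eventually_elim (simp add: affine_swap_def)
  have sm: "smooth_at affine_swap w" if "snd w \<noteq> 0" for w
    unfolding affine_swap_def[abs_def] by (intro smooth that)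
  have "snd (affine_swap w) \<noteq> 0" using assms by (simp add: affine_swap_def)
  then show "smooth_at affine_swap w" "smooth_at affine_swap (affine_swap w)"
    "eventually (\<lambda>z. affine_swap (affine_swap z) = z) (nhds w)"
    "eventually (\<lambda>z. affine_swap (affine_swap z) = z) (nhds (affine_swap w))"
    using sm ev assms by auto
qed

lemma smooth_param_affine: "smooth_param CP2 (affine_chart j) w"
  unfolding smooth_param_def
proof (intro allI impI)
  fix U \<phi> assume "(U, \<phi>) \<in> CP2" and w: "affine_chart j w \<in> U"
  then obtain \<psi> where \<psi>: "U = range \<psi>" "\<phi> = the_inv \<psi>" "\<psi> = affine_chart0 \<or> \<psi> = affine_chart j \<or> \<psi> = affine_chart (\<not> j)"
    unfolding CP2_eq by (cases j) (auto, metis+)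
  have "\<exists>m. eventually (\<lambda>z. affine_chart j z = \<psi> (m z)) (nhds w) \<and> ldiff m w"
    using \<psi>(3)
  proof (elim disjE)
    assume \<psi>0: "\<psi> = affine_chart0"
    obtain z' where "affine_chart j w = affine_chart0 z'" using w unfolding \<psi>(1) \<psi>0 by blast
    then have f: "fst w \<noteq> 0" by (rule affine_chart_eq_chart0D)
    have ev: "eventually (\<lambda>z. fst z \<noteq> 0) (nhds w)" using eventually_fst_neq[OF f] .
    show ?thesis
    proof (cases j)
      case True
      have "ldiff (\<lambda>z. (1 / fst z, snd z / fst z)) w"
        by (rule ldiffI[where g = "\<lambda>z. (1 / fst z, snd z / fst z)"])
          (use f in \<open>auto intro!: smooth eventually_mono[OF ev] eventually_mono[OF eventually_fst_neq]\<close>)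
      moreover have "eventually (\<lambda>z. affine_chart j z = \<psi> (1 / fst z, snd z / fst z)) (nhds w)"
        using ev by eventually_elim (simp add: \<psi>0 True affine_chart_eq_chart0)
      ultimately show ?thesis by (intro exI[of _ "\<lambda>z. (1 / fst z, snd z / fst z)"]) simp
    next
      case False
      have "ldiff (\<lambda>z. (snd z / fst z, 1 / fst z)) w"
        by (rule ldiffI[where g = "\<lambda>z. (1 / snd z, fst z / snd z)"])
          (use f in \<open>auto intro!: smooth eventually_mono[OF ev] eventually_mono[OF eventually_snd_neq]\<close>)
      moreover have "eventually (\<lambda>z. affine_chart j z = \<psi> (snd z / fst z, 1 / fst z)) (nhds w)"
        using ev by eventually_elim (simp add: \<psi>0 False affine_chart_eq_chart0)
      ultimately show ?thesis by (intro exI[of _ "\<lambda>z. (snd z / fst z, 1 / fst z)"]) simp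
    qed
  next
    assume "\<psi> = affine_chart j" then show ?thesis using ldiff_ident by (intro exI[of _ "\<lambda>z. z"]) auto
  next
    assume \<psi>s: "\<psi> = affine_chart (\<not> j)"
    then have s: "snd w \<noteq> 0" using affine_neq_snd w \<psi>(1) by blast
    have "eventually (\<lambda>z. affine_chart j z = \<psi> (affine_swap z)) (nhds w)"
      using eventually_snd_neq[OF s] by eventually_elim (simp add: \<psi>s affine_swap)
    then show ?thesis using ldiff_affine_swap[OF s] by blast
  qed
  moreover have "inj \<psi>" using \<psi>(3) inj_affine inj_affine_chart0 by auto
  ultimately show "eventually (\<lambda>z. affine_chart j z \<in> U) (nhds w) \<and> ldiff (\<lambda>z. \<phi> (affine_chart j z)) w"
    using smooth_param_CP2_chart \<psi>(1,2) by blast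
qed

lemma inj_charts_CP2_bar: "inj_charts CP2_bar"
  unfolding CP2_bar_def by (intro inj_charts_remodel inj_charts_CP2) (auto intro!: injI)

lemma smooth_param_CP2_bar:
  assumes "z \<in> blowup_dom"
  shows "smooth_param CP2_bar (\<lambda>z. affine_chart j (fibre_coord z)) z"
proof -
  have "ldiff (\<lambda>(a, b). (cnj a, b)) x" for x
    by (rule ldiff_linear[where g = "\<lambda>(a, b). (cnj a, b)"]) (auto intro!: linearI)
  then have "smooth_param CP2_bar (affine_chart j) (fibre_coord z)"
    unfolding CP2_bar_def by (intro smooth_param_remodel smooth_param_affine)
  then show ?thesis by (rule smooth_param_comp) (rule ldiff_fibre_coord[OF assms])
qed

lemma CP2_bar_cover:
  assumes "(U, \<phi>) \<in> CP2_bar" "y \<in> U" "y \<noteq> CP2_ball 0"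
  shows "\<exists>j. \<exists>z\<in>blowup_dom. affine_chart j (fibre_coord z) = y"
proof -
  have b: "CP2_ball 0 = cline (1, 0, 0)" by (simp add: CP2_ball_def zero_prod_def)
  have "\<exists>\<psi> z. y = \<psi> z \<and> (\<psi> = affine_chart0 \<or> (\<exists>j. \<psi> = affine_chart j))"
    using assms(1,2) unfolding CP2_bar_def remodel_atlas_def CP2_eq by blast
  then have "\<exists>j z. affine_chart j z = y"
  proof (elim exE conjE disjE)
    fix \<psi> z assume y: "y = \<psi> z" "\<psi> = affine_chart0"
    then consider "fst z \<noteq> 0" | "snd z \<noteq> 0" using assms(3) unfolding y b affine_chart0_def by metis
    then show ?thesis
    proof cases
      case 1
      have "affine_chart True (1 / fst z, snd z / fst z) = y"
        using affine_chart_eq_chart0(1)[of "(1 / fst z, snd z / fst z)"] 1 by (simp add: y)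
      then show ?thesis by blast
    next
      case 2
      have "affine_chart False (1 / snd z, fst z / snd z) = y"
        using affine_chart_eq_chart0(2)[of "(1 / snd z, fst z / snd z)"] 2 by (simp add: y)
      then show ?thesis by blast
    qed
  qed blast
  then show ?thesis using fibre_coord_inverse2 by metis
qed


section \<open>Blowing down\<close>

definition blowdown :: "bool \<Rightarrow> complex \<times> complex \<Rightarrow> complex \<times> complex" where
  "blowdown j z = (if j then (fst z, fst z * snd z) else (fst z * snd z, fst z))"

text \<open>The transition map between the two coordinate systems of the blow-up, in both directions.\<close>

definition blowup_swap :: "complex \<times> complex \<Rightarrow> complex \<times> complex" where
  "blowup_swap z = (fst z * snd z, 1 / snd z)"

lemma norm_blowdown: "(norm (blowdown j z))\<^sup>2 = (fst z \<bullet> fst z) * wt (snd z)"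
  by (auto simp: blowdown_def norm_Pair norm_mult wt_def dot_square_norm power_mult_distrib algebra_simps)

lemma blowup_dom_iff: "z \<in> blowup_dom \<longleftrightarrow> norm (blowdown j z) < 1"
  by (simp add: blowup_dom_def abs_square_less_1 flip: norm_blowdown[of j])

lemma ex_blowdown:
  assumes "v \<noteq> 0"
  shows "\<exists>j z. fst z \<noteq> 0 \<and> blowdown j z = v"
proof (cases "fst v = 0")
  case True
  then show ?thesis using assms
    by (intro exI[of _ False] exI[of _ "(snd v, 0)"]) (auto simp: blowdown_def prod_eq_iff)
next
  case False
  then show ?thesis
    by (intro exI[of _ True] exI[of _ "(fst v, snd v / fst v)"]) (auto simp: blowdown_def prod_eq_iff)
qed

lemma wt_inverse: "b \<noteq> 0 \<Longrightarrow> (b \<bullet> b) * wt (1 / b) = wt b"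
  by (simp add: wt_def dot_square_norm norm_divide power_divide field_simps)

lemma inner_mult: "(a * b) \<bullet> (a * b) = (a \<bullet> a) * (b \<bullet> b)" for a b :: complex
  by (simp add: dot_square_norm norm_mult power_mult_distrib)

lemma blowup_swap_dom:
  assumes "snd z \<noteq> 0"
  shows "blowup_swap z \<in> blowup_dom \<longleftrightarrow> z \<in> blowup_dom"
  using wt_inverse[OF assms] by (simp add: blowup_dom_def blowup_swap_def inner_mult mult.assoc)

text \<open>The radial rescaling depends only on the distance from the origin, which both coordinate
  systems of the blow-up compute alike; so it is compatible with their transition maps.\<close>

lemma fibre_coord_swap:
  assumes "snd z \<noteq> 0"
  shows "fibre_coord (blowup_swap z) = affine_swap (fibre_coord z)"
proof -
  obtain a b where z: "z = (a, b)" by (cases z)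
  have b: "b \<noteq> 0" using assms z by simp
  have x: "((a * b) \<bullet> (a * b)) * wt (1 / b) = (a \<bullet> a) * wt b"
    using wt_inverse[OF b] by (simp add: inner_mult mult.assoc)
  have "cnj b * of_real (wt (1 / b)) = of_real (wt b) / b"
    using b wt_inverse[OF b]
    by (simp add: eq_divide_eq) (metis complex_norm_square dot_square_norm mult.commute mult.left_commute of_real_mult of_real_power)
  then have "cnj (a * b) * of_real (wt (1 / b) * t) = cnj a * of_real (wt b * t) / b" for t
    by (simp add: algebra_simps)
  then show ?thesis
    by (simp add: z fibre_coord_def affine_swap_def blowup_swap_def x)
qed

lemma affine_blowup_swap:
  assumes "snd z \<noteq> 0"
  shows "affine_chart j (fibre_coord z) = affine_chart (\<not> j) (fibre_coord (blowup_swap z))"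
  using affine_swap[of "fibre_coord z" j] assms by (simp add: fibre_coord_swap) (simp add: fibre_coord_def)

lemma hdiffI:
  assumes "ldiff h w" "eventually (\<lambda>z. (h has_derivative D z) (at z)) (nhds w)" "\<And>z v. D z (I v) = I (D z v)"
  shows "hdiff I h w"
  unfolding hdiff_def
proof
  show "eventually (\<lambda>z. \<forall>v. frechet_derivative h (at z) (I v) = I (frechet_derivative h (at z) v)) (nhds w)"
    using assms(2) by eventually_elim (use assms(3) frechet_derivative_at in metis)
qed (rule assms(1))

lemma hdiff_linear:
  assumes "linear h" "linear g" "\<And>x. g (h x) = x" "\<And>y. h (g y) = y" "\<And>v. h (I v) = I (h v)"
  shows "hdiff I h w"
proof (rule hdiffI[where D = "\<lambda>_. h"])
  show "eventually (\<lambda>z. (h has_derivative h) (at z)) (nhds w)"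
    using bounded_linear_imp_has_derivative[OF assms(1)[unfolded linear_conv_bounded_linear]] by simp
  show "ldiff h w" by (rule ldiff_linear[OF assms(1-4)])
qed (rule assms(5))

lemma hdiff_blowup_swap:
  assumes "snd w \<noteq> 0"
  shows "hdiff (cmul \<i>) blowup_swap w"
proof (rule hdiffI)
  have ev: "eventually (\<lambda>z. snd z \<noteq> 0) (nhds w)" if "snd w \<noteq> 0" for w :: "complex \<times> complex"
    by (rule eventually_snd_neq[OF that])
  have sm: "smooth_at blowup_swap w" if "snd w \<noteq> 0" for w
    unfolding blowup_swap_def[abs_def] by (intro smooth that)
  have s: "snd (blowup_swap w) \<noteq> 0" using assms by (simp add: blowup_swap_def)
  have inv: "blowup_swap (blowup_swap z) = z" if "snd z \<noteq> 0" for z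
    using that by (simp add: blowup_swap_def)
  show "ldiff blowup_swap w"
    by (rule ldiffI[OF sm[OF assms] sm[OF s] eventually_mono[OF ev[OF assms]] eventually_mono[OF ev[OF s]]])
      (simp_all add: inv)
  show "eventually (\<lambda>z. (blowup_swap has_derivative
     (\<lambda>v. (fst z * snd v + fst v * snd z, - (snd v / (snd z)\<^sup>2)))) (at z)) (nhds w)"
    using ev[OF assms] unfolding blowup_swap_def[abs_def]
    by eventually_elim (auto intro!: derivative_eq_intros simp: power2_eq_square)
qed (simp add: cmul_def algebra_simps)

lemma hdiff_blowdown:
  assumes "fst w \<noteq> 0"
  shows "hdiff (cmul \<i>) (blowdown j) w"
proof (rule hdiffI)
  show "eventually (\<lambda>z. (blowdown j has_derivative
     (\<lambda>v. if j then (fst v, fst z * snd v + fst v * snd z) else (fst z * snd v + fst v * snd z, fst v))) (at z)) (nhds w)"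
    unfolding blowdown_def[abs_def] by (intro always_eventually allI) (cases j; auto intro!: derivative_eq_intros)
  show "ldiff (blowdown j) w"
  proof (cases j)
    case True
    have "smooth_at (\<lambda>v. (fst v, snd v / fst v)) (blowdown True w)"
      using assms by (auto intro!: smooth simp: blowdown_def)
    moreover have "smooth_at (blowdown True) w" unfolding blowdown_def[abs_def] if_True by (intro smooth)
    moreover have "fst (blowdown True w) \<noteq> 0" using assms by (simp add: blowdown_def)
    ultimately have "ldiff (blowdown True) w" using assms
      by (intro ldiffI[where g = "\<lambda>v. (fst v, snd v / fst v)"])
        (auto simp: blowdown_def intro!: eventually_mono[OF eventually_fst_neq[of _ 0]])
    then show ?thesis using True by simp
  next
    case False
    have 1: "smooth_at (\<lambda>v. (snd v, fst v / snd v)) (blowdown False w)"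
      using assms by (auto intro!: smooth simp: blowdown_def)
    have 2: "smooth_at (blowdown False) w" unfolding blowdown_def[abs_def] if_False by (intro smooth)
    have 3: "snd (blowdown False w) \<noteq> 0" using assms by (simp add: blowdown_def)
    have "ldiff (blowdown False) w"
      by (rule ldiffI[OF 2 1 eventually_mono[OF eventually_fst_neq[OF assms]] eventually_mono[OF eventually_snd_neq[OF 3]]])
        (auto simp: blowdown_def)
    then show ?thesis using False by simp
  qed
qed (auto simp: cmul_def algebra_simps)

text \<open>The gluing map of the connected sum identifies a punctured ball with its blow-up away from the
  exceptional line: at distance \<open>t\<close> from the centre of the blown-down ball, the point of the
  projective plane lies at distance \<open>1 - t\<close> from \<open>[1:0:0]\<close>, and tangent and
  cotangent are exchanged.\<close>

lemma CP2_ball_blowdown: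
  fixes j
  assumes "z \<in> blowup_dom" "fst z \<noteq> 0"
  defines "v \<equiv> blowdown j z"
  shows "CP2_ball ((1 - norm v) *\<^sub>R (v /\<^sub>R norm v)) = affine_chart j (fibre_coord z)"
proof -
  define t where "t = norm v"
  have "v \<noteq> 0" using assms(2) by (auto simp: v_def blowdown_def zero_prod_def)
  then have t: "0 < t" "t < 1" using assms(1) blowup_dom_iff[of z j] by (simp_all add: t_def v_def)
  have t2: "(fst z \<bullet> fst z) * wt (snd z) = t\<^sup>2" by (simp add: t_def v_def norm_blowdown)
  define c where "c = cos (pi / 2 * t)"
  have "pi / 2 * t < pi / 2" "pi / 2 * t > 0" using t by simp_all
  then have c: "c > 0" unfolding c_def by (intro cos_gt_zero_pi) (use pi_gt_zero in linarith)+
  have n: "norm ((1 - t) *\<^sub>R (v /\<^sub>R t)) = 1 - t" using t by (simp add: t_def)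
  have co: "cos (pi / 2 * (1 - t)) = sin (pi / 2 * t)" "sin (pi / 2 * (1 - t)) = c"
    using sin_cos_eq[of "pi / 2 * t"] cos_sin_eq[of "pi / 2 * t"]
    by (simp_all add: c_def algebra_simps diff_divide_distrib)
  have "CP2_ball ((1 - t) *\<^sub>R (v /\<^sub>R t)) = cline (of_real (sin (pi / 2 * t)), (c / (1 - t)) *\<^sub>R ((1 - t) *\<^sub>R (v /\<^sub>R t)))"
    unfolding CP2_ball_def n co ..
  also have "(c / (1 - t)) *\<^sub>R ((1 - t) *\<^sub>R (v /\<^sub>R t)) = cmul (of_real (c / t)) v"
    using t unfolding scaleR_eq_cmul[symmetric] by (simp add: divide_inverse)
  finally have 1: "CP2_ball ((1 - t) *\<^sub>R (v /\<^sub>R t)) =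
    cline (of_real (sin (pi / 2 * t)), cmul (of_real (c / t)) v)" .
  \<comment> \<open>dividing the homogeneous coordinates by this number yields the affine ones\<close>
  define d where "d = of_real (c / t) * fst z"
  have d: "d \<noteq> 0" using c t assms(2) by (simp add: d_def)
  have "d * fst (fibre_coord z) = of_real (c / t * (fst z \<bullet> fst z) * wt (snd z) * tan_profile (t\<^sup>2))"
  proof -
    have "fst z * cnj (fst z) = of_real (fst z \<bullet> fst z)"
      unfolding dot_square_norm by (rule complex_norm_square[symmetric])
    moreover have "d * fst (fibre_coord z) =
        of_real (c / t) * (fst z * cnj (fst z)) * of_real (wt (snd z) * tan_profile (t\<^sup>2))"
      unfolding d_def fibre_coord_def fst_conv t2 by (simp only: mult.assoc)
    ultimately show ?thesis by (simp only: of_real_mult mult.assoc)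
  qed
  also have "c / t * (fst z \<bullet> fst z) * wt (snd z) * tan_profile (t\<^sup>2) = c / t * t\<^sup>2 * (tan (pi / 2 * t) / t)"
    using t2 tan_profile_square[OF t(1)] by (simp add: mult.assoc)
  also have "\<dots> = sin (pi / 2 * t)"
    using t c unfolding tan_def c_def[symmetric] by (simp add: power2_eq_square)
  finally have 2: "d * fst (fibre_coord z) = of_real (sin (pi / 2 * t))" .
  have "cmul (of_real (c / t)) v = (if j then (d * 1, d * snd z) else (d * snd z, d * 1))"
    by (simp add: v_def blowdown_def cmul_def d_def)
  then have "cline (of_real (sin (pi / 2 * t)), cmul (of_real (c / t)) v) = affine_chart j (fibre_coord z)"
    unfolding 2[symmetric] using cline_scale[OF d, of "fst (fibre_coord z)" 1 "snd z"]
      cline_scale[OF d, of "fst (fibre_coord z)" "snd z" 1]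
    by (auto simp: affine_chart_def fibre_coord_def)
  then show ?thesis using 1 unfolding t_def by simp
qed

section \<open>The complex structure on the connected sum\<close>

definition glue_equiv ::
  "nat \<Rightarrow> (nat \<Rightarrow> 'e::euclidean_space \<Rightarrow> 'a) \<Rightarrow> ('e \<Rightarrow> 'b) \<Rightarrow> ('a + nat \<times> 'b) rel" where
  "glue_equiv k i j = (glue_rel k i j \<union> (glue_rel k i j)\<inverse>)\<^sup>*"

lemma sym_glue_equiv: "sym (glue_equiv k i j)"
  unfolding glue_equiv_def by (intro sym_rtrancl) (auto intro: symI)

lemma trans_glue_equiv: "trans (glue_equiv k i j)"
  unfolding glue_equiv_def by (rule trans_rtrancl)

lemma glue_proj_eq_iff: "glue_proj k i j x = glue_proj k i j y \<longleftrightarrow> (x, y) \<in> glue_equiv k i j"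
proof -
  have "equiv UNIV (glue_equiv k i j)"
    using sym_glue_equiv trans_glue_equiv by (auto intro!: equivI simp: glue_equiv_def refl_on_def)
  from eq_equiv_class_iff[OF this, of x y] show ?thesis by (simp add: glue_proj_def glue_equiv_def)
qed

text \<open>Germs of parametrizations that induce the same germ in the quotient by \<open>r\<close>, up to a holomorphic
  change of parameters. Unlike equality in the quotient, this is stated in the disjoint union, where
  the gluing relation can be unfolded.\<close>

definition linked :: "'x rel \<Rightarrow> ('e::euclidean_space \<Rightarrow> 'e) \<Rightarrow> ('e \<Rightarrow> 'x) \<times> 'e \<Rightarrow> ('e \<Rightarrow> 'x) \<times> 'e \<Rightarrow> bool" where
  "linked r I c d \<longleftrightarrow> (\<exists>h. hdiff I h (snd c) \<and> h (snd c) = snd d \<and>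
     eventually (\<lambda>z. (fst c z, fst d (h z)) \<in> r) (nhds (snd c)))"

lemma linked_trans:
  assumes "trans r" "linked r I a b" "linked r I b c"
  shows "linked r I a c"
proof -
  obtain h where h: "hdiff I h (snd a)" "h (snd a) = snd b"
    "eventually (\<lambda>z. (fst a z, fst b (h z)) \<in> r) (nhds (snd a))"
    using assms(2) by (auto simp: linked_def)
  obtain h' where h': "hdiff I h' (h (snd a))" "h' (h (snd a)) = snd c"
    "eventually (\<lambda>z. (fst b z, fst c (h' z)) \<in> r) (nhds (h (snd a)))"
    using assms(3) unfolding linked_def h(2)[symmetric] by blast
  have "eventually (\<lambda>z. (fst a z, fst c (h' (h z))) \<in> r) (nhds (snd a))"
    using h(3) smooth_at_eventually_comp[OF ldiff_smooth[OF hdiff_ldiff[OF h(1)]] h'(3)]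
    by eventually_elim (use assms(1) in \<open>blast dest: transD\<close>)
  then show ?thesis unfolding linked_def using hdiff_comp[OF h(1) h'(1)] h'(2) by blast
qed

lemma linked_sym:
  assumes "sym r" "linked r I a b"
  shows "linked r I b a"
proof -
  obtain h where h: "hdiff I h (snd a)" "h (snd a) = snd b"
    "eventually (\<lambda>z. (fst a z, fst b (h z)) \<in> r) (nhds (snd a))"
    using assms(2) by (auto simp: linked_def)
  obtain g where g: "hdiff I g (snd b)" "g (snd b) = snd a" "eventually (\<lambda>y. h (g y) = y) (nhds (snd b))"
    using hdiff_inverse[OF h(1)] unfolding h(2) by blast
  have "eventually (\<lambda>y. (fst a (g y), fst b (h (g y))) \<in> r) (nhds (snd b))"
    by (rule smooth_at_eventually_comp[OF ldiff_smooth[OF hdiff_ldiff[OF g(1)]]]) (simp only: g(2) h(3))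
  then have "eventually (\<lambda>y. (fst b y, fst a (g y)) \<in> r) (nhds (snd b))"
    using g(3) by eventually_elim (use assms(1) in \<open>auto dest: symD\<close>)
  then show ?thesis unfolding linked_def using g by blast
qed

lemma hopf_cmul:
  assumes "p \<ge> 1" "\<zeta> ^ p = 1" "cmod \<zeta> = 1"
  shows "hopf p (cmul (\<zeta> * of_real (exp (2 * pi * of_int n))) z) = hopf p z"
proof (cases "z = 0")
  case True
  then show ?thesis by (simp add: cmul_def zero_prod_def)
next
  case False
  define e where "e = exp (2 * pi * of_int n)"
  have e: "e > 0" "ln e = 2 * pi * of_int n" by (simp_all add: e_def)
  have n: "norm (cmul (\<zeta> * of_real e) z) = e * norm z"
    using e assms(3) by (simp add: norm_cmul norm_mult)
  have "cmul (\<zeta> * of_real e) z = e *\<^sub>R cmul \<zeta> z"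
    unfolding scaleR_eq_cmul cmul_cmul by (simp add: mult.commute)
  then have "cmul (\<zeta> * of_real e) z /\<^sub>R (e * norm z) = cmul \<zeta> (z /\<^sub>R norm z)"
    using e by (simp add: cmul_scaleR)
  moreover have "cis (- ln (e * norm z)) = cis (- ln (norm z))"
  proof -
    have "- ln (e * norm z) = - ln (norm z) + 2 * pi * of_int (- n)"
      using e False by (simp add: ln_mult)
    also have "cis \<dots> = cis (- ln (norm z)) * cis (2 * pi * of_int (- n))" by (simp only: cis_mult)
    also have "cis (2 * pi * of_int (- n)) = 1" by (rule cis_multiple_2pi) simp
    finally show ?thesis by simp
  qed
  ultimately show ?thesis unfolding hopf_def e_def[symmetric] n by (simp add: lens_proj_cmul[OF assms(1,2)])
qed

text \<open>The deck transformations of the covering \<open>hopf\<close> are complex linear; this is why the complex structure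
  of \<open>\<complex>\<^sup>2\<close> descends.\<close>

lemma hopf_eqD:
  assumes "p \<ge> 1" "w \<noteq> 0" "w' \<noteq> 0" "hopf p w = hopf p w'"
  shows "\<exists>\<zeta> n. \<zeta> ^ p = 1 \<and> cmod \<zeta> = 1 \<and> w' = cmul (\<zeta> * of_real (exp (2 * pi * of_int n))) w"
proof -
  obtain \<zeta> where z: "\<zeta> ^ p = 1" "cmod \<zeta> = 1" "w' /\<^sub>R norm w' = cmul \<zeta> (w /\<^sub>R norm w)"
    using lens_proj_eqD[OF assms(1)] assms(4) unfolding hopf_def by (metis fst_conv)
  have "cis (- ln (norm w)) = cis (- ln (norm w'))" using assms(4) by (simp add: hopf_def)
  then have "sin (- ln (norm w)) = sin (- ln (norm w')) \<and> cos (- ln (norm w)) = cos (- ln (norm w'))"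
    by (simp add: complex_eq_iff)
  then obtain n :: int where n: "- ln (norm w) = - ln (norm w') + 2 * pi * of_int n"
    using sin_cos_eq_iff by blast
  then have "ln (norm w') = ln (norm w) + 2 * pi * of_int n" by simp
  then have "exp (ln (norm w')) = exp (ln (norm w)) * exp (2 * pi * of_int n)" by (simp add: exp_add)
  then have nw: "norm w' = norm w * exp (2 * pi * of_int n)" using assms by simp
  have "w' = norm w' *\<^sub>R (w' /\<^sub>R norm w')" using assms by simp
  also have "\<dots> = (norm w * exp (2 * pi * of_int n)) *\<^sub>R cmul \<zeta> (w /\<^sub>R norm w)" unfolding z(3) unfolding nw ..
  also have "\<dots> = exp (2 * pi * of_int n) *\<^sub>R cmul \<zeta> w" using assms by (simp add: cmul_scaleR)
  also have "\<dots> = cmul (\<zeta> * of_real (exp (2 * pi * of_int n))) w"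
    unfolding scaleR_eq_cmul cmul_cmul by (simp only: mult.commute)
  finally show ?thesis using z by blast
qed

definition ball_affine :: "nat \<Rightarrow> nat \<Rightarrow> nat \<Rightarrow> complex \<times> complex \<Rightarrow> complex \<times> complex" where
  "ball_affine p k l v = exp (real l / real (k + 1)) *\<^sub>R ((1, 0) + (1 / (4 * real p * real (k + 1))) *\<^sub>R v)"

lemma lens_circle_ball_eq: "lens_circle_ball p k l v = hopf p (ball_affine p k l v)"
  by (simp add: lens_circle_ball_def hopf_def ball_affine_def Let_def)

lemma ball_affine_nonzero:
  assumes "p \<ge> 1" "norm v < 1"
  shows "ball_affine p k l v \<noteq> 0"
proof
  assume "ball_affine p k l v = 0"
  then have "(1, 0) + (1 / (4 * real p * real (k + 1))) *\<^sub>R v = 0" by (simp add: ball_affine_def)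
  then have v: "(1 / (4 * real p * real (k + 1))) *\<^sub>R v = - (1, 0)" by (simp add: add_eq_0_iff)
  have "norm ((1 / (4 * real p * real (k + 1))) *\<^sub>R v) = 1" unfolding v by (simp add: norm_Pair)
  moreover have "1 \<le> real p * real (k + 1)"
    using mult_mono[of 1 "real p" 1 "real (k + 1)"] assms(1) by simp
  then have "1 / (4 * real p * real (k + 1)) \<le> 1" "0 \<le> 1 / (4 * real p * real (k + 1))"
    by (simp_all add: divide_le_eq_1)
  then have "norm ((1 / (4 * real p * real (k + 1))) *\<^sub>R v) \<le> norm v"
    unfolding norm_scaleR by (intro mult_left_le_one_le) auto
  ultimately show False using assms(2) by linarith
qed

lemma hdiff_ball_affine:
  assumes "p \<ge> 1"
  shows "hdiff (cmul \<i>) (ball_affine p k l) v"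
proof -
  define c where "c = exp (real l / real (k + 1))"
  define e where "e = 1 / (4 * real p * real (k + 1))"
  have c: "c \<noteq> 0" and e: "e \<noteq> 0" using assms by (simp_all add: c_def e_def)
  have eq: "ball_affine p k l = (\<lambda>v. c *\<^sub>R ((1, 0) + e *\<^sub>R v))"
    by (simp add: ball_affine_def fun_eq_iff c_def e_def)
  show ?thesis unfolding eq
  proof (rule hdiffI)
    show "ldiff (\<lambda>v. c *\<^sub>R ((1, 0) + e *\<^sub>R v)) v"
      by (rule ldiffI[where g = "\<lambda>y. inverse e *\<^sub>R (inverse c *\<^sub>R y - (1, 0))"])
        (use c e in \<open>auto intro!: smooth\<close>)
    show "eventually (\<lambda>v. ((\<lambda>v. c *\<^sub>R ((1, 0) + e *\<^sub>R v)) has_derivative (\<lambda>u. c *\<^sub>R (e *\<^sub>R u))) (at v)) (nhds v)"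
      by (intro always_eventually allI) (auto intro!: derivative_eq_intros)
  qed (simp add: cmul_scaleR)
qed

lemma hdiff_cmul:
  assumes "c \<noteq> 0"
  shows "hdiff (cmul \<i>) (cmul c) w"
  by (rule hdiff_linear[where g = "cmul (inverse c)"])
    (use assms in \<open>simp_all add: linear_cmul_complex mult.commute\<close>)

text \<open>Parametrizations of the disjoint union of \<open>L(p,1) \<times> S\<^sup>1\<close> and of countably many blow-ups of a ball, one
  for each index \<open>l\<close>.\<close>

definition pieces ::
  "nat \<Rightarrow> ((complex \<times> complex \<Rightarrow> (complex \<times> complex) set \<times> complex + nat \<times> (complex \<times> complex \<times> complex) set)
     \<times> complex \<times> complex) set" where
  "pieces p = {(\<lambda>z. Inl (hopf p z), w) | w. w \<noteq> 0} \<union>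
     {(\<lambda>z. Inr (l, affine_chart j (fibre_coord z)), w) | l j w. w \<in> blowup_dom}"

lemma pieces_lens: "w \<noteq> 0 \<Longrightarrow> (\<lambda>z. Inl (hopf p z), w) \<in> pieces p"
  unfolding pieces_def by blast

lemma pieces_blowup: "w \<in> blowup_dom \<Longrightarrow> (\<lambda>z. Inr (l, affine_chart j (fibre_coord z)), w) \<in> pieces p"
  unfolding pieces_def by blast

context
  fixes p k :: nat
  assumes p: "p \<ge> 1"
begin

abbreviation "glued \<equiv> glue_equiv k (lens_circle_ball p k) CP2_ball"

text \<open>Before gluing, two parametrizations of one point differ by a deck transformation of \<open>hopf\<close> or by the
  transition map of the blow-up.\<close>

lemma linked_refl_case:
  assumes "c \<in> pieces p" "d \<in> pieces p" "fst c (snd c) = fst d (snd d)"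
  shows "linked glued (cmul \<i>) c d"
proof -
  have refl: "(x, x) \<in> glued" for x by (simp add: glue_equiv_def)
  consider (lens) w w' where "c = (\<lambda>z. Inl (hopf p z), w)" "d = (\<lambda>z. Inl (hopf p z), w')" "w \<noteq> 0" "w' \<noteq> 0"
    | (cp) l j w l' j' w' where "c = (\<lambda>z. Inr (l, affine_chart j (fibre_coord z)), w)"
      "d = (\<lambda>z. Inr (l', affine_chart j' (fibre_coord z)), w')" "w \<in> blowup_dom" "w' \<in> blowup_dom"
    using assms unfolding pieces_def by auto
  then show ?thesis
  proof cases
    case lens
    then have "hopf p w = hopf p w'" using assms(3) by simp
    then obtain \<zeta> n where z: "\<zeta> ^ p = 1" "cmod \<zeta> = 1" "w' = cmul (\<zeta> * of_real (exp (2 * pi * of_int n))) w"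
      using hopf_eqD[OF p] lens by blast
    let ?c = "\<zeta> * of_real (exp (2 * pi * of_int n))"
    have "?c \<noteq> 0" using z(2) by auto
    then have "hdiff (cmul \<i>) (cmul ?c) w" by (rule hdiff_cmul)
    then show ?thesis
      unfolding linked_def lens fst_conv snd_conv
      by (intro exI[of _ "cmul ?c"]) (simp add: z(3) hopf_cmul[OF p z(1,2)] refl)
  next
    case cp
    then have eq: "l' = l" "affine_chart j (fibre_coord w) = affine_chart j' (fibre_coord w')"
      using assms(3) by simp_all
    have inj: "v = v'" if "affine_chart j' (fibre_coord v) = affine_chart j' (fibre_coord v')"
      "v \<in> blowup_dom" "v' \<in> blowup_dom" for v v'
      using injD[OF inj_affine that(1)] fibre_coord_inverse1[OF that(2)] fibre_coord_inverse1[OF that(3)] by metis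
    show ?thesis
    proof (cases "j' = j")
      case True
      then have "w = w'" using inj[of w w'] eq cp by simp
      then show ?thesis
        unfolding linked_def cp fst_conv snd_conv
        by (intro exI[of _ "\<lambda>z. z"]) (simp add: hdiff_ident True eq refl)
    next
      case False
      then have j: "j' = (\<not> j)" by auto
      have s: "snd w \<noteq> 0"
        using affine_neq_snd[of j "fibre_coord w" "fibre_coord w'"] eq(2) unfolding j
        by (simp add: fibre_coord_def)
      have "blowup_swap w = w'"
        using affine_blowup_swap[OF s, of j] eq(2) blowup_swap_dom[OF s] cp(3,4) inj[of "blowup_swap w" w']
        unfolding j by simp
      moreover have "eventually (\<lambda>z. (Inr (l, affine_chart j (fibre_coord z)),
          Inr (l', affine_chart j' (fibre_coord (blowup_swap z)))) \<in> glued) (nhds w)"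
        using eventually_snd_neq[OF s]
        by eventually_elim (use affine_blowup_swap in \<open>simp add: j eq(1) refl\<close>)
      ultimately show ?thesis
        unfolding linked_def cp fst_conv snd_conv using hdiff_blowup_swap[OF s] by blast
    qed
  qed
qed

text \<open>One gluing step is the blow-down followed by the affine embedding of the ball.\<close>

lemma linked_glue_case:
  assumes "(x, y) \<in> glue_rel k (lens_circle_ball p k) CP2_ball"
  shows "\<exists>c\<in>pieces p. \<exists>d\<in>pieces p. fst c (snd c) = x \<and> fst d (snd d) = y \<and> linked glued (cmul \<i>) d c"
proof -
  obtain l t u where l: "l < k" and t: "0 < t" "t < 1" and u: "norm u = 1"
    and x: "x = Inl (lens_circle_ball p k l (t *\<^sub>R u))" and y: "y = Inr (l, CP2_ball ((1 - t) *\<^sub>R u))"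
    using assms unfolding glue_rel_def by blast
  have "t *\<^sub>R u \<noteq> 0" using t u by auto
  then obtain j z where z: "fst z \<noteq> 0" "blowdown j z = t *\<^sub>R u" using ex_blowdown by blast
  have nt: "norm (t *\<^sub>R u) = t" using t u by simp
  have dom: "z \<in> blowup_dom" using z(2) nt t blowup_dom_iff[of z j] by simp
  let ?h = "\<lambda>z. ball_affine p k l (blowdown j z)"
  let ?c = "(\<lambda>z. Inl (hopf p z), ?h z)" and ?d = "(\<lambda>z. Inr (l, affine_chart j (fibre_coord z)), z)"
  have "?h z \<noteq> 0" using ball_affine_nonzero[OF p] z(2) nt t by simp
  then have "?c \<in> pieces p" "?d \<in> pieces p" using dom pieces_lens pieces_blowup by blast+
  moreover have "fst ?c (snd ?c) = x" by (simp add: x lens_circle_ball_eq z(2))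
  moreover have "fst ?d (snd ?d) = y"
    using CP2_ball_blowdown[OF dom z(1), of j] nt t by (simp add: y z(2))
  moreover have "linked glued (cmul \<i>) ?d ?c"
    unfolding linked_def fst_conv snd_conv
  proof (intro exI[of _ ?h] conjI refl)
    show "hdiff (cmul \<i>) ?h z"
      by (rule hdiff_comp[OF hdiff_blowdown[OF z(1)] hdiff_ball_affine[OF p]])
    have "eventually (\<lambda>z. z \<in> blowup_dom) (nhds z)" by (rule eventually_nhds_in_open[OF open_blowup_dom dom])
    then show "eventually (\<lambda>z. (Inr (l, affine_chart j (fibre_coord z)), Inl (hopf p (?h z))) \<in> glued) (nhds z)"
      using eventually_fst_neq[OF z(1)]
    proof eventually_elim
      case (elim z)
      let ?v = "blowdown j z"
      have v: "0 < norm ?v" "norm ?v < 1"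
        using elim blowup_dom_iff[of z j] by (auto simp: blowdown_def zero_prod_def)
      have "?v = norm ?v *\<^sub>R (?v /\<^sub>R norm ?v)" "norm (?v /\<^sub>R norm ?v) = 1" using v by auto
      then have "(Inl (lens_circle_ball p k l ?v), Inr (l, CP2_ball ((1 - norm ?v) *\<^sub>R (?v /\<^sub>R norm ?v))))
          \<in> glue_rel k (lens_circle_ball p k) CP2_ball"
        unfolding glue_rel_def using l v by (intro CollectI exI[of _ l] exI[of _ "norm ?v"] exI[of _ "?v /\<^sub>R norm ?v"]) simp
      then have "(Inl (hopf p (?h z)), Inr (l, affine_chart j (fibre_coord z))) \<in> glue_rel k (lens_circle_ball p k) CP2_ball"
        unfolding lens_circle_ball_eq CP2_ball_blowdown[OF elim] .
      then show ?case unfolding glue_equiv_def by (intro r_into_rtrancl) auto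
    qed
  qed
  ultimately show ?thesis by blast
qed

text \<open>Every step in a chain of gluings contributes a holomorphic change of parameters, and between
  consecutive steps the parametrizations of the intermediate point are matched.\<close>

lemma pieces_linked:
  assumes "(x, y) \<in> glued" "c \<in> pieces p" "d \<in> pieces p" "fst c (snd c) = x" "fst d (snd d) = y"
  shows "linked glued (cmul \<i>) c d"
  using assms(1)[unfolded glue_equiv_def] assms(2-)
proof (induction arbitrary: d rule: rtrancl_induct)
  case base
  then show ?case using linked_refl_case by simp
next
  case (step y y')
  have "\<exists>a\<in>pieces p. \<exists>b\<in>pieces p. fst a (snd a) = y \<and> fst b (snd b) = y' \<and> linked glued (cmul \<i>) a b"
    using step.hyps(2)
  proof
    assume "(y, y') \<in> glue_rel k (lens_circle_ball p k) CP2_ball"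
    then show ?thesis using linked_glue_case linked_sym[OF sym_glue_equiv] by blast
  next
    assume "(y, y') \<in> (glue_rel k (lens_circle_ball p k) CP2_ball)\<inverse>"
    then show ?thesis using linked_glue_case by blast
  qed
  then obtain a b where ab: "a \<in> pieces p" "b \<in> pieces p" "fst a (snd a) = y" "fst b (snd b) = y'"
    "linked glued (cmul \<i>) a b" by blast
  have "linked glued (cmul \<i>) c a" using step.IH step.prems ab by blast
  moreover have "linked glued (cmul \<i>) b d" using linked_refl_case ab step.prems by simp
  ultimately show ?case using linked_trans[OF trans_glue_equiv] ab(5) by blast
qed

abbreviation "proj \<equiv> glue_proj k (lens_circle_ball p k) CP2_ball"

text \<open>The holomorphic change of parameters provides the lift to the piece from which a chart was pushed.\<close>

lemma smooth_param_sum: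
  assumes c: "c \<in> pieces p"
  shows "smooth_param (lens_circle_sum_CP2_bar p k) (\<lambda>z. proj (fst c z)) (snd c)"
  unfolding lens_circle_sum_CP2_bar_def connected_sum_copies_def
proof (intro smooth_param_Un smooth_param_UN smooth_param_push inj_charts_restrict inj_charts_lens_circle inj_charts_CP2_bar)
  fix U \<phi> x
  assume U: "(U, \<phi>) \<in> restrict_atlas (- {lens_circle_ball p k l 0 |l. l < k}) (lens_circle p)" "x \<in> U"
    and x: "proj (Inl x) = proj (fst c (snd c))"
  from U obtain U0 where U0: "(U0, \<phi>) \<in> lens_circle p" "x \<in> U0" "x \<notin> {lens_circle_ball p k l 0 |l. l < k}"
    by (auto simp: restrict_atlas_def)
  obtain w where w: "w \<noteq> 0" "hopf p w = x" using lens_circle_hopf[OF U0(1,2)] by blast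
  let ?d = "(\<lambda>z. Inl (hopf p z), w)"
  have "?d \<in> pieces p" using w(1) by (rule pieces_lens)
  moreover have "(fst c (snd c), Inl x) \<in> glued" using x by (simp flip: glue_proj_eq_iff)
  ultimately have "linked glued (cmul \<i>) c ?d" using pieces_linked c w by simp
  then obtain h where h: "hdiff (cmul \<i>) h (snd c)" "h (snd c) = w"
    "eventually (\<lambda>z. (fst c z, Inl (hopf p (h z))) \<in> glued) (nhds (snd c))"
    by (auto simp: linked_def)
  have sp: "smooth_param (lens_circle p) (\<lambda>z. hopf p (h z)) (snd c)"
    by (rule smooth_param_comp[OF _ hdiff_ldiff[OF h(1)]]) (simp add: h(2) smooth_param_lens_circle[OF p w(1)])
  show "\<exists>R. R (snd c) = x \<and> smooth_param (restrict_atlas (- {lens_circle_ball p k l 0 |l. l < k}) (lens_circle p)) R (snd c)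
      \<and> eventually (\<lambda>z. proj (Inl (R z)) = proj (fst c z)) (nhds (snd c))"
  proof (intro exI[of _ "\<lambda>z. hopf p (h z)"] conjI)
    show "hopf p (h (snd c)) = x" by (simp add: h(2) w(2))
    have "eventually (\<lambda>z. \<forall>l\<in>{..<k}. hopf p (h z) \<noteq> lens_circle_ball p k l 0) (nhds (snd c))"
      by (intro eventually_ball_finite ballI smooth_param_avoid[OF inj_charts_lens_circle sp U0(1)])
        (use U0 h(2) w(2) in auto)
    then show "smooth_param (restrict_atlas (- {lens_circle_ball p k l 0 |l. l < k}) (lens_circle p)) (\<lambda>z. hopf p (h z)) (snd c)"
      by (intro smooth_param_restrict sp) (auto elim: eventually_mono)
    show "eventually (\<lambda>z. proj (Inl (hopf p (h z))) = proj (fst c z)) (nhds (snd c))"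
      using h(3) by eventually_elim (simp flip: glue_proj_eq_iff)
  qed
next
  fix l U \<phi> y
  assume U: "(U, \<phi>) \<in> restrict_atlas (- {CP2_ball 0}) CP2_bar" "y \<in> U"
    and y: "proj (Inr (l, y)) = proj (fst c (snd c))"
  from U obtain U0 where U0: "(U0, \<phi>) \<in> CP2_bar" "y \<in> U0" "y \<noteq> CP2_ball 0"
    by (auto simp: restrict_atlas_def)
  obtain j w where w: "w \<in> blowup_dom" "affine_chart j (fibre_coord w) = y" using CP2_bar_cover[OF U0] by blast
  let ?Q = "\<lambda>z. affine_chart j (fibre_coord z)"
  let ?d = "(\<lambda>z. Inr (l, ?Q z), w)"
  have "?d \<in> pieces p" using w(1) by (rule pieces_blowup)
  moreover have "(fst c (snd c), Inr (l, y)) \<in> glued" using y by (simp flip: glue_proj_eq_iff)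
  ultimately have "linked glued (cmul \<i>) c ?d" using pieces_linked c w by simp
  then obtain h where h: "hdiff (cmul \<i>) h (snd c)" "h (snd c) = w"
    "eventually (\<lambda>z. (fst c z, Inr (l, ?Q (h z))) \<in> glued) (nhds (snd c))"
    by (auto simp: linked_def)
  have sp: "smooth_param CP2_bar (\<lambda>z. ?Q (h z)) (snd c)"
    by (rule smooth_param_comp[OF _ hdiff_ldiff[OF h(1)]]) (simp add: h(2) smooth_param_CP2_bar[OF w(1)])
  show "\<exists>R. R (snd c) = y \<and> smooth_param (restrict_atlas (- {CP2_ball 0}) CP2_bar) R (snd c)
      \<and> eventually (\<lambda>z. proj (Inr (l, R z)) = proj (fst c z)) (nhds (snd c))"
  proof (intro exI[of _ "\<lambda>z. ?Q (h z)"] conjI)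
    show "?Q (h (snd c)) = y" by (simp add: h(2) w(2))
    have "eventually (\<lambda>z. ?Q (h z) \<noteq> CP2_ball 0) (nhds (snd c))"
      by (rule smooth_param_avoid[OF inj_charts_CP2_bar sp U0(1)]) (use U0 h(2) w(2) in auto)
    then show "smooth_param (restrict_atlas (- {CP2_ball 0}) CP2_bar) (\<lambda>z. ?Q (h z)) (snd c)"
      by (intro smooth_param_restrict sp) (auto elim: eventually_mono)
    show "eventually (\<lambda>z. proj (Inr (l, ?Q (h z))) = proj (fst c z)) (nhds (snd c))"
      using h(3) by eventually_elim (simp flip: glue_proj_eq_iff)
  qed
qed

lemma pieces_cover:
  assumes "(U, \<phi>) \<in> lens_circle_sum_CP2_bar p k" "q \<in> U"
  shows "\<exists>c\<in>pieces p. proj (fst c (snd c)) = q"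
proof -
  consider (lens) x U0 \<phi>0 where "q = proj (Inl x)" "(U0, \<phi>0) \<in> lens_circle p" "x \<in> U0"
    | (cp) l y U0 \<phi>0 where "q = proj (Inr (l, y))" "(U0, \<phi>0) \<in> CP2_bar" "y \<in> U0" "y \<noteq> CP2_ball 0"
    using assms unfolding lens_circle_sum_CP2_bar_def connected_sum_copies_def push_atlas_def restrict_atlas_def
    by auto blast+
  then show ?thesis
  proof cases
    case lens
    then obtain w where "w \<noteq> 0" "hopf p w = x" using lens_circle_hopf by blast
    then show ?thesis using lens(1) by (intro bexI[OF _ pieces_lens]) auto
  next
    case cp
    then obtain j z where "z \<in> blowup_dom" "affine_chart j (fibre_coord z) = y" using CP2_bar_cover by blast
    then show ?thesis using cp(1)
      by (intro bexI[OF _ pieces_blowup]) auto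
  qed
qed

lemma eventually_pieces:
  assumes "(P, w) \<in> pieces p"
  shows "eventually (\<lambda>z. (P, z) \<in> pieces p) (nhds w)"
proof -
  consider "P = (\<lambda>z. Inl (hopf p z))" "w \<noteq> 0"
    | l j where "P = (\<lambda>z. Inr (l, affine_chart j (fibre_coord z)))" "w \<in> blowup_dom"
    using assms by (auto simp: pieces_def)
  then show ?thesis
  proof cases
    case 1
    show ?thesis using t1_space_nhds[OF 1(2)] by eventually_elim (simp add: 1(1) pieces_lens)
  next
    case 2
    show ?thesis using eventually_nhds_in_open[OF open_blowup_dom 2(2)]
      by eventually_elim (simp add: 2(1) pieces_blowup)
  qed
qed

lemma inj_charts_sum: "inj_charts (lens_circle_sum_CP2_bar p k)"
proof -
  have Un: "inj_charts (A \<union> B)" if "inj_charts A" "inj_charts B"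
    for A B :: "('x, 'y) atlas" using that by (auto simp: inj_charts_def)
  have UN: "inj_charts (\<Union>l\<in>L. A l)" if "\<And>l. l \<in> L \<Longrightarrow> inj_charts (A l)"
    for A :: "nat \<Rightarrow> ('x, 'y) atlas" and L using that by (auto simp: inj_charts_def)
  show ?thesis unfolding lens_circle_sum_CP2_bar_def connected_sum_copies_def
    by (intro Un UN inj_charts_push inj_charts_restrict inj_charts_lens_circle inj_charts_CP2_bar)
qed

lemma holomorphic_cover_sum:
  "holomorphic_cover (lens_circle_sum_CP2_bar p k) ((\<lambda>c. (\<lambda>z. proj (fst c z), snd c)) ` pieces p) (cmul \<i>)"
proof
  show "cmul \<i> (b1 + b2) = cmul \<i> b1 + cmul \<i> b2" "cmul \<i> (r *\<^sub>R b1) = r *\<^sub>R cmul \<i> b1" for b1 b2 r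
    by (simp_all add: linear_add[OF linear_cmul_complex] cmul_scaleR)
  show "cmul \<i> (cmul \<i> v) = - v" for v by (simp add: cmul_def prod_eq_iff)
next
  fix U \<phi> assume U: "(U, \<phi>) \<in> lens_circle_sum_CP2_bar p k"
  then show "inj_on \<phi> U" using inj_charts_sum by (auto simp: inj_charts_def)
  fix q assume "q \<in> U"
  then show "\<exists>P w. (P, w) \<in> (\<lambda>c. (\<lambda>z. proj (fst c z), snd c)) ` pieces p \<and> P w = q"
    using pieces_cover[OF U] by blast
next
  fix P w assume "(P, w) \<in> (\<lambda>c. (\<lambda>z. proj (fst c z), snd c)) ` pieces p"
  then obtain c where c: "c \<in> pieces p" "P = (\<lambda>z. proj (fst c z))" "w = snd c" by auto
  have "eventually (\<lambda>z. (fst c, z) \<in> pieces p) (nhds w)" using eventually_pieces c by simp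
  then show "eventually (\<lambda>z. (P, z) \<in> (\<lambda>c. (\<lambda>z. proj (fst c z), snd c)) ` pieces p) (nhds w)"
  proof eventually_elim
    case (elim z)
    from imageI[OF this, of "\<lambda>c. (\<lambda>z. proj (fst c z), snd c)"] show ?case by (simp add: c(2))
  qed
  have sp: "smooth_param (lens_circle_sum_CP2_bar p k) P w" using smooth_param_sum[OF c(1)] c by simp
  fix U \<phi> assume "(U, \<phi>) \<in> lens_circle_sum_CP2_bar p k" "P w \<in> U"
  then show "eventually (\<lambda>z. P z \<in> U) (nhds w)" "ldiff (\<lambda>z. \<phi> (P z)) w"
    using sp unfolding smooth_param_def by blast+
next
  fix P w P' w'
  assume "(P, w) \<in> (\<lambda>c. (\<lambda>z. proj (fst c z), snd c)) ` pieces p"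
    "(P', w') \<in> (\<lambda>c. (\<lambda>z. proj (fst c z), snd c)) ` pieces p" and eq: "P w = P' w'"
  then obtain c d where c: "c \<in> pieces p" "P = (\<lambda>z. proj (fst c z))" "w = snd c"
    and d: "d \<in> pieces p" "P' = (\<lambda>z. proj (fst d z))" "w' = snd d" by auto
  have "linked glued (cmul \<i>) c d"
    using pieces_linked[OF _ c(1) d(1)] eq by (simp add: c d glue_proj_eq_iff)
  then show "\<exists>h. hdiff (cmul \<i>) h w \<and> h w = w' \<and> eventually (\<lambda>z. P z = P' (h z)) (nhds w)"
    by (simp add: linked_def c d glue_proj_eq_iff)
qed

end

theorem mainTheorem7:
  fixes p k :: nat
  assumes "p \<ge> 1"
  shows "(\<exists>H J. twisted_generalized_complex_structure (lens_circle_sum_CP2_bar p k) H J) \<longleftrightarrow>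
         (\<exists>J. almost_complex_structure (lens_circle_sum_CP2_bar p k) J)"
  using holomorphic_cover.generalized_complex[OF holomorphic_cover_sum[OF assms]]
    holomorphic_cover.almost_complex[OF holomorphic_cover_sum[OF assms]] by blast

end
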